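(* Let $\mathfrak T$ be a measurable action of an inductively compact group $G$ on a standard Borel space $(X,\mathcal B)$. Let $\rho$ be a fibrewise continuous positive real-valued multiplicative cocycle over $\mathfrak T$. Then there exist a Borel subset $\widetilde X\subset X$ and a surjective Borel map $$\pi:\widetilde X\to \mathfrak M_{\mathrm{erg}}(\mathfrak T,\rho)$$ such that: (1) For any $\eta\in\mathfrak M_{\mathrm{erg}}(\mathfrak T,\rho)$ we have $\eta(\pi^{-1}(\eta))=1$. (2) For any $\nu\in\mathfrak M(\mathfrak T,\rho)$ we have $$\nu=\int_{\mathfrak M_{\mathrm{erg}}(\mathfrak T,\rho)}\eta\,d\overline\nu(\eta),\qquad\text{where }\overline\nu=\pi_*\nu.$$ In particular, for any $\nu\in\mathfrak M(\mathfrak T,\rho)$ we have $\nu(\widetilde X)=1$. (3) The correspondence $\nu\mapsto\overline\nu$ is a Borel isomorphism between the Borel spaces $\mathfrak M(\mathfrak T,\rho)$ and $\mathfrak M(\mathfrak M_{\mathrm{erg}}(\mathfrak T,\rho))$; and if $\nu\in\mathfrak M(\mathfrak T,\rho)$ and $\tilde\nu\in\mathfrak M(\mathfrak M_{\mathrm{erg}}(\mathfrak T,\rho))$ are such that $$\nu=\int_{\mathfrak M_{\mathrm{erg}}(\mathfrak T,\rho)}\eta\,d\tilde\nu(\eta),$$ then $\tilde\nu=\overline\nu$. (4) For any $\nu_1,\nu_2\in\mathfrak M(\mathfrak T,\rho)$ we have $\nu_1\ll\nu_2$ if and only if $\overline\nu_1\ll\overline\nu_2$, and $\nu_1\perp\nu_2$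 if and only if $\overline\nu_1\perp\overline\nu_2$.
   Context: A standard Borel space is a pair $(X,\mathcal B)$, $\mathcal B$ a sigma-algebra on $X$, admitting a bijection of $X$ onto the unit interval carrying $\mathcal B$ to the Borel sigma-algebra. For a space $Y$ with a Borel structure, $\mathfrak M(Y)$ is the space of Borel probability measures on $Y$, with the sigma-algebra generated by the sets $\{\nu:\nu(A)>\alpha\}$, $A\subset Y$ Borel, $\alpha\in\mathbb R$. An inductively compact group is $G=\bigcup_{n\ge1}K(n)$, where $K(1)\subset K(2)\subset\cdots$ is an ascending chain of metrizable compact groups; $G$ carries the inductive limit topology (a function on $G$ is continuous iff its restriction to every $K(n)$ is continuous) and the Borel sigma-algebra spanned by the Borel sigma-algebras of the $K(n)$. A measurable (Borel) action $\mathfrak T$ of $G$ on $X$ is an action $g\mapsto T_g$ for which $(g,x)\mapsto T_gx$, $G\times X\to X$, is Borel-measurable. A (positive real-valued multiplicative) cocycle over $\mathfrak T$ is a measurable map $\rho:G\times X\to\mathbb R_{>0}$ with $\rho(gh,x)=\rho(g,T_hx)\rho(h,x)$. It is fibrewise continuous if for every $x\in X$ the function $g\mapsto\rho(g,x)$ is continuous on $G$. With $\nu\circ T_g(A)=\nu(T_gA)$, set $$\mathfrak M(\mathfrak T,\rho)=\Big\{\nu\in\mathfrak M(X):\ \tfrac{d\nu\circ T_g}{d\nu}(x)=\rho(g,x)\text{ for all }g\in G\text{ and }\nu\text{-almost all }x\Big\}.$$ A measure $\nu\in\mathfrak M(\mathfrak T,\rho)$ is ergodic if every $G$-invariant Borel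 set $A$ has $\nu(A)=0$ or $\nu(X\setminus A)=0$; $\mathfrak M_{\mathrm{erg}}(\mathfrak T,\rho)$ is the set of ergodic measures in $\mathfrak M(\mathfrak T,\rho)$. Both sets carry the Borel structure induced from $\mathfrak M(X)$. An equality $\nu=\int\eta\,d\tilde\nu(\eta)$ means $\nu(A)=\int\eta(A)\,d\tilde\nu(\eta)$ for every Borel $A\subset X$. *)

theory Defs
  imports "HOL-Probability.Probability" "HOL-Algebra.Group_Action"
begin

text \<open>
  A Borel space is represented by a \<^typ>\<open>'a measure\<close>, of which only the underlying set and
  the sigma-algebra are used. For a Borel space \<open>Y\<close>, the Borel space of Borel probability measures
  on \<open>Y\<close> is the library's \<^const>\<open>prob_algebra\<close>: its sigma-algebra is generated by the evaluation
  maps at the measurable subsets of \<open>Y\<close>.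
\<close>

section \<open>Borel spaces\<close>

definition borel_isomorphism :: "('a \<Rightarrow> 'b) \<Rightarrow> 'a measure \<Rightarrow> 'b measure \<Rightarrow> bool" where
  "borel_isomorphism f M N \<longleftrightarrow>
     f \<in> M \<rightarrow>\<^sub>M N \<and> bij_betw f (space M) (space N) \<and> the_inv_into (space M) f \<in> N \<rightarrow>\<^sub>M M"

text \<open>The reference space is the unit interval, so that standard Borel spaces are uncountable.\<close>

definition standard_borel_space :: "'a measure \<Rightarrow> bool" where
  "standard_borel_space X \<longleftrightarrow>
     (\<exists>f. borel_isomorphism f X (restrict_space borel {0..1::real}))"

definition mutually_singular :: "'a measure \<Rightarrow> 'a measure \<Rightarrow> bool" where
  "mutually_singular M N \<longleftrightarrow>
     sets M = sets N \<and> (\<exists>A\<in>sets M. emeasure M A = 0 \<and> emeasure N (space N - A) = 0)"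

text \<open>\<open>\<nu> = \<integral> \<eta> dP(\<eta>)\<close> as measures on \<open>X\<close>, tested on every measurable set.\<close>

definition is_mixture :: "'a measure \<Rightarrow> 'a measure \<Rightarrow> 'a measure measure \<Rightarrow> bool" where
  "is_mixture X \<nu> P \<longleftrightarrow> (\<forall>A\<in>sets X. emeasure \<nu> A = (\<integral>\<^sup>+ \<eta>. emeasure \<eta> A \<partial>P))"

text \<open>Push-forward of \<open>\<nu>\<close> along a map defined only on the measurable subset \<open>D\<close>.\<close>

definition pushforward_on ::
  "'a set \<Rightarrow> ('a \<Rightarrow> 'b) \<Rightarrow> 'b measure \<Rightarrow> 'a measure \<Rightarrow> 'b measure" where
  "pushforward_on D f N \<nu> = distr (restrict_space \<nu> D) N f"

section \<open>Inductively compact groups\<close>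

definition topological_group :: "('g, 'm) monoid_scheme \<Rightarrow> 'g topology \<Rightarrow> bool" where
  "topological_group G \<tau> \<longleftrightarrow>
     group G \<and> topspace \<tau> = carrier G \<and>
     continuous_map (prod_topology \<tau> \<tau>) \<tau> (\<lambda>(g, h). g \<otimes>\<^bsub>G\<^esub> h) \<and>
     continuous_map \<tau> \<tau> (\<lambda>g. inv\<^bsub>G\<^esub> g)"

text \<open>
  The group \<open>K(n)\<close> is given by its topology; its underlying set is the topspace, and its
  multiplication is inherited from \<open>G\<close>. The inclusions \<open>K(n) \<subseteq> K(n+1)\<close> are inclusions of
  topological groups.
\<close>

locale inductively_compact_group = group G for G (structure) +
  fixes K :: "nat \<Rightarrow> 'a topology"
  assumes carrier_eq: "carrier G = (\<Union>n. topspace (K n))"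
    and subgroup_K: "\<And>n. subgroup (topspace (K n)) G"
    and topological_group_K: "\<And>n. topological_group (G\<lparr>carrier := topspace (K n)\<rparr>) (K n)"
    and compact_K: "\<And>n. compact_space (K n)"
    and metrizable_K: "\<And>n. metrizable_space (K n)"
    and ascending_K: "\<And>n. topspace (K n) \<subseteq> topspace (K (Suc n))"
    and subspace_K: "\<And>n. subtopology (K (Suc n)) (topspace (K n)) = K n"

definition inductive_limit_topology :: "(nat \<Rightarrow> 'g topology) \<Rightarrow> 'g topology" where
  "inductive_limit_topology K = topology (\<lambda>U.
     U \<subseteq> (\<Union>n. topspace (K n)) \<and> (\<forall>n. openin (K n) (U \<inter> topspace (K n))))"

lemma openin_inductive_limit_topology:
  "openin (inductive_limit_topology K) U \<longleftrightarrow>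
     U \<subseteq> (\<Union>n. topspace (K n)) \<and> (\<forall>n. openin (K n) (U \<inter> topspace (K n)))"
proof -
  have "istopology (\<lambda>U. U \<subseteq> (\<Union>n. topspace (K n)) \<and> (\<forall>n. openin (K n) (U \<inter> topspace (K n))))"
    unfolding istopology_def
  proof (intro conjI allI impI)
    fix S T n
    assume "S \<subseteq> (\<Union>n. topspace (K n)) \<and> (\<forall>n. openin (K n) (S \<inter> topspace (K n)))"
      and "T \<subseteq> (\<Union>n. topspace (K n)) \<and> (\<forall>n. openin (K n) (T \<inter> topspace (K n)))"
    moreover have "S \<inter> T \<inter> topspace (K n) = (S \<inter> topspace (K n)) \<inter> (T \<inter> topspace (K n))"
      by blast
    ultimately show "openin (K n) (S \<inter> T \<inter> topspace (K n))"
      by (metis openin_Int)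
  next
    fix \<K> n
    assume "\<forall>S\<in>\<K>. S \<subseteq> (\<Union>n. topspace (K n)) \<and> (\<forall>n. openin (K n) (S \<inter> topspace (K n)))"
    then have "openin (K n) (\<Union>S\<in>\<K>. S \<inter> topspace (K n))"
      by (intro openin_Union) blast
    moreover have "\<Union>\<K> \<inter> topspace (K n) = (\<Union>S\<in>\<K>. S \<inter> topspace (K n))"
      by blast
    ultimately show "openin (K n) (\<Union>\<K> \<inter> topspace (K n))"
      by (simp only:)
  qed blast+
  then show ?thesis
    by (simp add: inductive_limit_topology_def topology_inverse')
qed

lemma topspace_inductive_limit_topology:
  "topspace (inductive_limit_topology K) = (\<Union>n. topspace (K n))"
proof -
  have "(\<Union>m. topspace (K m)) \<inter> topspace (K n) = topspace (K n)" for n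
    by blast
  then have "openin (inductive_limit_topology K) (\<Union>n. topspace (K n))"
    by (simp add: openin_inductive_limit_topology)
  then show ?thesis
    using openin_topspace[of "inductive_limit_topology K"]
    by (intro subset_antisym openin_subset) (auto simp only: openin_inductive_limit_topology)
qed

lemma continuous_map_inductive_limit_topology:
  "continuous_map (inductive_limit_topology K) Y f \<longleftrightarrow> (\<forall>n. continuous_map (K n) Y f)"
proof -
  have "{x \<in> (\<Union>n. topspace (K n)). f x \<in> U} \<inter> topspace (K n) = {x \<in> topspace (K n). f x \<in> U}"
    for U n by blast
  then show ?thesis
    unfolding continuous_map_def topspace_inductive_limit_topology
      openin_inductive_limit_topology Pi_iff by (simp only:) blast
qed

definition inductive_limit_borel :: "(nat \<Rightarrow> 'g topology) \<Rightarrow> 'g measure" where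
  "inductive_limit_borel K =
     sigma (\<Union>n. topspace (K n)) (\<Union>n. sigma_sets (topspace (K n)) {U. openin (K n) U})"

section \<open>Measurable actions and cocycles\<close>

text \<open>
  \<^const>\<open>group_action\<close> makes each \<open>T g\<close> an extensional bijection of \<^term>\<open>space X\<close>; the
  values of \<open>T g\<close> off \<^term>\<open>space X\<close> carry no information.
\<close>

definition measurable_action ::
  "('g, 'm) monoid_scheme \<Rightarrow> (nat \<Rightarrow> 'g topology) \<Rightarrow> 'x measure \<Rightarrow> ('g \<Rightarrow> 'x \<Rightarrow> 'x) \<Rightarrow> bool" where
  "measurable_action G K X T \<longleftrightarrow>
     group_action G (space X) T \<and>
     (\<lambda>(g, x). T g x) \<in> inductive_limit_borel K \<Otimes>\<^sub>M X \<rightarrow>\<^sub>M X"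

definition positive_cocycle ::
  "('g, 'm) monoid_scheme \<Rightarrow> (nat \<Rightarrow> 'g topology) \<Rightarrow> 'x measure \<Rightarrow> ('g \<Rightarrow> 'x \<Rightarrow> 'x) \<Rightarrow>
   ('g \<Rightarrow> 'x \<Rightarrow> real) \<Rightarrow> bool" where
  "positive_cocycle G K X T \<rho> \<longleftrightarrow>
     (\<lambda>(g, x). \<rho> g x) \<in> borel_measurable (inductive_limit_borel K \<Otimes>\<^sub>M X) \<and>
     (\<forall>g\<in>carrier G. \<forall>x\<in>space X. \<rho> g x > 0) \<and>
     (\<forall>g\<in>carrier G. \<forall>h\<in>carrier G. \<forall>x\<in>space X. \<rho> (g \<otimes>\<^bsub>G\<^esub> h) x = \<rho> g (T h x) * \<rho> h x)"

definition fibrewise_continuous ::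
  "(nat \<Rightarrow> 'g topology) \<Rightarrow> 'x measure \<Rightarrow> ('g \<Rightarrow> 'x \<Rightarrow> real) \<Rightarrow> bool" where
  "fibrewise_continuous K X \<rho> \<longleftrightarrow>
     (\<forall>x\<in>space X. continuous_map (inductive_limit_topology K) euclideanreal (\<lambda>g. \<rho> g x))"

section \<open>Measures with a prescribed cocycle\<close>

text \<open>The measure \<open>\<nu> \<circ> t\<close>, for \<open>t\<close> a Borel automorphism of the space of \<open>\<nu>\<close>.\<close>

definition compose_measure :: "'x measure \<Rightarrow> ('x \<Rightarrow> 'x) \<Rightarrow> 'x measure" where
  "compose_measure \<nu> t = measure_of (space \<nu>) (sets \<nu>) (\<lambda>A. emeasure \<nu> (t ` A))"

lemma compose_measure_eq_distr:
  assumes t: "t \<in> \<nu> \<rightarrow>\<^sub>M \<nu>" and s: "s \<in> \<nu> \<rightarrow>\<^sub>M \<nu>"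
    and st: "\<And>x. x \<in> space \<nu> \<Longrightarrow> s (t x) = x" and ts: "\<And>x. x \<in> space \<nu> \<Longrightarrow> t (s x) = x"
  shows "compose_measure \<nu> t = distr \<nu> \<nu> s"
proof -
  have "t ` A = s -` A \<inter> space \<nu>" if "A \<in> sets \<nu>" for A
  proof (intro equalityI subsetI)
    fix y assume "y \<in> t ` A"
    then obtain x where "x \<in> A" "y = t x" by blast
    moreover have "x \<in> space \<nu>"
      using \<open>x \<in> A\<close> sets.sets_into_space[OF that] by (rule_tac subsetD)
    ultimately show "y \<in> s -` A \<inter> space \<nu>"
      using st[of x] measurable_space[OF t, of x] by simp
  next
    fix y assume "y \<in> s -` A \<inter> space \<nu>"
    then have "s y \<in> A" "y = t (s y)" using ts[of y] by simp_all
    then show "y \<in> t ` A" by (rule_tac image_eqI)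
  qed
  then show ?thesis
    unfolding compose_measure_def distr_def
    by (intro measure_of_eq[OF sets.space_closed]) (simp only: sets.sigma_sets_eq)
qed

text \<open>
  Absolute continuity is required explicitly because \<^const>\<open>RN_deriv\<close> has a default value when
  there is no density. The exceptional null set may depend on \<open>g\<close>.
\<close>

definition cocycle_measures ::
  "('g, 'm) monoid_scheme \<Rightarrow> 'x measure \<Rightarrow> ('g \<Rightarrow> 'x \<Rightarrow> 'x) \<Rightarrow> ('g \<Rightarrow> 'x \<Rightarrow> real) \<Rightarrow>
   'x measure measure" where
  "cocycle_measures G X T \<rho> = restrict_space (prob_algebra X)
     {\<nu>. \<forall>g\<in>carrier G. absolutely_continuous \<nu> (compose_measure \<nu> (T g)) \<and>
           (AE x in \<nu>. RN_deriv \<nu> (compose_measure \<nu> (T g)) x = ennreal (\<rho> g x))}"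

definition ergodic_measure ::
  "('g, 'm) monoid_scheme \<Rightarrow> 'x measure \<Rightarrow> ('g \<Rightarrow> 'x \<Rightarrow> 'x) \<Rightarrow> 'x measure \<Rightarrow> bool" where
  "ergodic_measure G X T \<nu> \<longleftrightarrow>
     (\<forall>A\<in>sets X. (\<forall>g\<in>carrier G. T g ` A = A) \<longrightarrow>
        emeasure \<nu> A = 0 \<or> emeasure \<nu> (space X - A) = 0)"

definition ergodic_cocycle_measures ::
  "('g, 'm) monoid_scheme \<Rightarrow> 'x measure \<Rightarrow> ('g \<Rightarrow> 'x \<Rightarrow> 'x) \<Rightarrow> ('g \<Rightarrow> 'x \<Rightarrow> real) \<Rightarrow>
   'x measure measure" where
  "ergodic_cocycle_measures G X T \<rho> =
     restrict_space (cocycle_measures G X T \<rho>) {\<nu>. ergodic_measure G X T \<nu>}"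

end

theory Submission
  imports Defs
begin

text \<open>
  For \<open>x\<close> in \<open>X\<close> let \<open>\<kappa> n x\<close> be the average of the point masses at \<open>T g x\<close>, \<open>g\<close> in \<open>K n\<close>, with
  weights \<open>\<rho> g x\<close> normalised against the Haar measure of \<open>K n\<close>. Right invariance of the Haar
  measure makes \<open>\<kappa> n\<close> measurable with respect to the \<open>K n\<close>-invariant sets, left invariance and
  invariance under inversion show that a probability measure \<open>\<nu>\<close> has the cocycle \<open>\<rho>\<close> if and only if
  \<open>\<integral> \<kappa> n x d\<nu>(x) = \<nu>\<close> for all \<open>n\<close>. For such \<open>\<nu>\<close> the kernels \<open>\<kappa> n\<close> are conditional
  probabilities with respect to a decreasing sequence of sigma-algebras, so they converge almost
  everywhere to a kernel \<open>\<pi>\<close> that does not depend on \<open>\<nu>\<close> and is a conditional probability with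
  respect to the sigma-algebra of \<open>G\<close>-invariant sets. Since that sigma-algebra is the same for all
  \<open>\<nu>\<close>, almost every \<open>\<pi> x\<close> has the cocycle \<open>\<rho>\<close> and satisfies \<open>\<pi> y = \<pi> x\<close> for \<open>\<pi> x\<close>-almost every
  \<open>y\<close>, which makes it ergodic; and an ergodic \<open>\<eta>\<close> satisfies \<open>\<pi> y = \<eta>\<close> for \<open>\<eta>\<close>-almost every \<open>y\<close>.
  The remaining assertions follow from these two facts.

  The Haar measure of a compact metrizable group comes from a bi-invariant metric: suitably
  normalised covering numbers by balls of radius \<open>\<epsilon>\<close> are invariant under all isometries, inversion
  included, and additive on sets at distance at least \<open>2 \<epsilon>\<close>; any cluster point as \<open>\<epsilon>\<close> tends to \<open>0\<close>
  is a content.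
\<close>

section \<open>Kernels along a decreasing sequence of sigma-algebras\<close>

lemma ennreal_dense_real:
  assumes "a < (b :: ennreal)"
  shows "\<exists>r\<ge>0. a < ennreal r \<and> ennreal r < b"
proof -
  from dense[OF assms] obtain z where z: "a < z" "z < b" by blast
  show ?thesis
  proof (cases z)
    case (real r)
    then show ?thesis using z by blast
  next
    case top
    then show ?thesis using z by simp
  qed
qed

lemma ennreal_dense_rat:
  assumes "a < (b :: ennreal)"
  shows "\<exists>r. a < ennreal (real_of_rat r) \<and> ennreal (real_of_rat r) < b"
proof -
  obtain s where s: "0 \<le> s" "a < ennreal s" "ennreal s < b"
    using ennreal_dense_real[OF assms] by blast
  obtain t where t: "a < ennreal t" "ennreal t < ennreal s" "0 \<le> t"
    using ennreal_dense_real[OF s(2)] by blast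
  have "t < s" using t s by (simp add: ennreal_less_iff)
  then obtain r where r: "t < real_of_rat r" "real_of_rat r < s" using of_rat_dense by blast
  have "a < ennreal (real_of_rat r)"
    using r t by (intro less_trans[OF t(1)] ennreal_lessI) linarith+
  moreover have "ennreal (real_of_rat r) < b"
    using r by (intro le_less_trans[OF ennreal_leI s(3)]) auto
  ultimately show ?thesis by blast
qed

lemma nn_integral_indicator_eq_imp_AE_eq:
  fixes u v :: "'a \<Rightarrow> ennreal"
  assumes sub: "subalgebra M F"
    and u [measurable]: "u \<in> borel_measurable F" and v [measurable]: "v \<in> borel_measurable F"
    and fin: "(\<integral>\<^sup>+x. u x \<partial>M) \<noteq> \<infinity>"
    and eq: "\<And>E. E \<in> sets F \<Longrightarrow> (\<integral>\<^sup>+x. u x * indicator E x \<partial>M) = (\<integral>\<^sup>+x. v x * indicator E x \<partial>M)"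
  shows "AE x in M. u x = v x"
proof -
  let ?R = "restr_to_subalg M F"
  have sR [measurable_cong]: "sets ?R = sets F"
    by (rule sets_restr_to_subalg[OF sub])
  have "density ?R u = density ?R v"
  proof (rule measure_eqI)
    fix E assume "E \<in> sets (density ?R u)"
    then have E [measurable]: "E \<in> sets F" by (simp add: sR)
    show "emeasure (density ?R u) E = emeasure (density ?R v) E"
      using eq[OF E] by (simp add: emeasure_density sR nn_integral_subalgebra2[OF sub])
  qed simp
  then have "AE x in ?R. u x = v x"
    by (rule finite_density_unique[THEN iffD1, rotated -1])
      (use fin in \<open>simp_all add: nn_integral_subalgebra2[OF sub]\<close>)
  then show ?thesis
    by (rule AE_restr_to_subalg[OF sub])
qed

text \<open>
  A substitute for the maximal inequality of reverse martingales: \<open>E\<close> is split according to the last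
  \<open>n < N\<close> with \<open>x \<in> Q n\<close>. As the sigma-algebras decrease, the \<open>n\<close>-th part belongs to \<open>F n\<close>.
\<close>

lemma emeasure_le_if_covered:
  fixes F :: "nat \<Rightarrow> 'a measure"
  assumes sp: "\<And>n. space (F n) = space X" and sX: "\<And>n. sets (F n) \<subseteq> sets X"
    and decr: "\<And>n. sets (F (Suc n)) \<subseteq> sets (F n)"
    and s1 [measurable_cong]: "sets \<mu>\<^sub>1 = sets X" and s2 [measurable_cong]: "sets \<mu>\<^sub>2 = sets X"
    and Q: "\<And>n. Q n \<in> sets (F n)"
    and le: "\<And>n S. S \<in> sets (F n) \<Longrightarrow> S \<subseteq> Q n \<Longrightarrow> emeasure \<mu>\<^sub>1 S \<le> emeasure \<mu>\<^sub>2 S"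
    and E: "\<And>n. E \<in> sets (F n)" "E \<subseteq> (\<Union>n. Q n)"
  shows "emeasure \<mu>\<^sub>1 E \<le> emeasure \<mu>\<^sub>2 E"
proof -
  have mono: "sets (F n) \<subseteq> sets (F m)" if "m \<le> n" for m n
    using that by (induction rule: dec_induct) (use decr in blast)+
  have meas: "E \<inter> (\<Union>n\<in>{m..<m+k}. Q n) \<in> sets (F m)" for m k
    using mono Q by (intro sets.Int E sets.finite_UN) (auto simp: subset_iff)
  have step: "emeasure \<mu>\<^sub>1 (E \<inter> (\<Union>n\<in>{m..<m+k}. Q n)) \<le> emeasure \<mu>\<^sub>2 (E \<inter> (\<Union>n\<in>{m..<m+k}. Q n))" for m k
  proof (induction k arbitrary: m)
    case (Suc k)
    let ?A = "E \<inter> (\<Union>n\<in>{Suc m..<Suc m+k}. Q n)"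
    let ?B = "(E - ?A) \<inter> Q m"
    have split: "E \<inter> (\<Union>n\<in>{m..<m + Suc k}. Q n) = ?A \<union> ?B"
    proof -
      have "{m..<m + Suc k} = insert m {Suc m..<Suc m + k}" by auto
      then show ?thesis by auto
    qed
    have A: "?A \<in> sets (F m)" using meas[of "Suc m" k] decr by blast
    have B: "?B \<in> sets (F m)" using A E Q by blast
    have AX: "?A \<in> sets X" and BX: "?B \<in> sets X" using A B sX by blast+
    have "emeasure \<mu>\<^sub>1 (?A \<union> ?B) = emeasure \<mu>\<^sub>1 ?A + emeasure \<mu>\<^sub>1 ?B"
      using AX BX by (intro plus_emeasure[symmetric]) (auto simp: s1)
    also have "\<dots> \<le> emeasure \<mu>\<^sub>2 ?A + emeasure \<mu>\<^sub>2 ?B"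
      by (intro add_mono Suc.IH le[OF B]) auto
    also have "\<dots> = emeasure \<mu>\<^sub>2 (?A \<union> ?B)"
      using AX BX by (intro plus_emeasure) (auto simp: s2)
    finally show ?case by (simp only: split)
  qed simp
  let ?S = "\<lambda>k. E \<inter> (\<Union>n\<in>{0..<0+k}. Q n)"
  have inc: "incseq ?S" by (intro incseq_SucI Int_mono UN_mono order_refl) auto
  have r: "range ?S \<subseteq> sets X" using meas[of 0] sX by blast
  have UN: "(\<Union>k. ?S k) = E"
  proof
    show "E \<subseteq> (\<Union>k. ?S k)"
    proof
      fix x assume "x \<in> E"
      then obtain n where "x \<in> Q n" using E by blast
      then show "x \<in> (\<Union>k. ?S k)" using \<open>x \<in> E\<close> by (intro UN_I[of "Suc n"]) auto
    qed
  qed auto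
  have "(\<lambda>k. emeasure \<mu>\<^sub>1 (?S k)) \<longlonglongrightarrow> emeasure \<mu>\<^sub>1 E" "(\<lambda>k. emeasure \<mu>\<^sub>2 (?S k)) \<longlonglongrightarrow> emeasure \<mu>\<^sub>2 E"
    using Lim_emeasure_incseq[of ?S \<mu>\<^sub>1] Lim_emeasure_incseq[of ?S \<mu>\<^sub>2] inc r UN
    by (simp_all add: s1 s2)
  then show ?thesis
    by (rule LIMSEQ_le) (intro exI[of _ 0] allI impI step)
qed

locale markov_tower =
  fixes X :: "'x measure" and F :: "nat \<Rightarrow> 'x measure" and \<kappa> :: "nat \<Rightarrow> 'x \<Rightarrow> 'x measure"
  assumes space_F: "space (F n) = space X"
    and sets_F: "sets (F n) \<subseteq> sets X"
    and F_Suc: "sets (F (Suc n)) \<subseteq> sets (F n)"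
    and kernel_F: "\<kappa> n \<in> F n \<rightarrow>\<^sub>M prob_algebra X"
    and proper: "A \<in> sets (F n) \<Longrightarrow> x \<in> space X \<Longrightarrow> emeasure (\<kappa> n x) A = indicator A x"
begin

definition stationary :: "'x measure set" where
  "stationary = {\<nu> \<in> space (prob_algebra X).
     \<forall>n. \<forall>A\<in>sets X. (\<integral>\<^sup>+x. emeasure (\<kappa> n x) A \<partial>\<nu>) = emeasure \<nu> A}"

definition Finf :: "'x measure" where
  "Finf = sigma (space X) (\<Inter>n. sets (F n))"

lemma stationaryD:
  assumes "\<nu> \<in> stationary"
  shows "prob_space \<nu>" "sets \<nu> = sets X" "space \<nu> = space X"
    "\<And>n A. A \<in> sets X \<Longrightarrow> (\<integral>\<^sup>+x. emeasure (\<kappa> n x) A \<partial>\<nu>) = emeasure \<nu> A"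
  using assms by (auto simp: stationary_def space_prob_algebra dest: sets_eq_imp_space_eq)

lemma sets_F_mono: "m \<le> n \<Longrightarrow> sets (F n) \<subseteq> sets (F m)"
  by (induction rule: dec_induct) (use F_Suc in blast)+

lemma measurable_F_mono: "m \<le> n \<Longrightarrow> f \<in> F n \<rightarrow>\<^sub>M N \<Longrightarrow> f \<in> F m \<rightarrow>\<^sub>M N"
  using sets_F_mono[of m n] by (auto simp: measurable_def space_F)

lemma measurable_F_X: "f \<in> F n \<rightarrow>\<^sub>M N \<Longrightarrow> f \<in> X \<rightarrow>\<^sub>M N"
  using sets_F[of n] by (auto simp: measurable_def space_F)

lemma sets_Finf: "sets Finf = (\<Inter>n. sets (F n))" and space_Finf: "space Finf = space X"
proof -
  have sub: "(\<Inter>n. sets (F n)) \<subseteq> Pow (space X)"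
    using sets.space_closed[of "F 0"] space_F[of 0] by blast
  have "sigma_algebra (space X) (\<Inter>n. sets (F n))"
    unfolding sigma_algebra_iff2
  proof (intro conjI sub ballI allI impI)
    show "{} \<in> (\<Inter>n. sets (F n))" by auto
    show "space X - s \<in> (\<Inter>n. sets (F n))" if "s \<in> (\<Inter>n. sets (F n))" for s
    proof
      fix n
      have "s \<in> sets (F n)" using that by blast
      from sets.compl_sets[OF this] show "space X - s \<in> sets (F n)" by (simp only: space_F)
    qed
    show "\<Union> (range A) \<in> (\<Inter>n. sets (F n))" if "range A \<subseteq> (\<Inter>n. sets (F n))" for A :: "nat \<Rightarrow> 'x set"
    proof
      fix n
      have "range A \<subseteq> sets (F n)" using that by blast
      then show "\<Union> (range A) \<in> sets (F n)" by (rule sets.countable_UN)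
    qed
  qed
  then show "sets Finf = (\<Inter>n. sets (F n))"
    unfolding Finf_def sets_measure_of[OF sub] by (rule sigma_algebra.sigma_sets_eq)
  show "space Finf = space X" unfolding Finf_def by (simp add: sub space_measure_of_conv)
qed

lemma sets_Finf_X: "sets Finf \<subseteq> sets X"
  using sets_F[of 0] by (auto simp: sets_Finf)

lemma measurable_Finf_F: "f \<in> Finf \<rightarrow>\<^sub>M N \<Longrightarrow> f \<in> F n \<rightarrow>\<^sub>M N"
  by (auto simp: measurable_def space_F space_Finf sets_Finf)

lemma measurable_Finf_X: "f \<in> Finf \<rightarrow>\<^sub>M N \<Longrightarrow> f \<in> X \<rightarrow>\<^sub>M N"
  using measurable_Finf_F measurable_F_X by blast

lemma measurable_FinfI: "(\<And>n. f \<in> F n \<rightarrow>\<^sub>M N) \<Longrightarrow> f \<in> Finf \<rightarrow>\<^sub>M N"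
  by (auto simp: measurable_def space_F space_Finf sets_Finf)

lemma subalgebra_Finf: "\<nu> \<in> stationary \<Longrightarrow> subalgebra \<nu> Finf"
  using sets_Finf_X by (auto simp: subalgebra_def space_Finf dest: stationaryD)

lemma kernel_space: "x \<in> space X \<Longrightarrow> \<kappa> n x \<in> space (prob_algebra X)"
  using measurable_space[OF kernel_F] by (simp add: space_F)

lemma prob_kernel: "x \<in> space X \<Longrightarrow> prob_space (\<kappa> n x)"
  and sets_kernel_eq: "x \<in> space X \<Longrightarrow> sets (\<kappa> n x) = sets X"
  using kernel_space[of x n] by (simp_all add: space_prob_algebra)

lemma space_kernel_eq: "x \<in> space X \<Longrightarrow> space (\<kappa> n x) = space X"
  by (rule sets_eq_imp_space_eq[OF sets_kernel_eq])

lemma measurable_emeasure_kernel_F [measurable]: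
  "A \<in> sets X \<Longrightarrow> (\<lambda>x. emeasure (\<kappa> n x) A) \<in> borel_measurable (F n)"
  by (rule measurable_compose[OF measurable_prob_algebraD[OF kernel_F] measurable_emeasure_subprob_algebra])

lemma measurable_emeasure_kernel_X [measurable]:
  "A \<in> sets X \<Longrightarrow> (\<lambda>x. emeasure (\<kappa> n x) A) \<in> borel_measurable X"
  by (rule measurable_F_X[OF measurable_emeasure_kernel_F])

lemma kernel_Int:
  assumes "E \<in> sets (F n)" "B \<in> sets X" "x \<in> space X"
  shows "emeasure (\<kappa> n x) (B \<inter> E) = emeasure (\<kappa> n x) B * indicator E x"
proof -
  let ?C = "space X - E"
  have C: "?C \<in> sets (F n)"
    using sets.compl_sets[OF assms(1)] by (simp only: space_F)
  have EX: "E \<in> sets (\<kappa> n x)" and CX: "?C \<in> sets (\<kappa> n x)" and BX: "B \<in> sets (\<kappa> n x)"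
    using assms C sets_F sets_kernel_eq[OF assms(3), of n] by blast+
  have "B = (B \<inter> E) \<union> (B \<inter> ?C)"
    using sets.sets_into_space[OF assms(2)] by blast
  then have "emeasure (\<kappa> n x) B = emeasure (\<kappa> n x) ((B \<inter> E) \<union> (B \<inter> ?C))"
    by (rule arg_cong)
  also have "\<dots> = emeasure (\<kappa> n x) (B \<inter> E) + emeasure (\<kappa> n x) (B \<inter> ?C)"
    by (rule plus_emeasure[symmetric]) (use EX CX BX in blast)+
  finally have split: "emeasure (\<kappa> n x) B = emeasure (\<kappa> n x) (B \<inter> E) + emeasure (\<kappa> n x) (B \<inter> ?C)" .
  have leC: "emeasure (\<kappa> n x) (B \<inter> ?C) \<le> indicator ?C x"
    unfolding proper[OF C assms(3), symmetric] by (rule emeasure_mono[OF Int_lower2 CX])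
  have leE: "emeasure (\<kappa> n x) (B \<inter> E) \<le> indicator E x"
    unfolding proper[OF assms(1,3), symmetric] by (rule emeasure_mono[OF Int_lower2 EX])
  show ?thesis
    using split leC leE by (cases "x \<in> E") auto
qed

lemma nn_integral_kernel_indicator:
  assumes \<nu>: "\<nu> \<in> stationary" and "E \<in> sets (F n)" "B \<in> sets X"
  shows "(\<integral>\<^sup>+x. emeasure (\<kappa> n x) B * indicator E x \<partial>\<nu>) = emeasure \<nu> (B \<inter> E)"
proof -
  have "B \<inter> E \<in> sets X" using assms sets_F by blast
  then have "emeasure \<nu> (B \<inter> E) = (\<integral>\<^sup>+x. emeasure (\<kappa> n x) (B \<inter> E) \<partial>\<nu>)"
    using stationaryD(4)[OF \<nu>] by simp
  also have "\<dots> = (\<integral>\<^sup>+x. emeasure (\<kappa> n x) B * indicator E x \<partial>\<nu>)"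
    using assms stationaryD(3)[OF \<nu>] by (intro nn_integral_cong kernel_Int) auto
  finally show ?thesis by simp
qed

lemma emeasure_density_indicator:
  assumes "\<nu> \<in> stationary" "B \<in> sets X" "S \<in> sets X"
  shows "emeasure (density \<nu> (indicator B)) S = emeasure \<nu> (B \<inter> S)"
proof -
  note [simp, measurable_cong] = stationaryD(2)[OF assms(1)]
  show ?thesis using assms(2,3) by (simp add: emeasure_density flip: indicator_inter_arith)
qed

lemma tail_bound_lower:
  assumes \<nu>: "\<nu> \<in> stationary" and B: "B \<in> sets X" and E: "E \<in> sets Finf"
    and sub: "E \<subseteq> {x. \<exists>n. \<beta> \<le> emeasure (\<kappa> n x) B}"
  shows "\<beta> * emeasure \<nu> E \<le> emeasure \<nu> (B \<inter> E)"
proof -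
  note [simp] = stationaryD(2,3)[OF \<nu>]
  note [measurable_cong] = stationaryD(2)[OF \<nu>]
  let ?d = "density \<nu> (indicator B)"
  have EX: "E \<in> sets X" using E sets_Finf_X by blast
  note eqd = emeasure_density_indicator[OF \<nu> B]
  define Q where "Q n = {x \<in> space (F n). \<beta> \<le> emeasure (\<kappa> n x) B}" for n
  have "emeasure (scale_measure \<beta> \<nu>) E \<le> emeasure ?d E"
  proof (rule emeasure_le_if_covered[where F=F and X=X and Q=Q])
    show "Q n \<in> sets (F n)" for n unfolding Q_def using B by measurable
    show "E \<subseteq> (\<Union>n. Q n)" using sub sets.sets_into_space[OF E] by (auto simp: Q_def space_F space_Finf)
    show "E \<in> sets (F n)" for n using E by (auto simp: sets_Finf)
    fix n S assume S: "S \<in> sets (F n)" "S \<subseteq> Q n"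
    then have SX: "S \<in> sets X" using sets_F by blast
    have "emeasure (scale_measure \<beta> \<nu>) S = (\<integral>\<^sup>+x. \<beta> * indicator S x \<partial>\<nu>)"
      using SX by (simp add: nn_integral_cmult_indicator)
    also have "\<dots> \<le> (\<integral>\<^sup>+x. emeasure (\<kappa> n x) B * indicator S x \<partial>\<nu>)"
      using S(2) by (intro nn_integral_mono) (auto simp: Q_def indicator_def)
    also have "\<dots> = emeasure ?d S"
      using nn_integral_kernel_indicator[OF \<nu> S(1) B] eqd[OF SX] by simp
    finally show "emeasure (scale_measure \<beta> \<nu>) S \<le> emeasure ?d S" .
  qed (use space_F sets_F F_Suc in simp_all)
  then show ?thesis using eqd[OF EX] by simp
qed

lemma tail_bound_upper:
  assumes \<nu>: "\<nu> \<in> stationary" and B: "B \<in> sets X" and E: "E \<in> sets Finf"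
    and sub: "E \<subseteq> {x. \<exists>n. emeasure (\<kappa> n x) B \<le> \<alpha>}"
  shows "emeasure \<nu> (B \<inter> E) \<le> \<alpha> * emeasure \<nu> E"
proof -
  note [simp] = stationaryD(2,3)[OF \<nu>]
  note [measurable_cong] = stationaryD(2)[OF \<nu>]
  let ?d = "density \<nu> (indicator B)"
  have EX: "E \<in> sets X" using E sets_Finf_X by blast
  note eqd = emeasure_density_indicator[OF \<nu> B]
  define Q where "Q n = {x \<in> space (F n). emeasure (\<kappa> n x) B \<le> \<alpha>}" for n
  have "emeasure ?d E \<le> emeasure (scale_measure \<alpha> \<nu>) E"
  proof (rule emeasure_le_if_covered[where F=F and X=X and Q=Q])
    show "Q n \<in> sets (F n)" for n unfolding Q_def using B by measurable
    show "E \<subseteq> (\<Union>n. Q n)" using sub sets.sets_into_space[OF E] by (auto simp: Q_def space_F space_Finf)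
    show "E \<in> sets (F n)" for n using E by (auto simp: sets_Finf)
    fix n S assume S: "S \<in> sets (F n)" "S \<subseteq> Q n"
    then have SX: "S \<in> sets X" using sets_F by blast
    have "emeasure ?d S = (\<integral>\<^sup>+x. emeasure (\<kappa> n x) B * indicator S x \<partial>\<nu>)"
      using nn_integral_kernel_indicator[OF \<nu> S(1) B] eqd[OF SX] by simp
    also have "\<dots> \<le> (\<integral>\<^sup>+x. \<alpha> * indicator S x \<partial>\<nu>)"
      using S(2) by (intro nn_integral_mono) (auto simp: Q_def indicator_def)
    also have "\<dots> = emeasure (scale_measure \<alpha> \<nu>) S"
      using SX by (simp add: nn_integral_cmult_indicator)
    finally show "emeasure ?d S \<le> emeasure (scale_measure \<alpha> \<nu>) S" .
  qed (use space_F sets_F F_Suc in simp_all)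
  then show ?thesis using eqd[OF EX] by simp
qed

definition upper :: "'x set \<Rightarrow> 'x \<Rightarrow> ennreal" where
  "upper B x = limsup (\<lambda>n. emeasure (\<kappa> n x) B)"

definition lower :: "'x set \<Rightarrow> 'x \<Rightarrow> ennreal" where
  "lower B x = liminf (\<lambda>n. emeasure (\<kappa> n x) B)"

lemma measurable_upper [measurable]: "B \<in> sets X \<Longrightarrow> upper B \<in> borel_measurable Finf"
proof (rule measurable_FinfI)
  fix m assume B: "B \<in> sets X"
  have "(\<lambda>x. limsup (\<lambda>n. emeasure (\<kappa> (n + m) x) B)) \<in> borel_measurable (F m)"
    using measurable_F_mono[OF _ measurable_emeasure_kernel_F[OF B], of m]
    by (intro borel_measurable_limsup) simp
  moreover have "upper B = (\<lambda>x. limsup (\<lambda>n. emeasure (\<kappa> (n + m) x) B))"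
    by (rule ext) (simp only: upper_def limsup_shift_k[of "\<lambda>n. emeasure (\<kappa> n _) B" m])
  ultimately show "upper B \<in> borel_measurable (F m)" by simp
qed

lemma measurable_lower [measurable]: "B \<in> sets X \<Longrightarrow> lower B \<in> borel_measurable Finf"
proof (rule measurable_FinfI)
  fix m assume B: "B \<in> sets X"
  have "(\<lambda>x. liminf (\<lambda>n. emeasure (\<kappa> (n + m) x) B)) \<in> borel_measurable (F m)"
    using measurable_F_mono[OF _ measurable_emeasure_kernel_F[OF B], of m]
    by (intro borel_measurable_liminf) simp
  moreover have "lower B = (\<lambda>x. liminf (\<lambda>n. emeasure (\<kappa> (n + m) x) B))"
    by (rule ext) (simp only: lower_def liminf_shift_k[of "\<lambda>n. emeasure (\<kappa> n _) B" m])
  ultimately show "lower B \<in> borel_measurable (F m)" by simp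
qed

lemma AE_lower_eq_upper:
  assumes \<nu>: "\<nu> \<in> stationary" and B [measurable]: "B \<in> sets X"
  shows "AE x in \<nu>. lower B x = upper B x"
proof -
  interpret prob_space \<nu> by (rule stationaryD[OF \<nu>])
  note [measurable_cong] = stationaryD(2)[OF \<nu>]
  \<comment> \<open>On the set where this fails, the conditional mass of \<open>B\<close> is at most \<open>\<alpha>\<close> and at least \<open>\<beta>\<close>.\<close>
  have null: "AE x in \<nu>. \<not> (lower B x < ennreal \<alpha> \<and> ennreal \<beta> < upper B x)"
    if "\<alpha> < \<beta>" "0 \<le> \<alpha>" for \<alpha> \<beta> :: real
  proof -
    let ?E = "{x \<in> space Finf. lower B x < ennreal \<alpha> \<and> ennreal \<beta> < upper B x}"
    have E: "?E \<in> sets Finf" by measurable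
    have "\<exists>n. ennreal \<beta> \<le> emeasure (\<kappa> n x) B" if "ennreal \<beta> < upper B x" for x
    proof (rule ccontr)
      assume "\<nexists>n. ennreal \<beta> \<le> emeasure (\<kappa> n x) B"
      then have "upper B x \<le> ennreal \<beta>"
        unfolding upper_def by (intro Limsup_bounded always_eventually) (auto simp: not_le less_imp_le)
      then show False using that by simp
    qed
    then have "?E \<subseteq> {x. \<exists>n. ennreal \<beta> \<le> emeasure (\<kappa> n x) B}" by blast
    from tail_bound_lower[OF \<nu> B E this]
    have 1: "ennreal \<beta> * emeasure \<nu> ?E \<le> emeasure \<nu> (B \<inter> ?E)" .
    have "\<exists>n. emeasure (\<kappa> n x) B \<le> ennreal \<alpha>" if "lower B x < ennreal \<alpha>" for x
    proof (rule ccontr)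
      assume "\<nexists>n. emeasure (\<kappa> n x) B \<le> ennreal \<alpha>"
      then have "ennreal \<alpha> \<le> lower B x"
        unfolding lower_def by (intro Liminf_bounded always_eventually) (auto simp: not_le less_imp_le)
      then show False using that by simp
    qed
    then have "?E \<subseteq> {x. \<exists>n. emeasure (\<kappa> n x) B \<le> ennreal \<alpha>}" by blast
    from tail_bound_upper[OF \<nu> B E this] 1
    have "ennreal \<beta> * emeasure \<nu> ?E \<le> ennreal \<alpha> * emeasure \<nu> ?E" by simp
    then have "ennreal (\<beta> * prob ?E) \<le> ennreal (\<alpha> * prob ?E)"
      using that by (simp add: emeasure_eq_measure ennreal_mult)
    then have "\<beta> * prob ?E \<le> \<alpha> * prob ?E"
      using that by (subst (asm) ennreal_le_iff) auto
    then have "prob ?E = 0"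
      using that mult_strict_right_mono[of \<alpha> \<beta> "prob ?E"] measure_nonneg[of \<nu> ?E]
      by linarith
    moreover have "?E \<in> sets \<nu>" using E sets_Finf_X stationaryD(2)[OF \<nu>] by blast
    ultimately have "?E \<in> null_sets \<nu>" by (auto simp: null_sets_def emeasure_eq_measure)
    from AE_not_in[OF this] show ?thesis
      by (rule AE_mp) (auto simp: space_Finf stationaryD(3)[OF \<nu>] intro!: AE_I2)
  qed
  have "AE x in \<nu>. \<forall>p\<in>{(a,b). 0 \<le> a \<and> a < b}.
      \<not> (lower B x < ennreal (real_of_rat (fst p)) \<and> ennreal (real_of_rat (snd p)) < upper B x)"
  proof (rule AE_ball_countable[THEN iffD2, OF countableI_type], rule ballI)
    fix p :: "rat \<times> rat" assume "p \<in> {(a,b). 0 \<le> a \<and> a < b}"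
    then have "real_of_rat (fst p) < real_of_rat (snd p)" "0 \<le> real_of_rat (fst p)"
      by (auto simp: of_rat_less)
    then show "AE x in \<nu>. \<not> (lower B x < ennreal (real_of_rat (fst p)) \<and> ennreal (real_of_rat (snd p)) < upper B x)"
      by (rule null)
  qed
  then show ?thesis
  proof (rule AE_mp, intro AE_I2 impI)
    fix x
    assume H: "\<forall>p\<in>{(a,b). 0 \<le> a \<and> a < b}.
      \<not> (lower B x < ennreal (real_of_rat (fst p)) \<and> ennreal (real_of_rat (snd p)) < upper B x)"
    have le: "lower B x \<le> upper B x" unfolding lower_def upper_def by (rule Liminf_le_Limsup) simp
    show "lower B x = upper B x"
    proof (rule ccontr)
      assume "lower B x \<noteq> upper B x"
      then have "lower B x < upper B x" using le by simp
      then obtain a where a: "lower B x < ennreal (real_of_rat a)" "ennreal (real_of_rat a) < upper B x"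
        using ennreal_dense_rat by blast
      then obtain b where b: "ennreal (real_of_rat a) < ennreal (real_of_rat b)" "ennreal (real_of_rat b) < upper B x"
        using ennreal_dense_rat by blast
      have "0 < real_of_rat a" using a(1) by (metis ennreal_neg not_less not_less_zero)
      then have "(a, b) \<in> {(a,b). 0 \<le> a \<and> a < b}" using b(1) by (auto simp: ennreal_less_iff of_rat_less)
      then show False using bspec[OF H, of "(a, b)"] a(1) b(2) by simp
    qed
  qed
qed

lemma nn_integral_upper:
  assumes \<nu>: "\<nu> \<in> stationary" and B [measurable]: "B \<in> sets X" and E: "E \<in> sets Finf"
  shows "(\<integral>\<^sup>+x. upper B x * indicator E x \<partial>\<nu>) = emeasure \<nu> (B \<inter> E)"
proof -
  interpret prob_space \<nu> by (rule stationaryD[OF \<nu>])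
  note [measurable_cong] = stationaryD(2)[OF \<nu>]
  have [measurable]: "E \<in> sets X" using E sets_Finf_X by blast
  have [measurable]: "upper B \<in> borel_measurable X" by (rule measurable_Finf_X) simp
  have "(\<lambda>n. \<integral>\<^sup>+x. emeasure (\<kappa> n x) B * indicator E x \<partial>\<nu>)
      \<longlonglongrightarrow> (\<integral>\<^sup>+x. upper B x * indicator E x \<partial>\<nu>)"
  proof (rule nn_integral_dominated_convergence[where w="\<lambda>_. 1"])
    show "AE x in \<nu>. emeasure (\<kappa> n x) B * indicator E x \<le> 1" for n
    proof (rule AE_I2)
      fix x assume "x \<in> space \<nu>"
      then have "emeasure (\<kappa> n x) B \<le> 1"
        using prob_kernel[of x n] stationaryD(3)[OF \<nu>]
        by (intro subprob_space.subprob_emeasure_le_1 prob_space_imp_subprob_space) simp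
      then show "emeasure (\<kappa> n x) B * indicator E x \<le> 1"
        by (simp add: indicator_def)
    qed
    show "(\<integral>\<^sup>+x. 1 \<partial>\<nu>) < \<infinity>" by (simp add: emeasure_space_1)
    show "AE x in \<nu>. (\<lambda>n. emeasure (\<kappa> n x) B * indicator E x) \<longlonglongrightarrow> upper B x * indicator E x"
      using AE_lower_eq_upper[OF \<nu> B]
    proof (rule AE_mp, intro AE_I2 impI)
      fix x assume "lower B x = upper B x"
      then have "(\<lambda>n. emeasure (\<kappa> n x) B) \<longlonglongrightarrow> upper B x"
        unfolding lower_def upper_def by (intro Liminf_eq_Limsup) auto
      then show "(\<lambda>n. emeasure (\<kappa> n x) B * indicator E x) \<longlonglongrightarrow> upper B x * indicator E x"
        by (cases "x \<in> E") auto
    qed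
  qed measurable
  moreover have "(\<integral>\<^sup>+x. emeasure (\<kappa> n x) B * indicator E x \<partial>\<nu>) = emeasure \<nu> (B \<inter> E)" for n
    using E by (intro nn_integral_kernel_indicator[OF \<nu> _ B]) (auto simp: sets_Finf)
  ultimately show ?thesis
    using LIMSEQ_unique[OF _ tendsto_const[of "emeasure \<nu> (B \<inter> E)"]] by simp
qed

end

section \<open>The limit kernel\<close>

locale coordinatized_space =
  fixes X :: "'x measure" and \<psi> :: "'x \<Rightarrow> real" and \<theta> :: "real \<Rightarrow> 'x"
  assumes measurable_\<psi> [measurable]: "\<psi> \<in> borel_measurable X"
    and measurable_\<theta> [measurable]: "\<theta> \<in> borel \<rightarrow>\<^sub>M X"
    and \<theta>_\<psi>: "x \<in> space X \<Longrightarrow> \<theta> (\<psi> x) = x"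
    and \<psi>_\<theta>: "\<psi> (\<theta> r) = max 0 (min 1 r)"
    and \<psi>_range: "x \<in> space X \<Longrightarrow> 0 \<le> \<psi> x" "x \<in> space X \<Longrightarrow> \<psi> x \<le> 1"
begin

definition sublevel :: "real \<Rightarrow> 'x set" where
  "sublevel r = {x \<in> space X. \<psi> x \<le> r}"

lemma sets_sublevel [measurable]: "sublevel r \<in> sets X"
  unfolding sublevel_def by measurable

lemma sublevel_mono: "r \<le> s \<Longrightarrow> sublevel r \<subseteq> sublevel s"
  by (auto simp: sublevel_def)

lemma sublevel_ge_1: "1 \<le> r \<Longrightarrow> sublevel r = space X"
  and sublevel_neg: "r < 0 \<Longrightarrow> sublevel r = {}"
  using \<psi>_range by (force simp: sublevel_def)+

lemma Int_stable_sublevel: "Int_stable (range sublevel)"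
proof (rule Int_stableI)
  fix a b assume "a \<in> range sublevel" "b \<in> range sublevel"
  then obtain r s where "a = sublevel r" "b = sublevel s" by blast
  then have "a \<inter> b = sublevel (min r s)" by (auto simp: sublevel_def)
  then show "a \<inter> b \<in> range sublevel" by blast
qed

lemma sets_eq_sigma_sublevel: "sets X = sigma_sets (space X) (range sublevel)"
proof
  show "sigma_sets (space X) (range sublevel) \<subseteq> sets X"
    by (rule sets.sigma_sets_subset) auto
  show "sets X \<subseteq> sigma_sets (space X) (range sublevel)"
  proof
    fix A assume A: "A \<in> sets X"
    let ?V = "{\<psi> -` B \<inter> space X |B. B \<in> sigma_sets UNIV (range (\<lambda>a::real. {..a}))}"
    have "\<theta> -` A \<in> sets borel" using measurable_sets[OF measurable_\<theta> A] by simp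
    then have "\<theta> -` A \<in> sigma_sets UNIV (range (\<lambda>a::real. {..a}))"
      unfolding borel_eq_atMost by (subst (asm) sets_measure_of) auto
    moreover have "A = \<psi> -` (\<theta> -` A) \<inter> space X"
      using sets.sets_into_space[OF A] by (auto simp: \<theta>_\<psi>)
    ultimately have "A \<in> ?V" by blast
    also have "?V = sigma_sets (space X) {\<psi> -` B \<inter> space X |B. B \<in> range (\<lambda>a::real. {..a})}"
      by (rule sigma_sets_vimage_commute) simp
    also have "{\<psi> -` B \<inter> space X |B. B \<in> range (\<lambda>a::real. {..a})} = range sublevel"
    proof -
      have "{\<psi> -` B \<inter> space X |B. B \<in> range (\<lambda>a::real. {..a})} = range (\<lambda>a. \<psi> -` {..a} \<inter> space X)"
        by blast
      also have "(\<lambda>a. \<psi> -` {..a} \<inter> space X) = sublevel"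
        by (auto simp: sublevel_def)
      finally show ?thesis .
    qed
    finally show "A \<in> sigma_sets (space X) (range sublevel)" .
  qed
qed

lemma measure_eqI_sublevel:
  assumes "sets M = sets X" "sets N = sets X" "emeasure M (space X) \<noteq> \<infinity>"
    and "\<And>r. emeasure M (sublevel r) = emeasure N (sublevel r)"
  shows "M = N"
proof (rule measure_eqI_generator_eq[OF Int_stable_sublevel, where \<Omega>="space X" and A="\<lambda>_. sublevel 1"])
  show "range sublevel \<subseteq> Pow (space X)" by (auto simp: sublevel_def)
qed (use assms sublevel_ge_1[of 1] in \<open>auto simp: sets_eq_sigma_sublevel[symmetric]\<close>)

lemma Inter_sublevel: "(\<Inter>n. sublevel (r + 1 / real (Suc n))) = sublevel r"
proof
  show "(\<Inter>n. sublevel (r + 1 / real (Suc n))) \<subseteq> sublevel r"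
  proof
    fix x assume x: "x \<in> (\<Inter>n. sublevel (r + 1 / real (Suc n)))"
    then have "\<psi> x \<le> r + 1 / real (Suc n)" for n by (auto simp: sublevel_def)
    moreover have "(\<lambda>n. r + 1 / real (Suc n)) \<longlonglongrightarrow> r + 0"
      using LIMSEQ_inverse_real_of_nat by (intro tendsto_add tendsto_const) (simp add: inverse_eq_divide)
    ultimately have "\<psi> x \<le> r + 0" by (intro LIMSEQ_le_const) auto
    then show "x \<in> sublevel r" using x by (auto simp: sublevel_def)
  qed
  show "sublevel r \<subseteq> (\<Inter>n. sublevel (r + 1 / real (Suc n)))"
    by (intro INT_greatest sublevel_mono) simp
qed

lemma measure_eqI_sublevel_rat:
  assumes M: "M \<in> space (prob_algebra X)" and N: "N \<in> space (prob_algebra X)"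
    and eq: "\<And>q. emeasure M (sublevel (real_of_rat q)) = emeasure N (sublevel (real_of_rat q))"
  shows "M = N"
proof (rule measure_eqI_sublevel)
  have sM: "sets M = sets X" "prob_space M" and sN: "sets N = sets X" "prob_space N"
    using M N by (auto simp: space_prob_algebra)
  then show "sets M = sets X" "sets N = sets X" by auto
  interpret M: prob_space M by fact
  interpret N: prob_space N by fact
  show "emeasure M (space X) \<noteq> \<infinity>" by simp
  fix r
  have "\<exists>q. r < real_of_rat q \<and> real_of_rat q < r + 1 / real (Suc n)" for n
    using of_rat_dense[of r "r + 1 / real (Suc n)"] by auto
  then obtain q where q: "\<And>n. r < real_of_rat (q n)" "\<And>n. real_of_rat (q n) < r + 1 / real (Suc n)"
    by metis
  define p where "p n = Min (q ` {..n})" for n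
  have p1: "r < real_of_rat (p n)" for n
  proof -
    have "p n \<in> q ` {..n}" unfolding p_def by (rule Min_in) auto
    then show ?thesis using q(1) by auto
  qed
  have p2: "real_of_rat (p n) < r + 1 / real (Suc n)" for n
  proof -
    have "p n \<le> q n" unfolding p_def by (rule Min_le) auto
    then have "real_of_rat (p n) \<le> real_of_rat (q n)" by (simp add: of_rat_less_eq)
    then show ?thesis using q(2)[of n] by simp
  qed
  have "p (Suc n) \<le> p n" for n unfolding p_def by (rule Min_antimono) auto
  then have dec: "decseq (\<lambda>n. sublevel (real_of_rat (p n)))"
    by (intro decseq_SucI sublevel_mono) (simp add: of_rat_less_eq)
  have "(\<Inter>n. sublevel (real_of_rat (p n))) \<subseteq> (\<Inter>n. sublevel (r + 1 / real (Suc n)))"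
    by (intro INT_anti_mono[OF order_refl] sublevel_mono less_imp_le p2)
  moreover have "sublevel r \<subseteq> (\<Inter>n. sublevel (real_of_rat (p n)))"
    by (intro INT_greatest sublevel_mono less_imp_le p1)
  ultimately have I: "(\<Inter>n. sublevel (real_of_rat (p n))) = sublevel r"
    unfolding Inter_sublevel by blast
  have "(INF n. emeasure M (sublevel (real_of_rat (p n)))) = emeasure M (sublevel r)"
    unfolding I[symmetric] by (rule INF_emeasure_decseq[OF _ dec]) (auto simp: sM)
  moreover have "(INF n. emeasure N (sublevel (real_of_rat (p n)))) = emeasure N (sublevel r)"
    unfolding I[symmetric] by (rule INF_emeasure_decseq[OF _ dec]) (auto simp: sN)
  ultimately show "emeasure M (sublevel r) = emeasure N (sublevel r)" using eq by simp
qed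

end

locale coordinatized_tower = markov_tower X F \<kappa> + coordinatized_space X \<psi> \<theta>
  for X :: "'x measure" and F \<kappa> \<psi> \<theta>
begin

text \<open>
  The limits of \<open>\<kappa> n x\<close> exist only almost everywhere, but the upper limits on sublevel sets, made
  right-continuous, form a distribution function for every \<open>x\<close>. So the kernel below is a probability
  measure everywhere and does not depend on a stationary measure.
\<close>

definition cdf_lim :: "'x \<Rightarrow> real \<Rightarrow> ennreal" where
  "cdf_lim x r = (INF n. upper (sublevel (r + 1 / real (Suc n))) x)"

definition limit_kernel :: "'x \<Rightarrow> 'x measure" where
  "limit_kernel x = distr (interval_measure (\<lambda>r. enn2real (cdf_lim x r))) X \<theta>"

lemma upper_mono:
  assumes "A \<subseteq> B" "B \<in> sets X" "x \<in> space X"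
  shows "upper A x \<le> upper B x"
  unfolding upper_def
proof (intro Limsup_mono always_eventually allI)
  fix n
  have "B \<in> sets (\<kappa> n x)" by (simp add: sets_kernel_eq[OF assms(3)] assms(2))
  then show "emeasure (\<kappa> n x) A \<le> emeasure (\<kappa> n x) B" by (rule emeasure_mono[OF assms(1)])
qed

lemma upper_space: "x \<in> space X \<Longrightarrow> upper (space X) x = 1"
  and upper_empty: "upper {} x = 0"
proof -
  assume "x \<in> space X"
  then have "emeasure (\<kappa> n x) (space X) = 1" for n
    using prob_space.emeasure_space_1[OF prob_kernel] space_kernel_eq by metis
  then show "upper (space X) x = 1" by (simp add: upper_def Limsup_const)
qed (simp add: upper_def Limsup_const)

lemma cdf_lim_mono: "x \<in> space X \<Longrightarrow> r \<le> s \<Longrightarrow> cdf_lim x r \<le> cdf_lim x s"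
  unfolding cdf_lim_def by (intro INF_mono' upper_mono sublevel_mono) simp_all

lemma cdf_lim_le_1: "x \<in> space X \<Longrightarrow> cdf_lim x r \<le> 1"
  unfolding cdf_lim_def upper_space[symmetric]
  by (intro INF_lower2[of 0] upper_mono) (auto simp: sublevel_def)

lemma cdf_lim_ge_1: "x \<in> space X \<Longrightarrow> 1 \<le> r \<Longrightarrow> cdf_lim x r = 1"
  unfolding cdf_lim_def by (simp add: sublevel_ge_1 add_increasing2 upper_space)

lemma cdf_lim_neg:
  assumes "r < 0" shows "cdf_lim x r = 0"
proof -
  obtain n where "1 / real (Suc n) < - r"
    using nat_approx_posE[of "-r"] assms by auto
  then have "upper (sublevel (r + 1 / real (Suc n))) x = 0"
    by (subst sublevel_neg) (auto simp: upper_empty)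
  then have "cdf_lim x r \<le> 0" unfolding cdf_lim_def by (intro INF_lower2[of n]) auto
  then show ?thesis by simp
qed

lemma enn2real_cdf_lim: "x \<in> space X \<Longrightarrow> ennreal (enn2real (cdf_lim x r)) = cdf_lim x r"
  using cdf_lim_le_1[of x r] by (intro ennreal_enn2real) (auto intro: le_less_trans)

lemma enn2real_cdf_lim_mono:
  "x \<in> space X \<Longrightarrow> r \<le> s \<Longrightarrow> enn2real (cdf_lim x r) \<le> enn2real (cdf_lim x s)"
  using cdf_lim_le_1[of x s] by (intro enn2real_mono cdf_lim_mono) (auto intro: le_less_trans)

lemma right_continuous_cdf_lim:
  assumes x: "x \<in> space X"
  shows "continuous (at_right a) (\<lambda>r. enn2real (cdf_lim x r))"
proof (subst continuous_at_right_real_increasing)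
  show "\<And>r s. r \<le> s \<Longrightarrow> enn2real (cdf_lim x r) \<le> enn2real (cdf_lim x s)"
    by (rule enn2real_cdf_lim_mono[OF x])
  show "\<forall>\<epsilon>>0. \<exists>\<delta>>0. enn2real (cdf_lim x (a + \<delta>)) - enn2real (cdf_lim x a) < \<epsilon>"
  proof (intro allI impI)
    fix \<epsilon> :: real assume \<epsilon>: "0 < \<epsilon>"
    have "cdf_lim x a < ennreal (enn2real (cdf_lim x a) + \<epsilon>)"
      by (subst enn2real_cdf_lim[OF x, symmetric], rule ennreal_lessI) (use \<epsilon> in \<open>auto simp: add_nonneg_pos\<close>)
    then obtain n where n: "upper (sublevel (a + 1 / real (Suc n))) x < ennreal (enn2real (cdf_lim x a) + \<epsilon>)"
      unfolding cdf_lim_def[of x a] INF_less_iff by blast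
    let ?\<delta> = "1 / real (Suc n) / 2"
    obtain m where "1 / real (Suc m) < ?\<delta>" using nat_approx_posE[of ?\<delta>] by auto
    then have "(a + ?\<delta>) + 1 / real (Suc m) \<le> a + 1 / real (Suc n)" by linarith
    then have "cdf_lim x (a + ?\<delta>) \<le> upper (sublevel (a + 1 / real (Suc n))) x"
      unfolding cdf_lim_def using x by (intro INF_lower2[of m] upper_mono sublevel_mono) auto
    also note n
    finally have "ennreal (enn2real (cdf_lim x (a + ?\<delta>))) < ennreal (enn2real (cdf_lim x a) + \<epsilon>)"
      by (simp only: enn2real_cdf_lim[OF x])
    then have "enn2real (cdf_lim x (a + ?\<delta>)) < enn2real (cdf_lim x a) + \<epsilon>"
      by (simp add: ennreal_less_iff)
    then show "\<exists>\<delta>>0. enn2real (cdf_lim x (a + \<delta>)) - enn2real (cdf_lim x a) < \<epsilon>"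
      by (intro exI[of _ ?\<delta>]) auto
  qed
qed

lemma real_distribution_cdf_lim:
  assumes x: "x \<in> space X"
  shows "real_distribution (interval_measure (\<lambda>r. enn2real (cdf_lim x r)))"
    and "cdf (interval_measure (\<lambda>r. enn2real (cdf_lim x r))) = (\<lambda>r. enn2real (cdf_lim x r))"
proof -
  have bot: "((\<lambda>r. enn2real (cdf_lim x r)) \<longlongrightarrow> 0) at_bot"
    by (rule tendsto_eventually) (auto simp: eventually_at_bot_dense cdf_lim_neg intro!: exI[of _ 0])
  have top: "((\<lambda>r. enn2real (cdf_lim x r)) \<longlongrightarrow> 1) at_top"
    by (rule tendsto_eventually) (auto simp: eventually_at_top_linorder cdf_lim_ge_1[OF x] intro!: exI[of _ 1])
  show "real_distribution (interval_measure (\<lambda>r. enn2real (cdf_lim x r)))"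
    by (rule real_distribution_interval_measure[OF enn2real_cdf_lim_mono[OF x] right_continuous_cdf_lim[OF x] bot top])
  show "cdf (interval_measure (\<lambda>r. enn2real (cdf_lim x r))) = (\<lambda>r. enn2real (cdf_lim x r))"
    by (rule cdf_interval_measure[OF enn2real_cdf_lim_mono[OF x] right_continuous_cdf_lim[OF x] bot])
qed

lemma prob_limit_kernel: "x \<in> space X \<Longrightarrow> prob_space (limit_kernel x)"
  unfolding limit_kernel_def
  by (intro prob_space.prob_space_distr)
    (use real_distribution_cdf_lim(1)[of x] in \<open>auto simp: real_distribution_def\<close>)

lemma sets_limit_kernel [simp]: "sets (limit_kernel x) = sets X"
  by (simp add: limit_kernel_def)

lemma limit_kernel_space: "x \<in> space X \<Longrightarrow> limit_kernel x \<in> space (prob_algebra X)"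
  by (simp add: space_prob_algebra prob_limit_kernel)

lemma emeasure_limit_kernel_sublevel:
  assumes x: "x \<in> space X"
  shows "emeasure (limit_kernel x) (sublevel r) = cdf_lim x r"
proof -
  let ?I = "interval_measure (\<lambda>r. enn2real (cdf_lim x r))"
  interpret I: real_distribution ?I by (rule real_distribution_cdf_lim[OF x])
  have [measurable]: "\<theta> \<in> ?I \<rightarrow>\<^sub>M X" by simp
  have "\<theta> s \<in> space X" for s using measurable_space[OF measurable_\<theta>, of s] by simp
  then have pre: "\<theta> -` sublevel r = {s. max 0 (min 1 s) \<le> r}"
    by (auto simp: sublevel_def \<psi>_\<theta>)
  have em: "emeasure (limit_kernel x) (sublevel r) = emeasure ?I {s. max 0 (min 1 s) \<le> r}"
    unfolding limit_kernel_def by (simp add: emeasure_distr pre)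
  consider "r < 0" | "0 \<le> r" "r < 1" | "1 \<le> r" by linarith
  then show ?thesis
  proof cases
    case 1
    then have "{s::real. max 0 (min 1 s) \<le> r} = {}" by auto
    then show ?thesis unfolding em cdf_lim_neg[OF 1] by (simp only: emeasure_empty)
  next
    case 2
    then have "{s::real. max 0 (min 1 s) \<le> r} = {..r}" by auto
    then have "emeasure (limit_kernel x) (sublevel r) = ennreal (cdf ?I r)"
      using em by (simp add: cdf_def I.emeasure_eq_measure)
    then show ?thesis by (simp add: real_distribution_cdf_lim(2)[OF x] enn2real_cdf_lim[OF x])
  next
    case 3
    then have "{s::real. max 0 (min 1 s) \<le> r} = space ?I" by auto
    then show ?thesis unfolding em cdf_lim_ge_1[OF x 3] by (simp only: I.emeasure_space_1)
  qed
qed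

lemma measurable_cdf_lim [measurable]: "(\<lambda>x. cdf_lim x r) \<in> borel_measurable Finf"
  unfolding cdf_lim_def by measurable

lemma measurable_limit_kernel: "limit_kernel \<in> Finf \<rightarrow>\<^sub>M prob_algebra X"
proof (rule measurable_prob_algebra_generated[OF sets_eq_sigma_sublevel Int_stable_sublevel])
  show "range sublevel \<subseteq> Pow (space X)" by (auto simp: sublevel_def)
  fix A assume "A \<in> range sublevel"
  then obtain r where A: "A = sublevel r" by blast
  have "(\<lambda>x. emeasure (limit_kernel x) (sublevel r)) \<in> borel_measurable Finf \<longleftrightarrow>
    (\<lambda>x. cdf_lim x r) \<in> borel_measurable Finf"
    by (rule measurable_cong) (simp add: emeasure_limit_kernel_sublevel space_Finf)
  then show "(\<lambda>x. emeasure (limit_kernel x) A) \<in> borel_measurable Finf" unfolding A by simp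
qed (simp_all add: prob_limit_kernel space_Finf)

lemma measurable_limit_kernel_X: "limit_kernel \<in> X \<rightarrow>\<^sub>M prob_algebra X"
  by (rule measurable_Finf_X[OF measurable_limit_kernel])

lemma measurable_emeasure_limit_kernel [measurable]:
  "B \<in> sets X \<Longrightarrow> (\<lambda>x. emeasure (limit_kernel x) B) \<in> borel_measurable Finf"
  by (rule measurable_compose[OF measurable_prob_algebraD[OF measurable_limit_kernel] measurable_emeasure_subprob_algebra])

lemma measurable_emeasure_limit_kernel_X [measurable]:
  "B \<in> sets X \<Longrightarrow> (\<lambda>x. emeasure (limit_kernel x) B) \<in> borel_measurable X"
  by (rule measurable_Finf_X[OF measurable_emeasure_limit_kernel])

lemma nn_integral_limit_kernel_sublevel:
  assumes \<nu>: "\<nu> \<in> stationary" and E: "E \<in> sets Finf"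
  shows "(\<integral>\<^sup>+x. emeasure (limit_kernel x) (sublevel r) * indicator E x \<partial>\<nu>) = emeasure \<nu> (sublevel r \<inter> E)"
proof -
  interpret prob_space \<nu> by (rule stationaryD[OF \<nu>])
  note [measurable_cong] = stationaryD(2)[OF \<nu>]
  note [simp] = stationaryD(2,3)[OF \<nu>]
  have EX [measurable]: "E \<in> sets X" using E sets_Finf_X by blast
  let ?s = "\<lambda>n. sublevel (r + 1 / real (Suc n))"
  have mu [measurable]: "upper (sublevel s) \<in> borel_measurable X" for s
    by (rule measurable_Finf_X) simp
  have "(\<integral>\<^sup>+x. emeasure (limit_kernel x) (sublevel r) * indicator E x \<partial>\<nu>)
      = (\<integral>\<^sup>+x. (INF n. upper (?s n) x * indicator E x) \<partial>\<nu>)"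
  proof (rule nn_integral_cong)
    fix x assume "x \<in> space \<nu>"
    then have "emeasure (limit_kernel x) (sublevel r) = (INF n. upper (?s n) x)"
      by (simp add: emeasure_limit_kernel_sublevel cdf_lim_def)
    then show "emeasure (limit_kernel x) (sublevel r) * indicator E x = (INF n. upper (?s n) x * indicator E x)"
      by (cases "x \<in> E") simp_all
  qed
  also have "\<dots> = (INF n. \<integral>\<^sup>+x. upper (?s n) x * indicator E x \<partial>\<nu>)"
  proof (rule nn_integral_monotone_convergence_INF_AE)
    show "AE x in \<nu>. upper (?s (Suc i)) x * indicator E x \<le> upper (?s i) x * indicator E x" for i
    proof (rule AE_I2, rule mult_right_mono, rule upper_mono, rule sublevel_mono)
      show "r + 1 / real (Suc (Suc i)) \<le> r + 1 / real (Suc i)" by (simp add: field_simps)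
    qed simp_all
    have "(\<integral>\<^sup>+x. upper (?s 0) x * indicator E x \<partial>\<nu>) = emeasure \<nu> (?s 0 \<inter> E)"
      by (rule nn_integral_upper[OF \<nu> sets_sublevel E])
    also have "\<dots> < \<infinity>" using emeasure_finite[of "?s 0 \<inter> E"] by (simp only: infinity_ennreal_def less_top)
    finally show "(\<integral>\<^sup>+x. upper (?s 0) x * indicator E x \<partial>\<nu>) < \<infinity>" .
  next
    show "(\<lambda>x. upper (?s i) x * indicator E x) \<in> borel_measurable \<nu>" for i by measurable
  qed
  also have "\<dots> = (INF n. emeasure \<nu> (?s n \<inter> E))"
    by (simp only: nn_integral_upper[OF \<nu> sets_sublevel E])
  also have "\<dots> = emeasure \<nu> (\<Inter>n. ?s n \<inter> E)"
  proof (rule INF_emeasure_decseq)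
    show "decseq (\<lambda>n. ?s n \<inter> E)"
      by (intro decseq_SucI Int_mono sublevel_mono order_refl) (simp add: field_simps)
    show "range (\<lambda>n. ?s n \<inter> E) \<subseteq> sets \<nu>" by (simp add: image_subset_iff)
    show "emeasure \<nu> (?s n \<inter> E) \<noteq> \<infinity>" for n by (rule emeasure_finite[unfolded infinity_ennreal_def[symmetric]])
  qed
  also have "(\<Inter>n. ?s n \<inter> E) = sublevel r \<inter> E"
  proof -
    have "(\<Inter>n. ?s n \<inter> E) = (\<Inter>n. ?s n) \<inter> E" by blast
    then show ?thesis by (simp only: Inter_sublevel)
  qed
  finally show ?thesis .
qed

lemma bind_limit_kernel:
  assumes \<nu>: "\<nu> \<in> stationary" and E: "E \<in> sets Finf"
  shows "density \<nu> (indicator E) \<bind> limit_kernel = density \<nu> (indicator E)"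
proof -
  interpret prob_space \<nu> by (rule stationaryD[OF \<nu>])
  note [measurable_cong] = stationaryD(2)[OF \<nu>]
  note [simp] = stationaryD(2,3)[OF \<nu>]
  have EX [measurable]: "E \<in> sets X" using E sets_Finf_X by blast
  let ?d = "density \<nu> (indicator E)"
  have ne: "space ?d \<noteq> {}" using not_empty by simp
  have L: "limit_kernel \<in> ?d \<rightarrow>\<^sub>M subprob_algebra X"
    using measurable_prob_algebraD[OF measurable_limit_kernel_X] by (simp cong: measurable_cong_sets)
  have b: "emeasure (?d \<bind> limit_kernel) (sublevel r) = emeasure \<nu> (sublevel r \<inter> E)" for r
  proof -
    have "emeasure (?d \<bind> limit_kernel) (sublevel r)
        = (\<integral>\<^sup>+x. emeasure (limit_kernel x) (sublevel r) * indicator E x \<partial>\<nu>)"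
      by (subst emeasure_bind[OF ne L]) (auto simp: nn_integral_density mult.commute)
    then show ?thesis by (simp only: nn_integral_limit_kernel_sublevel[OF \<nu> E])
  qed
  have d: "emeasure ?d C = emeasure \<nu> (C \<inter> E)" if "C \<in> sets X" for C
    using that by (simp add: emeasure_density Int_commute flip: indicator_inter_arith)
  show "?d \<bind> limit_kernel = ?d"
  proof (rule measure_eqI_sublevel)
    show "sets (?d \<bind> limit_kernel) = sets X"
      by (rule sets_bind[OF _ ne]) simp
    show "emeasure (?d \<bind> limit_kernel) (sublevel r) = emeasure ?d (sublevel r)" for r
      by (simp only: b d[OF sets_sublevel])
    show "emeasure (?d \<bind> limit_kernel) (space X) \<noteq> \<infinity>"
      using b[of 1] by (simp add: sublevel_ge_1)
  qed simp
qed

lemma nn_integral_limit_kernel: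
  assumes \<nu>: "\<nu> \<in> stationary" and E: "E \<in> sets Finf" and f [measurable]: "f \<in> borel_measurable X"
  shows "(\<integral>\<^sup>+x. (\<integral>\<^sup>+y. f y \<partial>limit_kernel x) * indicator E x \<partial>\<nu>) = (\<integral>\<^sup>+x. f x * indicator E x \<partial>\<nu>)"
proof -
  note [measurable_cong] = stationaryD(2)[OF \<nu>]
  have EX [measurable]: "E \<in> sets X" using E sets_Finf_X by blast
  let ?d = "density \<nu> (indicator E)"
  have [measurable]: "limit_kernel \<in> \<nu> \<rightarrow>\<^sub>M subprob_algebra X"
    using measurable_prob_algebraD[OF measurable_limit_kernel_X] by (simp cong: measurable_cong_sets)
  have "(\<integral>\<^sup>+x. f x \<partial>(?d \<bind> limit_kernel)) = (\<integral>\<^sup>+x. (\<integral>\<^sup>+y. f y \<partial>limit_kernel x) \<partial>?d)"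
    by (rule nn_integral_bind[where B=X]) simp_all
  then show ?thesis
    by (simp add: bind_limit_kernel[OF \<nu> E] nn_integral_density mult.commute)
qed

lemma nn_integral_limit_kernel_indicator:
  assumes \<nu>: "\<nu> \<in> stationary" and E: "E \<in> sets Finf" and B: "B \<in> sets X"
  shows "(\<integral>\<^sup>+x. emeasure (limit_kernel x) B * indicator E x \<partial>\<nu>) = emeasure \<nu> (B \<inter> E)"
proof -
  have EX: "E \<in> sets X" using E sets_Finf_X by blast
  have "(\<integral>\<^sup>+x. emeasure (limit_kernel x) B * indicator E x \<partial>\<nu>)
      = (\<integral>\<^sup>+x. (\<integral>\<^sup>+y. indicator B y \<partial>limit_kernel x) * indicator E x \<partial>\<nu>)"
    using B by simp
  also have "\<dots> = (\<integral>\<^sup>+x. indicator B x * indicator E x \<partial>\<nu>)"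
    by (rule nn_integral_limit_kernel[OF \<nu> E]) (use B in simp)
  also have "\<dots> = emeasure \<nu> (B \<inter> E)"
    using B EX by (simp add: stationaryD(2)[OF \<nu>] flip: indicator_inter_arith)
  finally show ?thesis .
qed

lemma AE_eqI_Finf:
  fixes u v :: "'x \<Rightarrow> ennreal"
  assumes \<nu>: "\<nu> \<in> stationary"
    and u: "u \<in> borel_measurable Finf" and v: "v \<in> borel_measurable Finf"
    and A: "A \<in> sets X"
    and u_eq: "\<And>E. E \<in> sets Finf \<Longrightarrow> (\<integral>\<^sup>+x. u x * indicator E x \<partial>\<nu>) = emeasure \<nu> (A \<inter> E)"
    and v_eq: "\<And>E. E \<in> sets Finf \<Longrightarrow> (\<integral>\<^sup>+x. v x * indicator E x \<partial>\<nu>) = emeasure \<nu> (A \<inter> E)"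
  shows "AE x in \<nu>. u x = v x"
proof (rule nn_integral_indicator_eq_imp_AE_eq[OF subalgebra_Finf[OF \<nu>] u v])
  interpret prob_space \<nu> by (rule stationaryD[OF \<nu>])
  have "(\<integral>\<^sup>+x. u x \<partial>\<nu>) = (\<integral>\<^sup>+x. u x * indicator (space X) x \<partial>\<nu>)"
    by (rule nn_integral_cong) (simp add: stationaryD(3)[OF \<nu>])
  also have "\<dots> = emeasure \<nu> (A \<inter> space X)"
    by (rule u_eq) (metis sets.top space_Finf)
  finally show "(\<integral>\<^sup>+x. u x \<partial>\<nu>) \<noteq> \<infinity>" by simp
qed (simp only: u_eq v_eq)

definition stationary_part :: "'x set" where
  "stationary_part = {x \<in> space X. \<forall>n q. (\<integral>\<^sup>+y. emeasure (\<kappa> n y) (sublevel (real_of_rat q)) \<partial>limit_kernel x)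
     = emeasure (limit_kernel x) (sublevel (real_of_rat q))}"

definition kernel_sublevel :: "rat \<Rightarrow> rat \<Rightarrow> 'x set" where
  "kernel_sublevel q r =
     {y \<in> space X. emeasure (limit_kernel y) (sublevel (real_of_rat q)) \<le> ennreal (real_of_rat r)}"

text \<open>
  The second condition says that \<open>limit_kernel y = limit_kernel x\<close> for \<open>limit_kernel x\<close>-almost all \<open>y\<close>,
  tested on countably many sets.
\<close>

definition good_part :: "'x set" where
  "good_part = stationary_part \<inter>
     {x \<in> space X. \<forall>q r. emeasure (limit_kernel x) (kernel_sublevel q r) = indicator (kernel_sublevel q r) x}"

lemma sets_kernel_sublevel: "kernel_sublevel q r \<in> sets Finf"
  unfolding kernel_sublevel_def space_Finf[symmetric] by measurable

lemma measurable_nn_integral_limit_kernel [measurable]: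
  "f \<in> borel_measurable X \<Longrightarrow> (\<lambda>x. \<integral>\<^sup>+y. f y \<partial>limit_kernel x) \<in> borel_measurable Finf"
  by (rule measurable_compose[OF measurable_prob_algebraD[OF measurable_limit_kernel] nn_integral_measurable_subprob_algebra])

lemma sets_good_part: "good_part \<in> sets Finf"
proof -
  have [measurable]: "kernel_sublevel q r \<in> sets X" "kernel_sublevel q r \<in> sets Finf" for q r
    using sets_kernel_sublevel sets_Finf_X by blast+
  show ?thesis
    unfolding good_part_def stationary_part_def space_Finf[symmetric] by measurable
qed

lemma sets_good_part_X: "good_part \<in> sets X"
  using sets_good_part sets_Finf_X by blast

lemma good_part_space: "x \<in> good_part \<Longrightarrow> x \<in> space X"
  by (auto simp: good_part_def)

lemma AE_limit_kernel_tail: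
  assumes \<nu>: "\<nu> \<in> stationary" and E: "E \<in> sets Finf"
  shows "AE x in \<nu>. emeasure (limit_kernel x) E = indicator E x"
proof (rule AE_eqI_Finf[OF \<nu>])
  show EX: "E \<in> sets X" using E sets_Finf_X by blast
  show "(\<lambda>x. emeasure (limit_kernel x) E) \<in> borel_measurable Finf" using EX by measurable
  show "indicator E \<in> borel_measurable Finf" using E by measurable
  fix E' assume E': "E' \<in> sets Finf"
  then have "E' \<in> sets X" using sets_Finf_X by blast
  then show "(\<integral>\<^sup>+x. indicator E x * indicator E' x \<partial>\<nu>) = emeasure \<nu> (E \<inter> E')"
    using EX by (simp add: stationaryD(2)[OF \<nu>] flip: indicator_inter_arith)
  show "(\<integral>\<^sup>+x. emeasure (limit_kernel x) E * indicator E' x \<partial>\<nu>) = emeasure \<nu> (E \<inter> E')"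
    by (rule nn_integral_limit_kernel_indicator[OF \<nu> E' EX])
qed

lemma AE_limit_kernel_stationary:
  assumes \<nu>: "\<nu> \<in> stationary" and A [measurable]: "A \<in> sets X"
  shows "AE x in \<nu>. (\<integral>\<^sup>+y. emeasure (\<kappa> n y) A \<partial>limit_kernel x) = emeasure (limit_kernel x) A"
proof (rule AE_eqI_Finf[OF \<nu> _ _ A])
  show "(\<lambda>x. \<integral>\<^sup>+y. emeasure (\<kappa> n y) A \<partial>limit_kernel x) \<in> borel_measurable Finf" by measurable
  show "(\<lambda>x. emeasure (limit_kernel x) A) \<in> borel_measurable Finf" by measurable
  fix E assume E: "E \<in> sets Finf"
  show "(\<integral>\<^sup>+x. emeasure (limit_kernel x) A * indicator E x \<partial>\<nu>) = emeasure \<nu> (A \<inter> E)"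
    by (rule nn_integral_limit_kernel_indicator[OF \<nu> E A])
  have "(\<integral>\<^sup>+x. (\<integral>\<^sup>+y. emeasure (\<kappa> n y) A \<partial>limit_kernel x) * indicator E x \<partial>\<nu>)
      = (\<integral>\<^sup>+x. emeasure (\<kappa> n x) A * indicator E x \<partial>\<nu>)"
    by (rule nn_integral_limit_kernel[OF \<nu> E]) measurable
  also have "\<dots> = emeasure \<nu> (A \<inter> E)"
    using E by (intro nn_integral_kernel_indicator[OF \<nu> _ A]) (simp add: sets_Finf)
  finally show "(\<integral>\<^sup>+x. (\<integral>\<^sup>+y. emeasure (\<kappa> n y) A \<partial>limit_kernel x) * indicator E x \<partial>\<nu>) = emeasure \<nu> (A \<inter> E)" .
qed

lemma AE_good_part:
  assumes \<nu>: "\<nu> \<in> stationary"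
  shows "AE x in \<nu>. x \<in> good_part"
proof -
  have "AE x in \<nu>. \<forall>n q. (\<integral>\<^sup>+y. emeasure (\<kappa> n y) (sublevel (real_of_rat q)) \<partial>limit_kernel x)
     = emeasure (limit_kernel x) (sublevel (real_of_rat q))"
    using AE_limit_kernel_stationary[OF \<nu> sets_sublevel] by (simp add: AE_all_countable)
  moreover have "AE x in \<nu>. \<forall>q r. emeasure (limit_kernel x) (kernel_sublevel q r) = indicator (kernel_sublevel q r) x"
    using AE_limit_kernel_tail[OF \<nu> sets_kernel_sublevel] by (simp add: AE_all_countable)
  ultimately show ?thesis
    using AE_space[of \<nu>] unfolding stationaryD(3)[OF \<nu>]
    by eventually_elim (simp add: good_part_def stationary_part_def)
qed

lemma emeasure_good_part:
  assumes \<nu>: "\<nu> \<in> stationary"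
  shows "emeasure \<nu> good_part = 1"
  using AE_good_part[OF \<nu>] sets_good_part_X stationaryD(1,2)[OF \<nu>]
  by (simp add: prob_space.emeasure_eq_1_AE)

lemma limit_kernel_stationary:
  assumes x: "x \<in> good_part"
  shows "limit_kernel x \<in> stationary"
proof -
  have xX: "x \<in> space X" by (rule good_part_space[OF x])
  have P: "limit_kernel x \<in> space (prob_algebra X)" by (rule limit_kernel_space[OF xX])
  have K: "\<kappa> n \<in> X \<rightarrow>\<^sub>M prob_algebra X" for n by (rule measurable_F_X[OF kernel_F])
  have "limit_kernel x \<bind> \<kappa> n = limit_kernel x" for n
  proof (rule measure_eqI_sublevel_rat[OF _ P])
    show "limit_kernel x \<bind> \<kappa> n \<in> space (prob_algebra X)"
      using prob_space_bind'[OF P K] sets_bind'[OF P K] by (simp add: space_prob_algebra)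
    fix q
    show "emeasure (limit_kernel x \<bind> \<kappa> n) (sublevel (real_of_rat q)) = emeasure (limit_kernel x) (sublevel (real_of_rat q))"
      using x by (simp add: emeasure_bind_prob_algebra[OF P K] good_part_def stationary_part_def)
  qed
  then have "(\<integral>\<^sup>+y. emeasure (\<kappa> n y) A \<partial>limit_kernel x) = emeasure (limit_kernel x) A"
    if "A \<in> sets X" for n A
    using emeasure_bind_prob_algebra[OF P K that] by metis
  then show ?thesis using P by (simp add: stationary_def)
qed

lemma AE_limit_kernel_const:
  assumes x: "x \<in> good_part"
  shows "AE y in limit_kernel x. limit_kernel y = limit_kernel x"
proof -
  have xX: "x \<in> space X" by (rule good_part_space[OF x])
  interpret prob_space "limit_kernel x" by (rule prob_limit_kernel[OF xX])
  have sp: "space (limit_kernel x) = space X" by (rule sets_eq_imp_space_eq) simp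
  have "AE y in limit_kernel x. y \<in> kernel_sublevel q r \<longleftrightarrow> x \<in> kernel_sublevel q r" for q r
  proof -
    have em: "emeasure (limit_kernel x) (kernel_sublevel q r) = indicator (kernel_sublevel q r) x"
      using x by (simp add: good_part_def)
    have ks: "kernel_sublevel q r \<in> sets (limit_kernel x)"
      using sets_kernel_sublevel sets_Finf_X by simp blast
    show ?thesis
    proof (cases "x \<in> kernel_sublevel q r")
      case True
      then have "prob (kernel_sublevel q r) = 1" using em by (simp add: measure_def)
      then have "AE y in limit_kernel x. y \<in> kernel_sublevel q r"
        by (simp only: AE_in_set_eq_1[OF ks])
      then show ?thesis using True by simp
    next
      case False
      then have "kernel_sublevel q r \<in> null_sets (limit_kernel x)"
        using em ks by (simp add: null_sets_def)
      from AE_not_in[OF this] show ?thesis using False by simp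
    qed
  qed
  then have "AE y in limit_kernel x. \<forall>q r. y \<in> kernel_sublevel q r \<longleftrightarrow> x \<in> kernel_sublevel q r"
    by (simp add: AE_all_countable)
  moreover have "AE y in limit_kernel x. y \<in> space X"
    using AE_space[of "limit_kernel x"] by (simp only: sp)
  ultimately show ?thesis
  proof eventually_elim
    case (elim y)
    show ?case
    proof (rule measure_eqI_sublevel_rat[OF limit_kernel_space[OF elim(2)] limit_kernel_space[OF xX]])
      fix q
      let ?u = "emeasure (limit_kernel y) (sublevel (real_of_rat q))"
      let ?v = "emeasure (limit_kernel x) (sublevel (real_of_rat q))"
      have iff: "?u \<le> ennreal (real_of_rat r) \<longleftrightarrow> ?v \<le> ennreal (real_of_rat r)" for r
        using elim xX by (simp add: kernel_sublevel_def)
      show "?u = ?v"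
      proof (rule linorder_cases[of ?u ?v])
        assume "?u < ?v"
        from ennreal_dense_rat[OF this] iff show ?thesis by (meson leD less_imp_le)
      next
        assume "?v < ?u"
        from ennreal_dense_rat[OF this] iff show ?thesis by (meson leD less_imp_le)
      qed
    qed
  qed
qed

definition tail_trivial :: "'x measure \<Rightarrow> bool" where
  "tail_trivial \<nu> \<longleftrightarrow> (\<forall>E\<in>sets Finf. emeasure \<nu> E = 0 \<or> emeasure \<nu> (space X - E) = 0)"

lemma tail_trivial_limit_kernel:
  assumes x: "x \<in> good_part"
  shows "tail_trivial (limit_kernel x)"
  unfolding tail_trivial_def
proof
  fix E assume E: "E \<in> sets Finf"
  have st: "limit_kernel x \<in> stationary" by (rule limit_kernel_stationary[OF x])
  interpret prob_space "limit_kernel x" by (rule stationaryD(1)[OF st])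
  have EX: "E \<in> sets (limit_kernel x)" using E sets_Finf_X by auto
  have "AE y in limit_kernel x. emeasure (limit_kernel x) E = indicator E y"
    using AE_limit_kernel_tail[OF st E] AE_limit_kernel_const[OF x]
    by eventually_elim simp
  then obtain y where "emeasure (limit_kernel x) E = indicator E y"
    using eventually_happens'[of "ae_filter (limit_kernel x)"] by (auto simp: ae_filter_bot)
  then consider "emeasure (limit_kernel x) E = 0" | "prob E = 1"
    by (cases "y \<in> E") (simp_all add: measure_def)
  then show "emeasure (limit_kernel x) E = 0 \<or> emeasure (limit_kernel x) (space X - E) = 0"
  proof cases
    case 2
    then have "prob (space (limit_kernel x) - E) = 0" using prob_compl[OF EX] by simp
    then show ?thesis by (simp add: emeasure_eq_measure stationaryD(3)[OF st])
  qed simp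
qed

lemma AE_limit_kernel_eq:
  assumes \<eta>: "\<eta> \<in> stationary" and triv: "tail_trivial \<eta>"
  shows "AE y in \<eta>. limit_kernel y = \<eta>"
proof -
  interpret prob_space \<eta> by (rule stationaryD(1)[OF \<eta>])
  note sE = stationaryD(2)[OF \<eta>] and spE = stationaryD(3)[OF \<eta>]
  have "AE y in \<eta>. emeasure (limit_kernel y) A = emeasure \<eta> A" if A: "A \<in> sets X" for A
  proof (rule AE_eqI_Finf[OF \<eta> _ _ A])
    show "(\<lambda>y. emeasure (limit_kernel y) A) \<in> borel_measurable Finf" using A by measurable
    show "(\<lambda>y. emeasure \<eta> A) \<in> borel_measurable Finf" by simp
    fix E assume E: "E \<in> sets Finf"
    have EX: "E \<in> sets \<eta>" and AX: "A \<in> sets \<eta>" using E A sets_Finf_X sE by auto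
    show "(\<integral>\<^sup>+y. emeasure (limit_kernel y) A * indicator E y \<partial>\<eta>) = emeasure \<eta> (A \<inter> E)"
      by (rule nn_integral_limit_kernel_indicator[OF \<eta> E A])
    have "(\<integral>\<^sup>+y. emeasure \<eta> A * indicator E y \<partial>\<eta>) = emeasure \<eta> A * emeasure \<eta> E"
      by (rule nn_integral_cmult_indicator[OF EX])
    also have "\<dots> = emeasure \<eta> (A \<inter> E)"
    proof (cases "emeasure \<eta> E = 0")
      case True
      have "emeasure \<eta> (A \<inter> E) \<le> emeasure \<eta> E" using EX by (intro emeasure_mono) auto
      then show ?thesis using True by simp
    next
      case False
      then have 0: "emeasure \<eta> (space \<eta> - E) = 0" using triv E by (auto simp: tail_trivial_def spE)
      then have "prob E = 1" using prob_compl[OF EX] by (simp add: measure_def)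
      then have E1: "emeasure \<eta> E = 1" by (simp add: emeasure_eq_measure)
      have "space \<eta> - E \<in> null_sets \<eta>" using 0 EX by (auto simp: null_sets_def)
      from AE_not_in[OF this] have "AE y in \<eta>. y \<in> E"
        using AE_space[of \<eta>] by eventually_elim auto
      then have "AE y in \<eta>. y \<in> A \<inter> E \<longleftrightarrow> y \<in> A" by eventually_elim auto
      then have "emeasure \<eta> (A \<inter> E) = emeasure \<eta> A"
        by (rule emeasure_eq_AE) (use AX EX in auto)
      then show ?thesis using E1 by simp
    qed
    finally show "(\<integral>\<^sup>+y. emeasure \<eta> A * indicator E y \<partial>\<eta>) = emeasure \<eta> (A \<inter> E)" .
  qed
  then have "AE y in \<eta>. \<forall>q. emeasure (limit_kernel y) (sublevel (real_of_rat q)) = emeasure \<eta> (sublevel (real_of_rat q))"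
    by (simp add: AE_all_countable)
  moreover have "AE y in \<eta>. y \<in> space X"
    using AE_space[of \<eta>] by (simp only: spE)
  ultimately show ?thesis
  proof eventually_elim
    case (elim y)
    have "\<eta> \<in> space (prob_algebra X)" using \<eta> by (simp add: stationary_def)
    then show ?case using elim by (intro measure_eqI_sublevel_rat limit_kernel_space) auto
  qed
qed

lemma sets_limit_kernel_fibre:
  assumes \<eta>: "\<eta> \<in> space (prob_algebra X)"
  shows "limit_kernel -` {\<eta>} \<inter> good_part \<in> sets X"
proof -
  note [measurable] = sets_good_part_X
  have "limit_kernel -` {\<eta>} \<inter> good_part =
    good_part \<inter> {y \<in> space X. \<forall>q. emeasure (limit_kernel y) (sublevel (real_of_rat q)) = emeasure \<eta> (sublevel (real_of_rat q))}"
    using good_part_space measure_eqI_sublevel_rat[OF limit_kernel_space \<eta>] by auto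
  also have "\<dots> \<in> sets X" by measurable
  finally show ?thesis .
qed

lemma emeasure_limit_kernel_fibre:
  assumes \<eta>: "\<eta> \<in> stationary" and triv: "tail_trivial \<eta>"
  shows "emeasure \<eta> (limit_kernel -` {\<eta>} \<inter> good_part) = 1"
proof -
  interpret prob_space \<eta> by (rule stationaryD(1)[OF \<eta>])
  have "limit_kernel -` {\<eta>} \<inter> good_part \<in> sets \<eta>"
    using sets_limit_kernel_fibre[of \<eta>] \<eta> by (simp add: stationaryD(2)[OF \<eta>] stationary_def)
  moreover have "AE y in \<eta>. y \<in> limit_kernel -` {\<eta>} \<inter> good_part"
    using AE_limit_kernel_eq[OF \<eta> triv] AE_good_part[OF \<eta>] by eventually_elim simp
  ultimately show ?thesis by (simp add: emeasure_eq_1_AE)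
qed

lemma limit_kernel_image: "limit_kernel ` good_part = {\<nu> \<in> stationary. tail_trivial \<nu>}"
proof
  show "{\<nu> \<in> stationary. tail_trivial \<nu>} \<subseteq> limit_kernel ` good_part"
  proof
    fix \<eta> assume "\<eta> \<in> {\<nu> \<in> stationary. tail_trivial \<nu>}"
    then have "emeasure \<eta> (limit_kernel -` {\<eta>} \<inter> good_part) = 1"
      using emeasure_limit_kernel_fibre by simp
    then have "limit_kernel -` {\<eta>} \<inter> good_part \<noteq> {}" by (metis emeasure_empty zero_neq_one)
    then show "\<eta> \<in> limit_kernel ` good_part" by auto
  qed
qed (use limit_kernel_stationary tail_trivial_limit_kernel in auto)

section \<open>Ergodic decomposition of stationary measures\<close>

definition stat_space :: "'x measure measure" where
  "stat_space = restrict_space (prob_algebra X) stationary"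

definition erg_space :: "'x measure measure" where
  "erg_space = restrict_space stat_space {\<nu>. tail_trivial \<nu>}"

definition bar :: "'x measure \<Rightarrow> 'x measure measure" where
  "bar = pushforward_on good_part limit_kernel erg_space"

lemma space_stat_space: "space stat_space = stationary"
  by (auto simp: stat_space_def space_restrict_space stationary_def)

lemma space_erg_space: "space erg_space = {\<nu> \<in> stationary. tail_trivial \<nu>}"
  by (auto simp: erg_space_def space_restrict_space space_stat_space)

lemma measurable_id_stat_space: "(\<lambda>\<nu>. \<nu>) \<in> stat_space \<rightarrow>\<^sub>M prob_algebra X"
  unfolding stat_space_def by (rule measurable_restrict_space1) simp

lemma measurable_id_erg_space: "(\<lambda>\<nu>. \<nu>) \<in> erg_space \<rightarrow>\<^sub>M prob_algebra X"
  unfolding erg_space_def by (rule measurable_restrict_space1[OF measurable_id_stat_space])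

lemma measurable_emeasure_erg_space [measurable]:
  "A \<in> sets X \<Longrightarrow> (\<lambda>\<nu>. emeasure \<nu> A) \<in> borel_measurable erg_space"
  by (rule measurable_compose[OF measurable_prob_algebraD[OF measurable_id_erg_space] measurable_emeasure_subprob_algebra])

lemma measurable_emeasure_stat_space [measurable]:
  "A \<in> sets X \<Longrightarrow> (\<lambda>\<nu>. emeasure \<nu> A) \<in> borel_measurable stat_space"
  by (rule measurable_compose[OF measurable_prob_algebraD[OF measurable_id_stat_space] measurable_emeasure_subprob_algebra])

lemma measurable_stat_spaceI:
  assumes "f \<in> M \<rightarrow>\<^sub>M prob_algebra X" "\<And>x. x \<in> space M \<Longrightarrow> f x \<in> stationary"
  shows "f \<in> M \<rightarrow>\<^sub>M stat_space"
  unfolding stat_space_def using assms by (intro measurable_restrict_space2) auto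

lemma measurable_limit_kernel_erg_space: "limit_kernel \<in> restrict_space X good_part \<rightarrow>\<^sub>M erg_space"
  unfolding erg_space_def
proof (rule measurable_restrict_space2[OF _ measurable_stat_spaceI])
  show "limit_kernel \<in> restrict_space X good_part \<rightarrow>\<^sub>M prob_algebra X"
    by (rule measurable_restrict_space1[OF measurable_limit_kernel_X])
qed (auto simp: space_restrict_space intro: limit_kernel_stationary tail_trivial_limit_kernel)

lemma sets_vimage_limit_kernel:
  assumes C: "C \<in> sets erg_space"
  shows "limit_kernel -` C \<inter> good_part \<in> sets X"
proof -
  have "limit_kernel -` C \<inter> space (restrict_space X good_part) \<in> sets (restrict_space X good_part)"
    by (rule measurable_sets[OF measurable_limit_kernel_erg_space C])
  moreover have "space (restrict_space X good_part) = good_part"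
    using good_part_space by (auto simp: space_restrict_space)
  ultimately show ?thesis
    using sets_good_part_X by (simp add: sets_restrict_space_iff)
qed

lemma measurable_limit_kernel_restrict:
  assumes "sets \<nu> = sets X"
  shows "limit_kernel \<in> restrict_space \<nu> good_part \<rightarrow>\<^sub>M erg_space"
proof -
  have "sets (restrict_space \<nu> good_part) = sets (restrict_space X good_part)"
    using assms by (rule sets_restrict_space_cong)
  then show ?thesis
    using measurable_limit_kernel_erg_space measurable_cong_sets by blast
qed

lemma sets_bar: "sets (bar \<nu>) = sets erg_space"
  by (simp add: bar_def pushforward_on_def)

lemma space_bar: "space (bar \<nu>) = space erg_space"
  by (rule sets_eq_imp_space_eq[OF sets_bar])

lemma emeasure_bar:
  assumes \<nu>: "\<nu> \<in> stationary" and C: "C \<in> sets erg_space"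
  shows "emeasure (bar \<nu>) C = emeasure \<nu> (limit_kernel -` C \<inter> good_part)"
proof -
  have sp: "space (restrict_space \<nu> good_part) = good_part"
    using good_part_space by (auto simp: space_restrict_space stationaryD(3)[OF \<nu>])
  have "emeasure (bar \<nu>) C = emeasure (restrict_space \<nu> good_part) (limit_kernel -` C \<inter> good_part)"
    unfolding bar_def pushforward_on_def
    by (subst emeasure_distr[OF measurable_limit_kernel_restrict[OF stationaryD(2)[OF \<nu>]] C]) (simp only: sp)
  also have "\<dots> = emeasure \<nu> (limit_kernel -` C \<inter> good_part)"
    by (rule emeasure_restrict_space)
      (use good_part_space sets_good_part_X in \<open>auto simp: stationaryD[OF \<nu>]\<close>)
  finally show ?thesis .
qed

lemma bar_in_prob_algebra:
  assumes \<nu>: "\<nu> \<in> stationary"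
  shows "bar \<nu> \<in> space (prob_algebra erg_space)"
proof -
  have "limit_kernel -` space erg_space \<inter> good_part = good_part"
    unfolding space_erg_space limit_kernel_image[symmetric] by blast
  then have "emeasure (bar \<nu>) (space (bar \<nu>)) = 1"
    using emeasure_bar[OF \<nu> sets.top] emeasure_good_part[OF \<nu>] by (simp add: space_bar)
  then show ?thesis by (simp add: space_prob_algebra sets_bar prob_spaceI)
qed

lemma nn_integral_bar:
  assumes \<nu>: "\<nu> \<in> stationary" and A: "A \<in> sets X"
  shows "(\<integral>\<^sup>+\<eta>. emeasure \<eta> A \<partial>bar \<nu>) = emeasure \<nu> A"
proof -
  note s = stationaryD(2)[OF \<nu>] and sp = stationaryD(3)[OF \<nu>]
  have "(\<integral>\<^sup>+\<eta>. emeasure \<eta> A \<partial>bar \<nu>) = (\<integral>\<^sup>+x. emeasure (limit_kernel x) A \<partial>restrict_space \<nu> good_part)"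
    unfolding bar_def pushforward_on_def
    by (rule nn_integral_distr[OF measurable_limit_kernel_restrict[OF s]])
      (use measurable_emeasure_erg_space[OF A] in simp)
  also have "\<dots> = (\<integral>\<^sup>+x. emeasure (limit_kernel x) A * indicator good_part x \<partial>\<nu>)"
    by (rule nn_integral_restrict_space) (use good_part_space sets_good_part_X in \<open>auto simp: s sp\<close>)
  also have "\<dots> = emeasure \<nu> (A \<inter> good_part)"
    by (rule nn_integral_limit_kernel_indicator[OF \<nu> sets_good_part A])
  also have "\<dots> = emeasure \<nu> A"
  proof (rule emeasure_eq_AE)
    show "AE x in \<nu>. x \<in> A \<inter> good_part \<longleftrightarrow> x \<in> A"
      using AE_good_part[OF \<nu>] by eventually_elim simp
  qed (use A sets_good_part_X in \<open>auto simp: s\<close>)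
  finally show ?thesis .
qed

lemma is_mixture_bar: "\<nu> \<in> stationary \<Longrightarrow> is_mixture X \<nu> (bar \<nu>)"
  by (simp add: is_mixture_def nn_integral_bar)

lemma emeasure_vimage_erg_space:
  assumes \<eta>: "\<eta> \<in> space erg_space" and C: "C \<in> sets erg_space"
  shows "emeasure \<eta> (limit_kernel -` C \<inter> good_part) = indicator C \<eta>"
proof -
  have st: "\<eta> \<in> stationary" and triv: "tail_trivial \<eta>" using \<eta> by (auto simp: space_erg_space)
  have s: "limit_kernel -` C \<inter> good_part \<in> sets \<eta>"
    using sets_vimage_limit_kernel[OF C] by (simp only: stationaryD(2)[OF st])
  have f: "emeasure \<eta> (limit_kernel -` {\<eta>} \<inter> good_part) = 1"
    by (rule emeasure_limit_kernel_fibre[OF st triv])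
  interpret prob_space \<eta> by (rule stationaryD(1)[OF st])
  show ?thesis
  proof (cases "\<eta> \<in> C")
    case True
    then have "limit_kernel -` {\<eta>} \<inter> good_part \<subseteq> limit_kernel -` C \<inter> good_part" by blast
    then have "1 \<le> emeasure \<eta> (limit_kernel -` C \<inter> good_part)"
      unfolding f[symmetric] by (rule emeasure_mono[OF _ s])
    moreover have "emeasure \<eta> (limit_kernel -` C \<inter> good_part) \<le> 1" by (rule emeasure_le_1)
    ultimately have "emeasure \<eta> (limit_kernel -` C \<inter> good_part) = 1" by (rule order_antisym[rotated])
    then show ?thesis using True by simp
  next
    case False
    have "emeasure \<eta> (limit_kernel -` C \<inter> good_part) = emeasure \<eta> {}"
    proof (rule emeasure_eq_AE)
      show "AE x in \<eta>. x \<in> limit_kernel -` C \<inter> good_part \<longleftrightarrow> x \<in> {}"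
        using AE_limit_kernel_eq[OF st triv] by eventually_elim (use False in auto)
    qed (use s in auto)
    then show ?thesis using False by simp
  qed
qed

lemma is_mixture_unique:
  assumes \<nu>: "\<nu> \<in> stationary" and P: "P \<in> space (prob_algebra erg_space)" and mix: "is_mixture X \<nu> P"
  shows "P = bar \<nu>"
proof (rule measure_eqI)
  have sP: "sets P = sets erg_space" using P by (simp add: space_prob_algebra)
  then show "sets P = sets (bar \<nu>)" by (simp add: sets_bar)
  have spP: "space P = space erg_space" by (rule sets_eq_imp_space_eq[OF sP])
  fix C assume "C \<in> sets P"
  then have C: "C \<in> sets erg_space" by (simp only: sP)
  have "emeasure (bar \<nu>) C = (\<integral>\<^sup>+\<eta>. emeasure \<eta> (limit_kernel -` C \<inter> good_part) \<partial>P)"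
    using mix sets_vimage_limit_kernel[OF C] by (simp add: emeasure_bar[OF \<nu> C] is_mixture_def)
  also have "\<dots> = (\<integral>\<^sup>+\<eta>. indicator C \<eta> \<partial>P)"
    by (rule nn_integral_cong) (simp add: emeasure_vimage_erg_space[OF _ C] spP)
  also have "\<dots> = emeasure P C" using C by (simp add: sP)
  finally show "emeasure P C = emeasure (bar \<nu>) C" by simp
qed

definition mix :: "'x measure measure \<Rightarrow> 'x measure" where
  "mix P = P \<bind> (\<lambda>\<eta>. \<eta>)"

lemma emeasure_mix:
  assumes "P \<in> space (prob_algebra erg_space)" "A \<in> sets X"
  shows "emeasure (mix P) A = (\<integral>\<^sup>+\<eta>. emeasure \<eta> A \<partial>P)"
  unfolding mix_def by (rule emeasure_bind_prob_algebra[OF assms(1) measurable_id_erg_space assms(2)])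

lemma mix_stationary:
  assumes P: "P \<in> space (prob_algebra erg_space)"
  shows "mix P \<in> stationary"
proof -
  have "prob_space P" and sP: "sets P = sets erg_space" using P by (auto simp: space_prob_algebra)
  have spP: "space P = space erg_space" by (rule sets_eq_imp_space_eq[OF sP])
  have pr: "mix P \<in> space (prob_algebra X)"
    using prob_space_bind'[OF P measurable_id_erg_space] sets_bind'[OF P measurable_id_erg_space]
    by (simp add: space_prob_algebra mix_def)
  have m: "(\<lambda>\<eta>. \<eta>) \<in> P \<rightarrow>\<^sub>M subprob_algebra X"
    using measurable_prob_algebraD[OF measurable_id_erg_space] measurable_cong_sets[OF sP refl] by blast
  have "(\<integral>\<^sup>+x. emeasure (\<kappa> n x) A \<partial>mix P) = emeasure (mix P) A" if A: "A \<in> sets X" for n A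
  proof -
    have "(\<integral>\<^sup>+x. emeasure (\<kappa> n x) A \<partial>mix P) = (\<integral>\<^sup>+\<eta>. (\<integral>\<^sup>+x. emeasure (\<kappa> n x) A \<partial>\<eta>) \<partial>P)"
      unfolding mix_def by (rule nn_integral_bind[OF measurable_emeasure_kernel_X[OF A] m])
    also have "\<dots> = (\<integral>\<^sup>+\<eta>. emeasure \<eta> A \<partial>P)"
      by (rule nn_integral_cong) (simp add: spP space_erg_space stationaryD(4) A)
    also have "\<dots> = emeasure (mix P) A" by (rule emeasure_mix[OF P A, symmetric])
    finally show ?thesis .
  qed
  then show ?thesis using pr by (simp add: stationary_def)
qed

lemma bar_mix:
  assumes P: "P \<in> space (prob_algebra erg_space)"
  shows "bar (mix P) = P"
  using is_mixture_unique[OF mix_stationary[OF P] P] emeasure_mix[OF P] by (simp add: is_mixture_def)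

lemma mix_bar:
  assumes \<nu>: "\<nu> \<in> stationary"
  shows "mix (bar \<nu>) = \<nu>"
proof (rule measure_eqI)
  show s: "sets (mix (bar \<nu>)) = sets \<nu>"
    using stationaryD(2)[OF mix_stationary[OF bar_in_prob_algebra[OF \<nu>]]] stationaryD(2)[OF \<nu>] by simp
  fix A assume "A \<in> sets (mix (bar \<nu>))"
  then have A: "A \<in> sets X" using s stationaryD(2)[OF \<nu>] by simp
  show "emeasure (mix (bar \<nu>)) A = emeasure \<nu> A"
    by (simp add: emeasure_mix[OF bar_in_prob_algebra[OF \<nu>] A] nn_integral_bar[OF \<nu> A])
qed

lemma borel_isomorphism_bar: "borel_isomorphism bar stat_space (prob_algebra erg_space)"
  unfolding borel_isomorphism_def
proof (intro conjI)
  show "bar \<in> stat_space \<rightarrow>\<^sub>M prob_algebra erg_space"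
  proof (rule measurable_prob_algebraI)
    show "prob_space (bar \<nu>)" if "\<nu> \<in> space stat_space" for \<nu>
      using bar_in_prob_algebra that by (simp add: space_stat_space space_prob_algebra)
    show "bar \<in> stat_space \<rightarrow>\<^sub>M subprob_algebra erg_space"
    proof (rule measurable_subprob_algebra)
      fix C assume C: "C \<in> sets erg_space"
      have "(\<lambda>\<nu>. emeasure (bar \<nu>) C) \<in> borel_measurable stat_space \<longleftrightarrow>
        (\<lambda>\<nu>. emeasure \<nu> (limit_kernel -` C \<inter> good_part)) \<in> borel_measurable stat_space"
        by (rule measurable_cong) (simp add: space_stat_space emeasure_bar C)
      then show "(\<lambda>\<nu>. emeasure (bar \<nu>) C) \<in> borel_measurable stat_space"
        using measurable_emeasure_stat_space[OF sets_vimage_limit_kernel[OF C]] by simp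
    qed (use bar_in_prob_algebra in \<open>auto simp: space_stat_space space_prob_algebra sets_bar intro: prob_space_imp_subprob_space\<close>)
  qed
  show bij: "bij_betw bar (space stat_space) (space (prob_algebra erg_space))"
    unfolding space_stat_space
    by (rule bij_betw_byWitness[where f'=mix])
      (auto simp: mix_bar bar_mix bar_in_prob_algebra mix_stationary)
  have inv: "the_inv_into (space stat_space) bar P = mix P" if "P \<in> space (prob_algebra erg_space)" for P
    using bij that
    by (intro the_inv_into_f_eq) (auto simp: bij_betw_def bar_mix mix_stationary space_stat_space)
  have "mix \<in> prob_algebra erg_space \<rightarrow>\<^sub>M stat_space"
  proof (rule measurable_stat_spaceI)
    show "mix \<in> prob_algebra erg_space \<rightarrow>\<^sub>M prob_algebra X"
      unfolding mix_def by (rule measurable_bind_prob_space[OF measurable_ident measurable_id_erg_space, unfolded id_def])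
  qed (rule mix_stationary)
  then show "the_inv_into (space stat_space) bar \<in> prob_algebra erg_space \<rightarrow>\<^sub>M stat_space"
    using measurable_cong[of "prob_algebra erg_space" "the_inv_into (space stat_space) bar" mix stat_space] inv by simp
qed

lemma null_sets_bar:
  assumes "\<nu> \<in> stationary" and "C \<in> sets erg_space"
  shows "C \<in> null_sets (bar \<nu>) \<longleftrightarrow> limit_kernel -` C \<inter> good_part \<in> null_sets \<nu>"
  using assms sets_vimage_limit_kernel[of C]
  by (simp add: null_sets_def sets_bar emeasure_bar stationaryD(2))

lemma null_set_iff_AE_bar:
  assumes \<nu>: "\<nu> \<in> stationary" and A: "A \<in> sets X"
  shows "emeasure \<nu> A = 0 \<longleftrightarrow> (AE \<eta> in bar \<nu>. emeasure \<eta> A = 0)"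
proof -
  have "(\<lambda>\<eta>. emeasure \<eta> A) \<in> borel_measurable (bar \<nu>)"
    using measurable_emeasure_erg_space[OF A] measurable_cong_sets[OF sets_bar refl] by blast
  then show ?thesis
    using nn_integral_0_iff_AE[of "\<lambda>\<eta>. emeasure \<eta> A" "bar \<nu>"] nn_integral_bar[OF \<nu> A] by simp
qed

lemma absolutely_continuous_bar:
  assumes 1: "\<nu>\<^sub>1 \<in> stationary" and 2: "\<nu>\<^sub>2 \<in> stationary"
  shows "absolutely_continuous \<nu>\<^sub>2 \<nu>\<^sub>1 \<longleftrightarrow> absolutely_continuous (bar \<nu>\<^sub>2) (bar \<nu>\<^sub>1)"
proof
  assume ac: "absolutely_continuous \<nu>\<^sub>2 \<nu>\<^sub>1"
  show "absolutely_continuous (bar \<nu>\<^sub>2) (bar \<nu>\<^sub>1)"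
    unfolding absolutely_continuous_def
  proof
    fix C assume C: "C \<in> null_sets (bar \<nu>\<^sub>2)"
    then have "C \<in> sets erg_space" using sets_bar by (auto simp: null_sets_def)
    then show "C \<in> null_sets (bar \<nu>\<^sub>1)"
      using C ac null_sets_bar[OF 1] null_sets_bar[OF 2] by (auto simp: absolutely_continuous_def)
  qed
next
  assume ac: "absolutely_continuous (bar \<nu>\<^sub>2) (bar \<nu>\<^sub>1)"
  show "absolutely_continuous \<nu>\<^sub>2 \<nu>\<^sub>1"
    unfolding absolutely_continuous_def
  proof
    fix A assume A: "A \<in> null_sets \<nu>\<^sub>2"
    then have AX: "A \<in> sets X" by (auto simp: null_sets_def stationaryD(2)[OF 2])
    have "AE \<eta> in bar \<nu>\<^sub>2. emeasure \<eta> A = 0"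
      using A null_set_iff_AE_bar[OF 2 AX] by (auto simp: null_sets_def)
    then have "AE \<eta> in bar \<nu>\<^sub>1. emeasure \<eta> A = 0"
      by (rule absolutely_continuous_AE[OF _ ac, rotated]) (simp add: sets_bar)
    then show "A \<in> null_sets \<nu>\<^sub>1"
      using AX null_set_iff_AE_bar[OF 1 AX] by (simp add: null_sets_def stationaryD(2)[OF 1])
  qed
qed

lemma mutually_singular_bar:
  assumes 1: "\<nu>\<^sub>1 \<in> stationary" and 2: "\<nu>\<^sub>2 \<in> stationary"
  shows "mutually_singular \<nu>\<^sub>1 \<nu>\<^sub>2 \<longleftrightarrow> mutually_singular (bar \<nu>\<^sub>1) (bar \<nu>\<^sub>2)"
proof
  assume "mutually_singular \<nu>\<^sub>1 \<nu>\<^sub>2"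
  then obtain A where A: "A \<in> sets X" "emeasure \<nu>\<^sub>1 A = 0" "emeasure \<nu>\<^sub>2 (space X - A) = 0"
    by (auto simp: mutually_singular_def stationaryD[OF 1] stationaryD[OF 2])
  let ?D = "{\<eta> \<in> space erg_space. emeasure \<eta> A \<noteq> 0}"
  have D: "?D \<in> sets erg_space" using A(1) by measurable
  have "AE \<eta> in bar \<nu>\<^sub>1. \<eta> \<notin> ?D"
    using A null_set_iff_AE_bar[OF 1 A(1)] by auto
  then have "emeasure (bar \<nu>\<^sub>1) ?D = emeasure (bar \<nu>\<^sub>1) {}"
    using D by (intro emeasure_eq_AE) (auto simp: sets_bar)
  moreover have "AE \<eta> in bar \<nu>\<^sub>2. emeasure \<eta> (space X - A) = 0"
    using A null_set_iff_AE_bar[OF 2, of "space X - A"] by auto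
  then have "AE \<eta> in bar \<nu>\<^sub>2. \<eta> \<notin> space erg_space - ?D"
    using AE_space[of "bar \<nu>\<^sub>2"]
  proof eventually_elim
    case (elim \<eta>)
    then have st: "\<eta> \<in> stationary" by (simp add: space_bar space_erg_space)
    interpret prob_space \<eta> by (rule stationaryD(1)[OF st])
    have "A \<in> events" using A(1) by (simp only: stationaryD(2)[OF st])
    from prob_compl[OF this] have "prob (space X - A) = 1 - prob A" by (simp only: stationaryD(3)[OF st])
    moreover have "prob (space X - A) = 0" using elim by (simp add: measure_def)
    ultimately have "emeasure \<eta> A \<noteq> 0" by (simp add: emeasure_eq_measure)
    then show ?case using elim by (simp add: space_bar)
  qed
  then have "emeasure (bar \<nu>\<^sub>2) (space erg_space - ?D) = emeasure (bar \<nu>\<^sub>2) {}"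
    using D by (intro emeasure_eq_AE) (auto simp: sets_bar)
  ultimately show "mutually_singular (bar \<nu>\<^sub>1) (bar \<nu>\<^sub>2)"
    using D by (auto simp: mutually_singular_def sets_bar space_bar intro!: bexI[of _ ?D])
next
  assume "mutually_singular (bar \<nu>\<^sub>1) (bar \<nu>\<^sub>2)"
  then obtain D where D: "D \<in> sets erg_space" "emeasure (bar \<nu>\<^sub>1) D = 0" "emeasure (bar \<nu>\<^sub>2) (space erg_space - D) = 0"
    by (auto simp: mutually_singular_def sets_bar space_bar)
  let ?A = "limit_kernel -` D \<inter> good_part"
  have A: "?A \<in> sets X" by (rule sets_vimage_limit_kernel[OF D(1)])
  have "emeasure \<nu>\<^sub>1 ?A = 0" using D emeasure_bar[OF 1 D(1)] by simp
  moreover have "emeasure \<nu>\<^sub>2 (space X - ?A) = 0"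
  proof -
    have D': "space erg_space - D \<in> sets erg_space" using D(1) by auto
    have "emeasure \<nu>\<^sub>2 (limit_kernel -` (space erg_space - D) \<inter> good_part) = 0"
      using D(3) emeasure_bar[OF 2 D'] by simp
    then have "limit_kernel -` (space erg_space - D) \<inter> good_part \<in> null_sets \<nu>\<^sub>2"
      using sets_vimage_limit_kernel[OF D'] by (simp add: null_sets_def stationaryD(2)[OF 2])
    from AE_not_in[OF this] AE_good_part[OF 2] have "AE x in \<nu>\<^sub>2. x \<in> space X - ?A \<longleftrightarrow> x \<in> {}"
    proof eventually_elim
      case (elim x)
      then show ?case using limit_kernel_image by (auto simp: space_erg_space)
    qed
    then have "emeasure \<nu>\<^sub>2 (space X - ?A) = emeasure \<nu>\<^sub>2 {}"
      using A by (intro emeasure_eq_AE) (auto simp: stationaryD(2)[OF 2])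
    then show ?thesis by simp
  qed
  ultimately show "mutually_singular \<nu>\<^sub>1 \<nu>\<^sub>2"
    using A by (auto simp: mutually_singular_def stationaryD[OF 1] stationaryD[OF 2] intro!: bexI[of _ ?A])
qed

end

section \<open>Haar measure of a compact metrizable group\<close>

locale topological_content =
  fixes T :: "'a topology" and \<Lambda> :: "'a set \<Rightarrow> ennreal"
  assumes compact_T: "compact_space T" and normal_T: "normal_space T"
    and content_mono: "closedin T C \<Longrightarrow> closedin T D \<Longrightarrow> C \<subseteq> D \<Longrightarrow> \<Lambda> C \<le> \<Lambda> D"
    and content_subadd: "closedin T C \<Longrightarrow> closedin T D \<Longrightarrow> \<Lambda> (C \<union> D) \<le> \<Lambda> C + \<Lambda> D"
    and content_add: "closedin T C \<Longrightarrow> closedin T D \<Longrightarrow> C \<inter> D = {} \<Longrightarrow> \<Lambda> (C \<union> D) = \<Lambda> C + \<Lambda> D"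
    and content_empty: "\<Lambda> {} = 0"
begin

definition inner :: "'a set \<Rightarrow> ennreal" where
  "inner U = (SUP C\<in>{C. closedin T C \<and> C \<subseteq> U}. \<Lambda> C)"

definition outer :: "'a set \<Rightarrow> ennreal" where
  "outer A = (INF U\<in>{U. openin T U \<and> A \<subseteq> U}. inner U)"

lemma inner_upper: "closedin T C \<Longrightarrow> C \<subseteq> U \<Longrightarrow> \<Lambda> C \<le> inner U"
  unfolding inner_def by (intro SUP_upper) simp

lemma inner_mono: "U \<subseteq> V \<Longrightarrow> inner U \<le> inner V"
  unfolding inner_def by (intro SUP_subset_mono) auto

lemma outer_lower: "openin T U \<Longrightarrow> A \<subseteq> U \<Longrightarrow> outer A \<le> inner U"
  unfolding outer_def by (intro INF_lower) simp

lemma outer_open: "openin T U \<Longrightarrow> outer U = inner U"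
  by (intro antisym outer_lower) (auto simp: outer_def intro!: INF_greatest inner_mono)

lemma outer_mono: "A \<subseteq> B \<Longrightarrow> outer A \<le> outer B"
  unfolding outer_def by (intro INF_superset_mono) auto

lemma inner_empty: "inner {} = 0"
  unfolding inner_def by (simp add: content_empty SUP_constant image_constant_conv)

lemma outer_empty: "outer {} = 0"
  using outer_open[of "{}"] inner_empty by simp

lemma closed_split:
  assumes C: "closedin T C" and U: "openin T U" and V: "openin T V" and sub: "C \<subseteq> U \<union> V"
  obtains C1 C2 where "closedin T C1" "closedin T C2" "C1 \<subseteq> U" "C2 \<subseteq> V" "C = C1 \<union> C2"
proof -
  have "closedin T (C - U)" "closedin T (C - V)" using C U V by (auto intro: closedin_diff)
  moreover have "disjnt (C - U) (C - V)" using sub by (auto simp: disjnt_def)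
  ultimately obtain P Q where PQ: "openin T P" "openin T Q" "C - U \<subseteq> P" "C - V \<subseteq> Q" "disjnt P Q"
    using normal_T unfolding normal_space_def by meson
  show thesis
  proof (rule that[of "C - P" "C - Q"])
    show "closedin T (C - P)" "closedin T (C - Q)" using C PQ by (auto intro: closedin_diff)
  qed (use PQ in \<open>auto simp: disjnt_def\<close>)
qed

lemma content_le_sum_inner:
  assumes "finite I" "\<And>i. i \<in> I \<Longrightarrow> openin T (U i)" "closedin T C" "C \<subseteq> (\<Union>i\<in>I. U i)"
  shows "\<Lambda> C \<le> (\<Sum>i\<in>I. inner (U i))"
  using assms
proof (induction I arbitrary: C rule: finite_induct)
  case empty
  then show ?case by (simp add: content_empty)
next
  case (insert i I)
  have "openin T (U i)" "openin T (\<Union>j\<in>I. U j)" "C \<subseteq> U i \<union> (\<Union>j\<in>I. U j)"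
    using insert.prems by auto
  then obtain C1 C2 where C: "closedin T C1" "closedin T C2" "C1 \<subseteq> U i" "C2 \<subseteq> (\<Union>j\<in>I. U j)" "C = C1 \<union> C2"
    using closed_split[OF insert.prems(2)] by metis
  have "\<Lambda> C \<le> \<Lambda> C1 + \<Lambda> C2" unfolding C(5) by (rule content_subadd[OF C(1,2)])
  also have "\<dots> \<le> inner (U i) + (\<Sum>j\<in>I. inner (U j))"
    using insert.prems(1) C by (intro add_mono inner_upper insert.IH) auto
  finally show ?case using insert.hyps by simp
qed

lemma inner_UN_le:
  fixes U :: "nat \<Rightarrow> 'a set"
  assumes U: "\<And>i. openin T (U i)"
  shows "inner (\<Union>i. U i) \<le> (\<Sum>i. inner (U i))"
  unfolding inner_def[of "\<Union>i. U i"]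
proof (rule SUP_least, clarify)
  fix C assume C: "closedin T C" "C \<subseteq> (\<Union>i. U i)"
  then have "compactin T C" by (rule_tac closedin_compact_space[OF compact_T])
  then have "\<exists>\<F>. finite \<F> \<and> \<F> \<subseteq> range U \<and> C \<subseteq> \<Union>\<F>"
    using compactinD[of T C "range U"] C U by auto
  then obtain \<F> where \<F>: "finite \<F>" "\<F> \<subseteq> range U" "C \<subseteq> \<Union>\<F>" by blast
  then obtain I where I: "finite I" "\<F> = U ` I" using finite_subset_image by metis
  have "\<Lambda> C \<le> (\<Sum>i\<in>I. inner (U i))"
    using content_le_sum_inner[OF I(1) U C(1)] \<F>(3) I(2) by simp
  also have "\<dots> \<le> (\<Sum>i. inner (U i))" by (rule sum_le_suminf[OF summableI I(1)]) simp
  finally show "\<Lambda> C \<le> (\<Sum>i. inner (U i))" .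
qed

lemma outer_UN_le:
  fixes A :: "nat \<Rightarrow> 'a set"
  assumes A: "\<And>i. A i \<subseteq> topspace T"
  shows "outer (\<Union>i. A i) \<le> (\<Sum>i. outer (A i))"
proof (rule ennreal_le_epsilon)
  fix e :: real assume "(\<Sum>i. outer (A i)) < top_class.top" and e: "0 < e"
  then have *: "outer (A n) < outer (A n) + ennreal (e * (1/2)^Suc n)" for n
    by (auto simp: less_top dest!: ennreal_suminf_lessD)
  have "\<exists>U. openin T U \<and> A n \<subseteq> U \<and> inner U < outer (A n) + ennreal (e * (1/2)^Suc n)" for n
    using *[of n] unfolding outer_def[of "A n"] INF_less_iff by auto
  then obtain U where U: "\<And>n. openin T (U n)" "\<And>n. A n \<subseteq> U n"
    "\<And>n. inner (U n) < outer (A n) + ennreal (e * (1/2)^Suc n)" by metis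
  have "outer (\<Union>i. A i) \<le> inner (\<Union>i. U i)"
    using U(1,2) by (intro outer_lower) auto
  also have "\<dots> \<le> (\<Sum>i. inner (U i))" by (rule inner_UN_le[OF U(1)])
  also have "\<dots> \<le> (\<Sum>n. outer (A n) + ennreal (e * (1/2) ^ Suc n))"
    by (intro suminf_le less_imp_le U(3) summableI)
  also have "\<dots> = (\<Sum>n. outer (A n)) + (\<Sum>n. ennreal e * ennreal ((1/2) ^ Suc n))"
    using e by (subst suminf_add[symmetric])
      (auto simp del: ennreal_suminf_cmult simp add: ennreal_mult[symmetric])
  also have "\<dots> = (\<Sum>n. outer (A n)) + ennreal e"
    unfolding ennreal_suminf_cmult
    by (subst suminf_ennreal_eq[OF zero_le_power power_half_series]) auto
  finally show "outer (\<Union>i. A i) \<le> (\<Sum>n. outer (A n)) + ennreal e" .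
qed

lemma outer_measure_space_outer: "outer_measure_space (Pow (topspace T)) outer"
  unfolding outer_measure_space_def
proof (intro conjI)
  show "positive (Pow (topspace T)) outer" by (simp add: positive_def outer_empty)
  show "increasing (Pow (topspace T)) outer" by (auto simp: increasing_def intro: outer_mono)
  show "countably_subadditive (Pow (topspace T)) outer"
    by (auto simp: countably_subadditive_def intro!: outer_UN_le)
qed

lemma inner_split:
  assumes U: "openin T U" and V: "openin T V"
  shows "inner (V \<inter> U) + outer (V - U) \<le> inner V"
proof -
  have "\<Lambda> C + outer (V - U) \<le> inner V" if C: "closedin T C" "C \<subseteq> V \<inter> U" for C
  proof -
    have "\<Lambda> C + inner (V - C) \<le> inner V"
      unfolding inner_def[of "V - C"]
    proof (subst ennreal_SUP_add_right)
      show "{D. closedin T D \<and> D \<subseteq> V - C} \<noteq> {}" by blast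
      show "(SUP D\<in>{D. closedin T D \<and> D \<subseteq> V - C}. \<Lambda> C + \<Lambda> D) \<le> inner V"
      proof (rule SUP_least, clarify)
        fix D assume D: "closedin T D" "D \<subseteq> V - C"
        have "\<Lambda> C + \<Lambda> D = \<Lambda> (C \<union> D)" using C D by (intro content_add[symmetric]) auto
        also have "\<dots> \<le> inner V" using C D by (intro inner_upper) auto
        finally show "\<Lambda> C + \<Lambda> D \<le> inner V" .
      qed
    qed
    moreover have "outer (V - U) \<le> inner (V - C)"
      using C by (intro outer_lower openin_diff V) auto
    ultimately show ?thesis by (meson add_left_mono order_trans)
  qed
  then show ?thesis
    unfolding inner_def[of "V \<inter> U"]
    by (subst ennreal_SUP_add_left[symmetric]) (auto intro!: SUP_least)
qed

lemma open_in_lambda_system: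
  assumes U: "openin T U"
  shows "U \<in> lambda_system (topspace T) (Pow (topspace T)) outer"
proof -
  have le: "outer (U \<inter> A) + outer ((topspace T - U) \<inter> A) \<le> outer A" if "A \<subseteq> topspace T" for A
    unfolding outer_def[of A]
  proof (rule INF_greatest, clarify)
    fix V assume V: "openin T V" "A \<subseteq> V"
    have "outer (U \<inter> A) + outer ((topspace T - U) \<inter> A) \<le> inner (V \<inter> U) + outer (V - U)"
      using V U by (intro add_mono outer_lower outer_mono) auto
    also have "\<dots> \<le> inner V" by (rule inner_split[OF U V(1)])
    finally show "outer (U \<inter> A) + outer ((topspace T - U) \<inter> A) \<le> inner V" .
  qed
  have ge: "outer A \<le> outer (U \<inter> A) + outer ((topspace T - U) \<inter> A)" if A: "A \<subseteq> topspace T" for A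
  proof -
    interpret P: sigma_algebra "topspace T" "Pow (topspace T)" by (rule sigma_algebra_Pow)
    have "countably_subadditive (Pow (topspace T)) outer" "positive (Pow (topspace T)) outer"
      using outer_measure_space_outer by (auto simp: outer_measure_space_def)
    then have "subadditive (Pow (topspace T)) outer"
      by (rule P.countably_subadditive_subadditive[rotated])
    then have "outer ((U \<inter> A) \<union> ((topspace T - U) \<inter> A)) \<le> outer (U \<inter> A) + outer ((topspace T - U) \<inter> A)"
      using A by (intro subadditiveD[of "Pow (topspace T)"]) auto
    moreover have "(U \<inter> A) \<union> ((topspace T - U) \<inter> A) = A" using A by blast
    ultimately show ?thesis by simp
  qed
  show ?thesis
    using le ge openin_subset[OF U] by (auto simp: lambda_system_def intro!: antisym)
qed

definition content_measure :: "'a measure" where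
  "content_measure = measure_of (topspace T) {U. openin T U} outer"

lemma open_sets_subset: "{U. openin T U} \<subseteq> Pow (topspace T)"
  by (auto dest: openin_subset)

lemma sets_content_measure: "sets content_measure = sigma_sets (topspace T) {U. openin T U}"
  and space_content_measure: "space content_measure = topspace T"
  unfolding content_measure_def by (simp_all add: open_sets_subset)

lemma emeasure_content_measure:
  assumes "A \<in> sigma_sets (topspace T) {U. openin T U}"
  shows "emeasure content_measure A = outer A"
proof (rule emeasure_measure_of[OF content_measure_def open_sets_subset])
  interpret P: sigma_algebra "topspace T" "Pow (topspace T)" by (rule sigma_algebra_Pow)
  let ?L = "lambda_system (topspace T) (Pow (topspace T)) outer"
  have L: "measure_space (topspace T) ?L outer"
    by (rule P.caratheodory_lemma[OF outer_measure_space_outer])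
  interpret L: sigma_algebra "topspace T" ?L
    using L by (simp add: measure_space_def)
  have "sigma_sets (topspace T) {U. openin T U} \<subseteq> ?L"
    by (rule L.sigma_sets_subset) (auto intro: open_in_lambda_system)
  then have "measure_space (topspace T) (sigma_sets (topspace T) {U. openin T U}) outer"
    by (intro measure_down[OF L] sigma_algebra_sigma_sets open_sets_subset)
  then show "positive (sets content_measure) outer" "countably_additive (sets content_measure) outer"
    by (auto simp: measure_space_def sets_content_measure)
qed (simp add: sets_content_measure assms)

lemma emeasure_content_measure_open: "openin T U \<Longrightarrow> emeasure content_measure U = inner U"
  by (simp add: emeasure_content_measure outer_open sigma_sets.Basic)

lemma emeasure_content_measure_space: "emeasure content_measure (topspace T) = \<Lambda> (topspace T)"
proof -
  have "inner (topspace T) = \<Lambda> (topspace T)"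
    by (intro antisym inner_upper) (auto simp: inner_def intro!: SUP_least content_mono dest: closedin_subset)
  then show ?thesis by (simp add: emeasure_content_measure_open)
qed

lemma distr_content_measure:
  assumes fg: "homeomorphic_maps T T f g"
    and inv: "\<And>C. closedin T C \<Longrightarrow> \<Lambda> (f ` C) = \<Lambda> C"
    and fin: "\<Lambda> (topspace T) \<noteq> \<infinity>"
  shows "distr content_measure content_measure g = content_measure"
proof -
  have f: "continuous_map T T f" and g: "continuous_map T T g"
    and gf: "\<And>x. x \<in> topspace T \<Longrightarrow> g (f x) = x" and fg': "\<And>x. x \<in> topspace T \<Longrightarrow> f (g x) = x"
    using fg by (auto simp: homeomorphic_maps_def)
  have f_in: "x \<in> topspace T \<Longrightarrow> f x \<in> topspace T" and g_in: "x \<in> topspace T \<Longrightarrow> g x \<in> topspace T" for x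
    using f g by (auto simp: continuous_map_def)
  have vim: "g -` A \<inter> topspace T = f ` A" if "A \<subseteq> topspace T" for A
  proof (intro equalityI subsetI)
    fix x assume "x \<in> g -` A \<inter> topspace T"
    then show "x \<in> f ` A" using fg'[of x] by (intro image_eqI[of _ _ "g x"]) auto
  next
    fix x assume "x \<in> f ` A"
    then show "x \<in> g -` A \<inter> topspace T" using that gf f_in by (auto simp: subset_iff)
  qed
  have vim': "{x \<in> topspace T. g x \<in> A} = f ` A" if "A \<subseteq> topspace T" for A
    using vim[OF that] by blast
  have vimf: "{x \<in> topspace T. f x \<in> A} \<subseteq> topspace T" for A by blast
  have meas: "g \<in> content_measure \<rightarrow>\<^sub>M content_measure"
  proof (rule measurable_sigma_sets[OF sets_content_measure open_sets_subset])
    show "g \<in> space content_measure \<rightarrow> topspace T" using g_in by (auto simp: space_content_measure)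
    fix U assume "U \<in> {U. openin T U}"
    then have "openin T (g -` U \<inter> topspace T)"
      using openin_continuous_map_preimage[OF g, of U] by (simp add: vimage_def Int_def conj_commute)
    then show "g -` U \<inter> space content_measure \<in> sets content_measure"
      by (auto simp: space_content_measure sets_content_measure)
  qed
  have open_im: "openin T (f ` U)" and inner_im: "inner (f ` U) = inner U" if U: "openin T U" for U
  proof -
    have Us: "U \<subseteq> topspace T" by (rule openin_subset[OF U])
    show "openin T (f ` U)"
      using openin_continuous_map_preimage[OF g U] vim'[OF Us] by simp
    have closed_im: "closedin T (f ` C)" if C: "closedin T C" for C
      using closedin_continuous_map_preimage[OF g C] vim'[OF closedin_subset[OF C]] by simp
    show "inner (f ` U) = inner U"
    proof (rule antisym)
      show "inner U \<le> inner (f ` U)"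
        unfolding inner_def[of U]
      proof (rule SUP_least, clarify)
        fix C assume C: "closedin T C" "C \<subseteq> U"
        then have "\<Lambda> (f ` C) \<le> inner (f ` U)" by (intro inner_upper closed_im) auto
        then show "\<Lambda> C \<le> inner (f ` U)" by (simp add: inv[OF C(1)])
      qed
      show "inner (f ` U) \<le> inner U"
        unfolding inner_def[of "f ` U"]
      proof (rule SUP_least, clarify)
        fix C assume C: "closedin T C" "C \<subseteq> f ` U"
        let ?D = "{x \<in> topspace T. f x \<in> C}"
        have D: "closedin T ?D" by (rule closedin_continuous_map_preimage[OF f C(1)])
        have "f ` ?D = C"
        proof
          show "C \<subseteq> f ` ?D" using C(2) Us by auto
        qed auto
        then have "\<Lambda> C = \<Lambda> ?D" using inv[OF D] by simp
        also have "\<dots> \<le> inner U"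
        proof (rule inner_upper[OF D], clarify)
          fix x assume "x \<in> topspace T" "f x \<in> C"
          then obtain u where "u \<in> U" "f x = f u" using C(2) by blast
          then show "x \<in> U" using gf[of x] gf[of u] Us \<open>x \<in> topspace T\<close> by auto
        qed
        finally show "\<Lambda> C \<le> inner U" .
      qed
    qed
  qed
  have eq: "emeasure (distr content_measure content_measure g) U = emeasure content_measure U" if U: "openin T U" for U
  proof -
    have "U \<in> sets content_measure" using U by (auto simp: sets_content_measure)
    then have "emeasure (distr content_measure content_measure g) U = emeasure content_measure (f ` U)"
      using vim[OF openin_subset[OF U]] by (simp add: emeasure_distr[OF meas] space_content_measure)
    then show ?thesis
      by (simp add: emeasure_content_measure_open open_im[OF U] inner_im[OF U] U)
  qed
  show ?thesis
  proof (rule measure_eqI_generator_eq[where E="{U. openin T U}" and \<Omega>="topspace T" and A="\<lambda>_. topspace T"])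
    show "Int_stable {U. openin T U}" by (auto simp: Int_stable_def)
    show "emeasure (distr content_measure content_measure g) (topspace T) \<noteq> \<infinity>"
      using eq[OF openin_topspace] fin by (simp add: emeasure_content_measure_space)
  qed (use eq open_sets_subset in \<open>auto simp: sets_content_measure\<close>)
qed

end

locale compact_metric = Metric_space M d for M :: "'a set" and d +
  assumes compact_M: "compact_space mtopology" and nonempty_M: "M \<noteq> {}"
begin

definition isometries :: "('a \<Rightarrow> 'a) set" where
  "isometries = {f. f ` M = M \<and> (\<forall>x\<in>M. \<forall>y\<in>M. d (f x) (f y) = d x y)}"

definition covers :: "real \<Rightarrow> 'a set \<Rightarrow> nat \<Rightarrow> bool" where
  "covers e A n \<longleftrightarrow> (\<exists>F. finite F \<and> F \<subseteq> M \<and> card F \<le> n \<and> A \<subseteq> (\<Union>x\<in>F. mball x e))"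

definition cov :: "real \<Rightarrow> 'a set \<Rightarrow> nat" where
  "cov e A = (LEAST n. covers e A n)"

lemma coversI:
  "finite F \<Longrightarrow> F \<subseteq> M \<Longrightarrow> card F \<le> n \<Longrightarrow> A \<subseteq> (\<Union>x\<in>F. mball x e) \<Longrightarrow> covers e A n"
  unfolding covers_def by (intro exI[of _ F] conjI)

lemma coversE:
  assumes "covers e A n"
  obtains F where "finite F" "F \<subseteq> M" "card F \<le> n" "A \<subseteq> (\<Union>x\<in>F. mball x e)"
  using assms unfolding covers_def by (elim exE conjE) (rule that)

lemma isometries_in: "f \<in> isometries \<Longrightarrow> x \<in> M \<Longrightarrow> f x \<in> M"
  by (auto simp: isometries_def)

lemma isometries_inj: "f \<in> isometries \<Longrightarrow> inj_on f M"
  by (auto simp: isometries_def inj_on_def) (metis zero)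

lemma inv_isometries:
  assumes f: "f \<in> isometries"
  shows "inv_into M f \<in> isometries"
proof -
  have im: "f ` M = M" and inj: "inj_on f M" using f isometries_inj by (auto simp: isometries_def)
  have "inv_into M f ` M = M" using inv_into_image_cancel[OF inj order_refl] by (simp add: im)
  moreover have "d (inv_into M f x) (inv_into M f y) = d x y" if "x \<in> M" "y \<in> M" for x y
  proof -
    have "inv_into M f x \<in> M" "inv_into M f y \<in> M" using that im by (auto intro: inv_into_into)
    then have "d (f (inv_into M f x)) (f (inv_into M f y)) = d (inv_into M f x) (inv_into M f y)"
      using f by (auto simp: isometries_def)
    then show ?thesis using that im by (simp add: f_inv_into_f)
  qed
  ultimately show ?thesis by (auto simp: isometries_def)
qed

lemma continuous_isometries:
  assumes f: "f \<in> isometries"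
  shows "continuous_map mtopology mtopology f"
  unfolding continuous_map_def
proof (intro conjI allI impI)
  show "f \<in> topspace mtopology \<rightarrow> topspace mtopology" using isometries_in[OF f] by auto
  fix U assume U: "openin mtopology U"
  have "\<exists>r>0. mball x r \<subseteq> {x \<in> M. f x \<in> U}" if x: "x \<in> M" "f x \<in> U" for x
  proof -
    obtain r where r: "r > 0" "mball (f x) r \<subseteq> U" using U x(2) by (auto simp: openin_mtopology)
    have "mball x r \<subseteq> {x \<in> M. f x \<in> U}"
    proof
      fix y assume y: "y \<in> mball x r"
      then have "y \<in> M" "d x y < r" by auto
      then have "d (f x) (f y) < r" using f x by (auto simp: isometries_def)
      then have "f y \<in> mball (f x) r" using isometries_in[OF f] x \<open>y \<in> M\<close> by simp
      then show "y \<in> {x \<in> M. f x \<in> U}" using r \<open>y \<in> M\<close> by auto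
    qed
    then show ?thesis using r by blast
  qed
  then show "openin mtopology {x \<in> topspace mtopology. f x \<in> U}"
    by (auto simp: openin_mtopology)
qed

lemma ex_covers:
  assumes "0 < e" "A \<subseteq> M"
  shows "\<exists>n. covers e A n"
proof -
  have "compactin mtopology M" using compact_M by (simp add: compact_space_def)
  then have "mtotally_bounded M" by (rule compactin_imp_mtotally_bounded)
  then have "\<exists>F. finite F \<and> F \<subseteq> M \<and> M \<subseteq> (\<Union>x\<in>F. mball x e)"
    using assms(1) by (simp add: mtotally_bounded_def)
  then obtain F where "finite F" "F \<subseteq> M" "M \<subseteq> (\<Union>x\<in>F. mball x e)" by (elim exE conjE)
  then have "covers e A (card F)" using assms(2) by (intro coversI[of F]) (simp_all add: order_trans[of A M])
  then show ?thesis ..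
qed

lemma covers_cov: "0 < e \<Longrightarrow> A \<subseteq> M \<Longrightarrow> covers e A (cov e A)"
  unfolding cov_def by (rule LeastI_ex[where P="covers e A", OF ex_covers])

lemma cov_le: "covers e A n \<Longrightarrow> cov e A \<le> n"
  unfolding cov_def by (rule Least_le)

lemma cov_mono:
  assumes "0 < e" "A \<subseteq> B" "B \<subseteq> M"
  shows "cov e A \<le> cov e B"
proof -
  obtain F where F: "finite F" "F \<subseteq> M" "card F \<le> cov e B" "B \<subseteq> (\<Union>x\<in>F. mball x e)"
    by (rule coversE[OF covers_cov[OF assms(1,3)]])
  show ?thesis by (rule cov_le[OF coversI[OF F(1-3) order_trans[OF assms(2) F(4)]]])
qed

lemma cov_Un:
  assumes "0 < e" "A \<subseteq> M" "B \<subseteq> M"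
  shows "cov e (A \<union> B) \<le> cov e A + cov e B"
proof -
  obtain F where F: "finite F" "F \<subseteq> M" "card F \<le> cov e A" "A \<subseteq> (\<Union>x\<in>F. mball x e)"
    by (rule coversE[OF covers_cov[OF assms(1,2)]])
  obtain G where G: "finite G" "G \<subseteq> M" "card G \<le> cov e B" "B \<subseteq> (\<Union>x\<in>G. mball x e)"
    by (rule coversE[OF covers_cov[OF assms(1,3)]])
  show ?thesis
  proof (rule cov_le)
    have "card (F \<union> G) \<le> cov e A + cov e B"
      using card_Un_le[of F G] F(3) G(3) by linarith
    moreover have "A \<union> B \<subseteq> (\<Union>x\<in>F\<union>G. mball x e)" using F(4) G(4) by blast
    ultimately show "covers e (A \<union> B) (cov e A + cov e B)"
      using F(1,2) G(1,2) by (intro coversI[of "F \<union> G"]) simp_all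
  qed
qed

lemma cov_isometry_le:
  assumes "0 < e" "A \<subseteq> M" and f: "f \<in> isometries"
  shows "cov e (f ` A) \<le> cov e A"
proof -
  obtain F where F: "finite F" "F \<subseteq> M" "card F \<le> cov e A" "A \<subseteq> (\<Union>x\<in>F. mball x e)"
    by (rule coversE[OF covers_cov[OF assms(1,2)]])
  show ?thesis
  proof (rule cov_le)
    have "f ` A \<subseteq> (\<Union>x\<in>f ` F. mball x e)"
    proof clarify
      fix a assume "a \<in> A"
      then obtain x where x: "x \<in> F" "a \<in> M" "d x a < e" using F(4) by auto
      then have "d (f x) (f a) < e" using f F(2) by (auto simp: isometries_def)
      then show "f a \<in> (\<Union>x\<in>f ` F. mball x e)"
        using x F(2) isometries_in[OF f] by (auto simp: subset_iff)
    qed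
    moreover have "card (f ` F) \<le> cov e A" using card_image_le[OF F(1), of f] F(3) by linarith
    moreover have "f ` F \<subseteq> M" using F(2) isometries_in[OF f] by blast
    ultimately show "covers e (f ` A) (cov e A)"
      using F(1) by (intro coversI[of "f ` F"]) simp_all
  qed
qed

lemma cov_isometry:
  assumes "0 < e" "A \<subseteq> M" and f: "f \<in> isometries"
  shows "cov e (f ` A) = cov e A"
proof (rule antisym[OF cov_isometry_le[OF assms]])
  have "f ` A \<subseteq> M" using assms isometries_in by blast
  from cov_isometry_le[OF assms(1) this inv_isometries[OF f]]
  show "cov e A \<le> cov e (f ` A)"
    using assms isometries_inj[OF f] by (simp add: inv_into_image_cancel)
qed

lemma cov_separated:
  assumes e: "0 < e" and A: "A \<subseteq> M" and B: "B \<subseteq> M"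
    and sep: "\<And>x y. x \<in> A \<Longrightarrow> y \<in> B \<Longrightarrow> 2 * e \<le> d x y"
  shows "cov e (A \<union> B) = cov e A + cov e B"
proof (rule antisym[OF cov_Un[OF e A B]])
  obtain F where F: "finite F" "F \<subseteq> M" "card F \<le> cov e (A \<union> B)" "A \<union> B \<subseteq> (\<Union>x\<in>F. mball x e)"
    using A B by (elim coversE[OF covers_cov[OF e, of "A \<union> B"], rotated]) auto
  let ?FA = "{x \<in> F. mball x e \<inter> A \<noteq> {}}" and ?FB = "{x \<in> F. mball x e \<inter> B \<noteq> {}}"
  have "cov e A \<le> card ?FA"
  proof (rule cov_le[OF coversI[of ?FA]])
    show "A \<subseteq> (\<Union>x\<in>?FA. mball x e)" using F(4) by blast
  qed (use F in auto)
  moreover have "cov e B \<le> card ?FB"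
  proof (rule cov_le[OF coversI[of ?FB]])
    show "B \<subseteq> (\<Union>x\<in>?FB. mball x e)" using F(4) by blast
  qed (use F in auto)
  moreover have "?FA \<inter> ?FB = {}"
  proof (rule ccontr)
    assume "?FA \<inter> ?FB \<noteq> {}"
    then obtain x a b where x: "x \<in> F" "a \<in> A" "a \<in> mball x e" "b \<in> B" "b \<in> mball x e" by blast
    then have "d a b \<le> d a x + d x b" by (intro triangle) auto
    also have "\<dots> < 2 * e" using x by (simp add: commute)
    finally show False using sep x by fastforce
  qed
  then have "card ?FA + card ?FB = card (?FA \<union> ?FB)" using F(1) by (intro card_Un_disjoint[symmetric]) auto
  moreover have "card (?FA \<union> ?FB) \<le> card F" using F(1) by (intro card_mono) auto
  ultimately show "cov e A + cov e B \<le> cov e (A \<union> B)" using F(3) by linarith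
qed

lemma cov_M_pos:
  assumes "0 < e" shows "0 < cov e M"
proof (rule ccontr)
  assume "\<not> 0 < cov e M"
  then have "covers e M 0" using covers_cov[OF assms order_refl] by simp
  then show False by (rule coversE) (use nonempty_M in simp)
qed

definition contents :: "nat \<Rightarrow> ('a set \<Rightarrow> real) set" where
  "contents j = {l. (\<forall>A. 0 \<le> l A \<and> l A \<le> 1) \<and> l M = 1 \<and>
     (\<forall>A B. A \<subseteq> B \<longrightarrow> l A \<le> l B) \<and> (\<forall>A B. l (A \<union> B) \<le> l A + l B) \<and>
     (\<forall>f A. f \<in> isometries \<and> A \<subseteq> M \<longrightarrow> l (f ` A) = l A) \<and>
     (\<forall>A B. A \<subseteq> M \<and> B \<subseteq> M \<and> (\<forall>x\<in>A. \<forall>y\<in>B. 2 / Suc j \<le> d x y) \<longrightarrow> l (A \<union> B) = l A + l B)}"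

lemma cov_contents:
  assumes "i \<le> j"
  shows "(\<lambda>A. cov (1 / Suc j) (A \<inter> M) / cov (1 / Suc j) M) \<in> contents i"
proof -
  let ?e = "1 / real (Suc j)"
  have e: "0 < ?e" by simp
  have pos: "0 < cov ?e M" by (rule cov_M_pos[OF e])
  have mono: "cov ?e (A \<inter> M) \<le> cov ?e (B \<inter> M)" if "A \<subseteq> B" for A B
    using that by (intro cov_mono[OF e]) auto
  have le: "cov ?e (A \<inter> M) \<le> cov ?e M" for A
    by (intro cov_mono[OF e]) auto
  have un: "cov ?e ((A \<union> B) \<inter> M) \<le> cov ?e (A \<inter> M) + cov ?e (B \<inter> M)" for A B
    using cov_Un[OF e, of "A \<inter> M" "B \<inter> M"] by (simp add: Int_Un_distrib2)
  have iso: "cov ?e (f ` A \<inter> M) = cov ?e (A \<inter> M)" if "f \<in> isometries" "A \<subseteq> M" for f A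
  proof -
    have "f ` A \<subseteq> M" using that isometries_in by blast
    then show ?thesis using cov_isometry[OF e that(2,1)] that(2) by (simp add: Int_absorb2)
  qed
  have sep: "cov ?e ((A \<union> B) \<inter> M) = cov ?e (A \<inter> M) + cov ?e (B \<inter> M)"
    if "A \<subseteq> M" "B \<subseteq> M" "\<forall>x\<in>A. \<forall>y\<in>B. 2 / real (Suc i) \<le> d x y" for A B
  proof -
    have "2 * ?e \<le> 2 / real (Suc i)" using assms by (simp add: frac_le)
    then have "2 * ?e \<le> d x y" if "x \<in> A" "y \<in> B" for x y
      using that \<open>\<forall>x\<in>A. \<forall>y\<in>B. _\<close> order_trans by blast
    then show ?thesis
      using cov_separated[OF e that(1,2)] that(1,2) by (simp add: Int_absorb2)
  qed
  show ?thesis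
    unfolding contents_def mem_Collect_eq
  proof (intro conjI allI impI; (elim conjE)?)
    show "real (cov ?e (A \<inter> M)) / real (cov ?e M) \<le> 1" for A
      using pos le[of A] by (simp add: divide_le_eq)
    show "real (cov ?e (A \<inter> M)) / real (cov ?e M) \<le> real (cov ?e (B \<inter> M)) / real (cov ?e M)"
      if "A \<subseteq> B" for A B
      using mono[OF that] by (intro divide_right_mono) auto
    show "real (cov ?e ((A \<union> B) \<inter> M)) / real (cov ?e M)
      \<le> real (cov ?e (A \<inter> M)) / real (cov ?e M) + real (cov ?e (B \<inter> M)) / real (cov ?e M)" for A B
      unfolding add_divide_distrib[symmetric] using un[of A B] by (intro divide_right_mono) linarith+
  qed (use pos iso sep in \<open>simp_all add: add_divide_distrib\<close>)
qed

lemma closed_contents: "closed (contents j)"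
  unfolding contents_def
  by (intro closed_Collect_conj closed_Collect_all closed_Collect_imp closed_Collect_le closed_Collect_eq
      open_Collect_const continuous_intros continuous_on_product_coordinates)

text \<open>The normalised covering numbers lie in a product of unit intervals, which is compact.\<close>

lemma ex_content: "\<exists>l. \<forall>j. l \<in> contents j"
proof -
  let ?S = "PiE UNIV (\<lambda>_::'a set. {0..1::real})"
  have "compactin (product_topology (\<lambda>_. euclidean) UNIV) ?S"
    by (simp add: compactin_PiE)
  then have S: "compact ?S"
    by (simp add: euclidean_product_topology)
  have "?S \<inter> (\<Inter>j\<in>UNIV. contents j) \<noteq> {}"
  proof (rule compact_imp_fip_image[OF S closed_contents])
    fix I :: "nat set" assume "finite I"
    then obtain j where j: "\<And>i. i \<in> I \<Longrightarrow> i \<le> j" by (meson finite_nat_set_iff_bounded_le)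
    let ?l = "\<lambda>A. cov (1 / Suc j) (A \<inter> M) / cov (1 / Suc j) M"
    have "?l \<in> ?S" using cov_contents[of j j] by (auto simp: contents_def)
    moreover have "?l \<in> (\<Inter>i\<in>I. contents i)" using cov_contents j by blast
    ultimately show "?S \<inter> (\<Inter>i\<in>I. contents i) \<noteq> {}" by blast
  qed
  then show ?thesis by blast
qed

lemma disjoint_closed_separated:
  assumes C: "closedin mtopology C" and D: "closedin mtopology D" and CD: "C \<inter> D = {}"
  shows "\<exists>j. \<forall>x\<in>C. \<forall>y\<in>D. 2 / Suc j \<le> d x y"
proof -
  have "\<exists>r>0. mball x (2 * r) \<inter> C = {} \<or> mball x (2 * r) \<inter> D = {}" if x: "x \<in> M" for x
  proof -
    have "x \<in> M - C \<or> x \<in> M - D" using x CD by blast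
    moreover have "openin mtopology (M - C)" "openin mtopology (M - D)"
      using C D by (auto simp: closedin_def)
    ultimately obtain r where "r > 0" "mball x r \<subseteq> M - C \<or> mball x r \<subseteq> M - D"
      by (auto simp: openin_mtopology)
    then show ?thesis by (intro exI[of _ "r / 2"]) auto
  qed
  then obtain r where r: "\<And>x. x \<in> M \<Longrightarrow> r x > 0"
    "\<And>x. x \<in> M \<Longrightarrow> mball x (2 * r x) \<inter> C = {} \<or> mball x (2 * r x) \<inter> D = {}" by metis
  have "compactin mtopology M" using compact_M by (simp add: compact_space_def)
  moreover have "M \<subseteq> (\<Union>x\<in>M. mball x (r x))" using r(1) by auto
  ultimately obtain \<F> where \<F>: "finite \<F>" "\<F> \<subseteq> (\<lambda>x. mball x (r x)) ` M" "M \<subseteq> \<Union>\<F>"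
    using compactinD[of mtopology M "(\<lambda>x. mball x (r x)) ` M"] by auto
  then obtain F where F: "F \<subseteq> M" "finite F" "M \<subseteq> (\<Union>x\<in>F. mball x (r x))"
    using finite_subset_image[OF \<F>(1,2)] by metis
  have "F \<noteq> {}" using F(3) nonempty_M by auto
  define \<delta> where "\<delta> = Min (r ` F)"
  have \<delta>: "0 < \<delta>" unfolding \<delta>_def using F r(1) \<open>F \<noteq> {}\<close> by (subst Min_gr_iff) auto
  obtain j where j: "1 / real (Suc j) < \<delta> / 2" using nat_approx_posE[of "\<delta> / 2"] \<delta> by auto
  have "2 / real (Suc j) \<le> d x y" if xy: "x \<in> C" "y \<in> D" for x y
  proof (rule ccontr)
    assume "\<not> 2 / real (Suc j) \<le> d x y"
    moreover have "2 / real (Suc j) = 2 * (1 / real (Suc j))" by simp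
    ultimately have dxy: "d x y < \<delta>" using j by linarith
    have M: "x \<in> M" "y \<in> M" using xy C D by (auto dest!: closedin_subset)
    then obtain z where z: "z \<in> F" "d z x < r z" using F(3) by auto
    then have zM: "z \<in> M" using F by blast
    have "\<delta> \<le> r z" unfolding \<delta>_def using F(2) z by (intro Min_le) auto
    then have "d z y < 2 * r z" using triangle[OF zM M] z dxy by linarith
    moreover have "d z x < 2 * r z" using z r(1)[OF zM] by linarith
    ultimately show False using r(2)[OF zM] xy M zM by auto
  qed
  then show ?thesis by blast
qed

theorem isometry_invariant_measure:
  "\<exists>\<mu>. prob_space \<mu> \<and> space \<mu> = M \<and> sets \<mu> = sigma_sets M {U. openin mtopology U} \<and>
     (\<forall>f\<in>isometries. distr \<mu> \<mu> f = \<mu>)"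
proof -
  obtain l where l: "\<And>j. l \<in> contents j" using ex_content by blast
  have nonneg: "0 \<le> l A" for A using l[of 0] by (auto simp: contents_def)
  have sep: "l (C \<union> D) = l C + l D" if "closedin mtopology C" "closedin mtopology D" "C \<inter> D = {}" for C D
  proof -
    from disjoint_closed_separated[OF that]
    obtain j where "\<forall>x\<in>C. \<forall>y\<in>D. 2 / real (Suc j) \<le> d x y" ..
    moreover have "C \<subseteq> M" "D \<subseteq> M" using closedin_subset[OF that(1)] closedin_subset[OF that(2)] by simp_all
    ultimately show ?thesis using l[of j] unfolding contents_def by blast
  qed
  have l0: "l {} = 0" using sep[of "{}" "{}"] by simp
  interpret topological_content mtopology "\<lambda>C. ennreal (l C)"
  proof
    show "compact_space mtopology" by (rule compact_M)
    show "normal_space mtopology" by (rule metrizable_imp_normal_space[OF metrizable_space_mtopology])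
    show "ennreal (l C) \<le> ennreal (l D)" if "C \<subseteq> D" for C D
      using l[of 0] that unfolding contents_def by (intro ennreal_leI) blast
    show "ennreal (l (C \<union> D)) \<le> ennreal (l C) + ennreal (l D)" for C D
      using l[of 0] unfolding ennreal_plus[OF nonneg nonneg, symmetric] contents_def by (intro ennreal_leI) blast
    show "ennreal (l (C \<union> D)) = ennreal (l C) + ennreal (l D)"
      if "closedin mtopology C" "closedin mtopology D" "C \<inter> D = {}" for C D
      unfolding ennreal_plus[OF nonneg nonneg, symmetric] by (simp only: sep[OF that])
    show "ennreal (l {}) = 0" by (simp add: l0)
  qed
  have lM: "l M = 1" using l[of 0] by (auto simp: contents_def)
  have "prob_space content_measure"
    by (rule prob_spaceI) (use emeasure_content_measure_space in \<open>simp add: space_content_measure lM\<close>)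
  moreover have "distr content_measure content_measure f = content_measure" if f: "f \<in> isometries" for f
  proof (rule distr_content_measure)
    let ?g = "inv_into M f"
    have g: "?g \<in> isometries" by (rule inv_isometries[OF f])
    have "f ` M = M" using f by (auto simp: isometries_def)
    then show "homeomorphic_maps mtopology mtopology ?g f"
      unfolding homeomorphic_maps_def
      using continuous_isometries[OF f] continuous_isometries[OF g] isometries_inj[OF f]
      by (auto simp: f_inv_into_f)
    show "ennreal (l (?g ` C)) = ennreal (l C)" if "closedin mtopology C" for C
      using l[of 0] g closedin_subset[OF that] unfolding contents_def by simp
  qed (simp add: lM)
  ultimately show ?thesis
    by (intro exI[of _ content_measure]) (simp add: space_content_measure sets_content_measure)
qed

end

lemma continuous_map_group_mult:
  assumes G: "topological_group G \<tau>" and f: "continuous_map Z \<tau> f" and g: "continuous_map Z \<tau> g"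
  shows "continuous_map Z \<tau> (\<lambda>z. f z \<otimes>\<^bsub>G\<^esub> g z)"
proof -
  have "continuous_map Z (prod_topology \<tau> \<tau>) (\<lambda>z. (f z, g z))"
    using f g by (simp add: continuous_map_pairedI)
  from continuous_map_compose[OF this, of \<tau> "\<lambda>(g, h). g \<otimes>\<^bsub>G\<^esub> h"] show ?thesis
    using G by (simp add: topological_group_def o_def)
qed

definition haar_measure :: "('a, 'm) monoid_scheme \<Rightarrow> 'a topology \<Rightarrow> 'a measure \<Rightarrow> bool" where
  "haar_measure G \<tau> \<mu> \<longleftrightarrow> prob_space \<mu> \<and> space \<mu> = carrier G \<and>
     sets \<mu> = sigma_sets (carrier G) {U. openin \<tau> U} \<and>
     (\<forall>a\<in>carrier G. distr \<mu> \<mu> (\<lambda>x. a \<otimes>\<^bsub>G\<^esub> x) = \<mu>) \<and>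
     (\<forall>a\<in>carrier G. distr \<mu> \<mu> (\<lambda>x. x \<otimes>\<^bsub>G\<^esub> a) = \<mu>) \<and> distr \<mu> \<mu> (\<lambda>x. inv\<^bsub>G\<^esub> x) = \<mu>"

locale compact_metric_group = group G + Metric_space "carrier G" d
  for G (structure) and d :: "'a \<Rightarrow> 'a \<Rightarrow> real" +
  assumes topological: "topological_group G mtopology" and compact_G: "compact_space mtopology"
begin

definition bi_dist :: "'a \<Rightarrow> 'a \<Rightarrow> real" where
  "bi_dist x y = (if x \<in> carrier G \<and> y \<in> carrier G
    then SUP p\<in>carrier G \<times> carrier G. d (fst p \<otimes> x \<otimes> snd p) (fst p \<otimes> y \<otimes> snd p) else 0)"

lemma bi_dist_upper:
  assumes "x \<in> carrier G" "y \<in> carrier G" "a \<in> carrier G" "b \<in> carrier G"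
  shows "d (a \<otimes> x \<otimes> b) (a \<otimes> y \<otimes> b) \<le> bi_dist x y"
proof -
  have "compactin mtopology (carrier G)" using compact_G by (simp add: compact_space_def)
  then have "mbounded (carrier G)" by (rule compactin_imp_mbounded)
  then obtain B where B: "\<And>u v. u \<in> carrier G \<Longrightarrow> v \<in> carrier G \<Longrightarrow> d u v \<le> B"
    unfolding mbounded_alt by blast
  have "bdd_above ((\<lambda>p. d (fst p \<otimes> x \<otimes> snd p) (fst p \<otimes> y \<otimes> snd p)) ` (carrier G \<times> carrier G))"
    by (rule bdd_aboveI2[of _ _ B]) (use assms in \<open>auto intro!: B\<close>)
  then have "d (fst (a, b) \<otimes> x \<otimes> snd (a, b)) (fst (a, b) \<otimes> y \<otimes> snd (a, b))
     \<le> (SUP p\<in>carrier G \<times> carrier G. d (fst p \<otimes> x \<otimes> snd p) (fst p \<otimes> y \<otimes> snd p))"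
    by (rule cSUP_upper[rotated]) (use assms in simp)
  then show ?thesis using assms by (simp add: bi_dist_def)
qed

lemma bi_dist_least:
  assumes "x \<in> carrier G" "y \<in> carrier G"
    and "\<And>a b. a \<in> carrier G \<Longrightarrow> b \<in> carrier G \<Longrightarrow> d (a \<otimes> x \<otimes> b) (a \<otimes> y \<otimes> b) \<le> c"
  shows "bi_dist x y \<le> c"
proof -
  have "(SUP p\<in>carrier G \<times> carrier G. d (fst p \<otimes> x \<otimes> snd p) (fst p \<otimes> y \<otimes> snd p)) \<le> c"
    by (rule cSUP_least) (use assms(3) in auto)
  then show ?thesis using assms by (simp add: bi_dist_def)
qed

lemma dist_le_bi_dist: "x \<in> carrier G \<Longrightarrow> y \<in> carrier G \<Longrightarrow> d x y \<le> bi_dist x y"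
  using bi_dist_upper[of x y \<one> \<one>] by simp

lemma Metric_space_bi_dist: "Metric_space (carrier G) bi_dist"
proof
  show "0 \<le> bi_dist x y" for x y
  proof (cases "x \<in> carrier G \<and> y \<in> carrier G")
    case True
    then show ?thesis using dist_le_bi_dist[of x y] nonneg[of x y] by linarith
  qed (auto simp: bi_dist_def)
  show "bi_dist x y = bi_dist y x" for x y unfolding bi_dist_def by (simp add: commute conj_commute)
  show "bi_dist x y = 0 \<longleftrightarrow> x = y" if xy: "x \<in> carrier G" "y \<in> carrier G" for x y
  proof
    assume "bi_dist x y = 0"
    then have "d x y = 0" using dist_le_bi_dist[OF xy] nonneg[of x y] by linarith
    then show "x = y" using xy by simp
  next
    assume "x = y"
    have "bi_dist x x \<le> 0" by (rule bi_dist_least) (use xy in simp_all)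
    moreover have "0 \<le> bi_dist x x" using dist_le_bi_dist[of x x] xy by simp
    ultimately show "bi_dist x y = 0" using \<open>x = y\<close> by simp
  qed
  show "bi_dist x z \<le> bi_dist x y + bi_dist y z" if xyz: "x \<in> carrier G" "y \<in> carrier G" "z \<in> carrier G" for x y z
  proof (rule bi_dist_least)
    fix a b assume ab: "a \<in> carrier G" "b \<in> carrier G"
    have "d (a \<otimes> x \<otimes> b) (a \<otimes> z \<otimes> b) \<le> d (a \<otimes> x \<otimes> b) (a \<otimes> y \<otimes> b) + d (a \<otimes> y \<otimes> b) (a \<otimes> z \<otimes> b)"
      by (rule triangle) (use ab xyz in simp_all)
    also have "\<dots> \<le> bi_dist x y + bi_dist y z" by (intro add_mono bi_dist_upper ab xyz)
    finally show "d (a \<otimes> x \<otimes> b) (a \<otimes> z \<otimes> b) \<le> bi_dist x y + bi_dist y z" .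
  qed (use xyz in simp_all)
qed

lemma bi_dist_left_le:
  assumes "x \<in> carrier G" "y \<in> carrier G" "c \<in> carrier G"
  shows "bi_dist (c \<otimes> x) (c \<otimes> y) \<le> bi_dist x y"
proof (rule bi_dist_least)
  fix a b assume ab: "a \<in> carrier G" "b \<in> carrier G"
  show "d (a \<otimes> (c \<otimes> x) \<otimes> b) (a \<otimes> (c \<otimes> y) \<otimes> b) \<le> bi_dist x y"
    using bi_dist_upper[of x y "a \<otimes> c" b] ab assms by (simp add: m_assoc)
qed (use assms in simp_all)

lemma bi_dist_left:
  assumes "x \<in> carrier G" "y \<in> carrier G" "c \<in> carrier G"
  shows "bi_dist (c \<otimes> x) (c \<otimes> y) = bi_dist x y"
proof (rule antisym[OF bi_dist_left_le[OF assms]])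
  show "bi_dist x y \<le> bi_dist (c \<otimes> x) (c \<otimes> y)"
    using bi_dist_left_le[of "c \<otimes> x" "c \<otimes> y" "inv c"] assms by (simp add: m_assoc[symmetric])
qed

lemma bi_dist_right_le:
  assumes "x \<in> carrier G" "y \<in> carrier G" "c \<in> carrier G"
  shows "bi_dist (x \<otimes> c) (y \<otimes> c) \<le> bi_dist x y"
proof (rule bi_dist_least)
  fix a b assume ab: "a \<in> carrier G" "b \<in> carrier G"
  show "d (a \<otimes> (x \<otimes> c) \<otimes> b) (a \<otimes> (y \<otimes> c) \<otimes> b) \<le> bi_dist x y"
    using bi_dist_upper[of x y a "c \<otimes> b"] ab assms by (simp add: m_assoc)
qed (use assms in simp_all)

lemma bi_dist_right:
  assumes "x \<in> carrier G" "y \<in> carrier G" "c \<in> carrier G"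
  shows "bi_dist (x \<otimes> c) (y \<otimes> c) = bi_dist x y"
proof (rule antisym[OF bi_dist_right_le[OF assms]])
  show "bi_dist x y \<le> bi_dist (x \<otimes> c) (y \<otimes> c)"
    using bi_dist_right_le[of "x \<otimes> c" "y \<otimes> c" "inv c"] assms by (simp add: m_assoc)
qed

lemma bi_dist_inv:
  assumes x: "x \<in> carrier G" and y: "y \<in> carrier G"
  shows "bi_dist (inv x) (inv y) = bi_dist x y"
proof -
  \<comment> \<open>Multiply by \<open>x\<close> from the left and by \<open>y\<close> from the right.\<close>
  have "bi_dist (inv x) (inv y) = bi_dist (x \<otimes> inv x \<otimes> y) (x \<otimes> inv y \<otimes> y)"
    using x y by (simp only: bi_dist_left bi_dist_right m_closed inv_closed)
  also have "\<dots> = bi_dist y x" using x y by (simp add: m_assoc)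
  also have "\<dots> = bi_dist x y" using Metric_space.commute[OF Metric_space_bi_dist] .
  finally show ?thesis .
qed

lemma mtopology_bi_dist: "Metric_space.mtopology (carrier G) bi_dist = mtopology"
proof -
  interpret DM: Metric_space "carrier G" bi_dist by (rule Metric_space_bi_dist)
  have "openin DM.mtopology U" if U: "openin mtopology U" for U
    unfolding DM.openin_mtopology
  proof (intro conjI allI impI)
    show sub: "U \<subseteq> carrier G" using openin_subset[OF U] by simp
    fix x assume x: "x \<in> U"
    then obtain r where r: "r > 0" "mball x r \<subseteq> U" using U by (auto simp: openin_mtopology)
    have "DM.mball x r \<subseteq> mball x r"
    proof
      fix y assume "y \<in> DM.mball x r"
      then show "y \<in> mball x r" using dist_le_bi_dist[of x y] by simp
    qed
    then show "\<exists>r>0. DM.mball x r \<subseteq> U" using r by blast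
  qed
  moreover have "openin mtopology U" if U: "openin DM.mtopology U" for U
    unfolding openin_mtopology
  proof (intro conjI allI impI)
    show sub: "U \<subseteq> carrier G" using openin_subset[OF U] by simp
    fix x assume x: "x \<in> U"
    then obtain r where r: "r > 0" "DM.mball x r \<subseteq> U" using U by (auto simp: DM.openin_mtopology)
    have xG: "x \<in> carrier G" using x sub by blast
    let ?P = "prod_topology mtopology mtopology"
    let ?Z = "prod_topology ?P mtopology"
    have a: "continuous_map ?Z mtopology (\<lambda>z. fst (fst z))" and b: "continuous_map ?Z mtopology (\<lambda>z. snd (fst z))"
      by (intro continuous_map_compose[OF continuous_map_fst, unfolded o_def]
          continuous_map_fst continuous_map_snd)+
    have y: "continuous_map ?Z mtopology snd" by (rule continuous_map_snd)
    have c: "continuous_map ?Z mtopology (\<lambda>z. x)" using xG by simp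
    have f1: "continuous_map ?Z mtopology (\<lambda>z. fst (fst z) \<otimes> x \<otimes> snd (fst z))"
      by (intro continuous_map_group_mult[OF topological] a b c)
    have f2: "continuous_map ?Z mtopology (\<lambda>z. fst (fst z) \<otimes> snd z \<otimes> snd (fst z))"
      by (intro continuous_map_group_mult[OF topological] a b y)
    have cont: "continuous_map ?Z euclideanreal
      (\<lambda>z. d (fst (fst z) \<otimes> x \<otimes> snd (fst z)) (fst (fst z) \<otimes> snd z \<otimes> snd (fst z)))"
      using continuous_map_mdist[of ?Z "metric (carrier G, d)"
          "\<lambda>z. fst (fst z) \<otimes> x \<otimes> snd (fst z)" "\<lambda>z. fst (fst z) \<otimes> snd z \<otimes> snd (fst z)"]
        f1 f2 by (simp add: mtopology_of_def)
    let ?W = "{z \<in> topspace ?Z. d (fst (fst z) \<otimes> x \<otimes> snd (fst z)) (fst (fst z) \<otimes> snd z \<otimes> snd (fst z)) \<in> {..<r/2}}"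
    have W: "openin ?Z ?W"
      by (rule openin_continuous_map_preimage[OF cont]) simp
    have C: "compactin ?P (topspace ?P)"
      using compact_G by (simp only: compact_space_def[symmetric] compact_space_prod_topology simp_thms)
    have "\<exists>A V. openin ?P A \<and> openin mtopology V \<and> topspace ?P \<subseteq> A \<and> x \<in> V \<and> A \<times> V \<subseteq> ?W"
      by (rule tube_lemma_left[OF W C]) (use xG r in auto)
    then obtain A V where AV: "openin mtopology V" "topspace ?P \<subseteq> A" "x \<in> V" "A \<times> V \<subseteq> ?W" by blast
    then obtain s where s: "s > 0" "mball x s \<subseteq> V" by (auto simp: openin_mtopology)
    have "mball x s \<subseteq> U"
    proof
      fix y assume y: "y \<in> mball x s"
      then have yG: "y \<in> carrier G" and yV: "y \<in> V" using s by auto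
      have "bi_dist x y \<le> r / 2"
      proof (rule bi_dist_least[OF xG yG])
        fix a b assume "a \<in> carrier G" "b \<in> carrier G"
        then have "((a, b), y) \<in> A \<times> V" using AV(2) yV by auto
        then have "((a, b), y) \<in> ?W" using AV(4) by blast
        then show "d (a \<otimes> x \<otimes> b) (a \<otimes> y \<otimes> b) \<le> r / 2" by simp
      qed
      then have "y \<in> DM.mball x r" using xG yG r(1) by simp
      then show "y \<in> U" using r(2) by blast
    qed
    then show "\<exists>r>0. mball x r \<subseteq> U" using s(1) by blast
  qed
  ultimately show ?thesis by (auto simp: topology_eq)
qed

lemma ex_haar_measure: "\<exists>\<mu>. haar_measure G mtopology \<mu>"
proof -
  interpret DM: Metric_space "carrier G" bi_dist by (rule Metric_space_bi_dist)
  interpret DC: compact_metric "carrier G" bi_dist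
    by unfold_locales (use compact_G in \<open>auto simp: mtopology_bi_dist\<close>)
  obtain \<mu> where \<mu>: "prob_space \<mu>" "space \<mu> = carrier G"
    "sets \<mu> = sigma_sets (carrier G) {U. openin mtopology U}"
    "\<And>f. f \<in> DC.isometries \<Longrightarrow> distr \<mu> \<mu> f = \<mu>"
    using DC.isometry_invariant_measure unfolding mtopology_bi_dist by blast
  have "(\<lambda>x. a \<otimes> x) \<in> DC.isometries" if a: "a \<in> carrier G" for a
  proof -
    have "x \<in> (\<lambda>x. a \<otimes> x) ` carrier G" if "x \<in> carrier G" for x
      using that a by (intro image_eqI[of _ _ "inv a \<otimes> x"]) (simp_all add: m_assoc[symmetric])
    then show ?thesis using a by (auto simp: DC.isometries_def bi_dist_left)
  qed
  moreover have "(\<lambda>x. x \<otimes> a) \<in> DC.isometries" if a: "a \<in> carrier G" for a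
  proof -
    have "x \<in> (\<lambda>x. x \<otimes> a) ` carrier G" if "x \<in> carrier G" for x
      using that a by (intro image_eqI[of _ _ "x \<otimes> inv a"]) (simp_all add: m_assoc)
    then show ?thesis using a by (auto simp: DC.isometries_def bi_dist_right)
  qed
  moreover have "(\<lambda>x. inv x) \<in> DC.isometries"
  proof -
    have "x \<in> (\<lambda>x. inv x) ` carrier G" if "x \<in> carrier G" for x
      using that by (intro image_eqI[of _ _ "inv x"]) simp_all
    then show ?thesis by (auto simp: DC.isometries_def bi_dist_inv)
  qed
  ultimately have "haar_measure G mtopology \<mu>"
    unfolding haar_measure_def using \<mu> by blast
  then show ?thesis ..
qed

end

theorem haar_measure_exists:
  assumes G: "topological_group G \<tau>" and comp: "compact_space \<tau>" and metr: "metrizable_space \<tau>"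
  shows "\<exists>\<mu>. haar_measure G \<tau> \<mu>"
proof -
  obtain M d where M: "Metric_space M d" "\<tau> = Metric_space.mtopology M d"
    using metr unfolding metrizable_space_def by blast
  have "M = carrier G"
    using G Metric_space.topspace_mtopology[OF M(1)] by (simp add: topological_group_def M(2))
  then have M': "Metric_space (carrier G) d" "\<tau> = Metric_space.mtopology (carrier G) d" using M by simp_all
  interpret compact_metric_group G d
    using M' G comp by (intro compact_metric_group.intro compact_metric_group_axioms.intro)
      (simp_all add: topological_group_def)
  show ?thesis using ex_haar_measure unfolding M'(2) .
qed

lemma compact_metrizable_chain_closedin:
  assumes "compact_space Y" "Y = subtopology Z S" "S \<subseteq> topspace Z" "metrizable_space Z"
  shows "closedin Z S"
proof -
  have "compactin Z S" using assms by (simp add: compactin_subspace)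
  then show ?thesis
    by (rule compactin_imp_closedin[OF metrizable_imp_Hausdorff_space[OF assms(4)]])
qed

context inductively_compact_group
begin

lemma ascending_le: "m \<le> n \<Longrightarrow> topspace (K m) \<subseteq> topspace (K n)"
  by (rule lift_Suc_mono_le[of "\<lambda>n. topspace (K n)"]) (rule ascending_K)

lemma subtopology_le:
  assumes "m \<le> n" shows "subtopology (K n) (topspace (K m)) = K m"
  using assms
proof (induction rule: dec_induct)
  case (step n)
  have "subtopology (K (Suc n)) (topspace (K m)) = subtopology (K (Suc n)) (topspace (K n) \<inter> topspace (K m))"
    using ascending_le[OF step(1)] by (simp add: Int_absorb1)
  also have "\<dots> = subtopology (subtopology (K (Suc n)) (topspace (K n))) (topspace (K m))"
    by (simp only: subtopology_subtopology)
  finally show ?case using step by (simp add: subspace_K)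
qed simp

lemma K_carrier: "g \<in> topspace (K n) \<Longrightarrow> g \<in> carrier G"
  unfolding carrier_eq by blast

lemma K_inv: "g \<in> topspace (K n) \<Longrightarrow> inv g \<in> topspace (K n)"
  using subgroup.m_inv_closed[OF subgroup_K] .

definition haar :: "nat \<Rightarrow> 'a measure" where
  "haar n = (SOME \<mu>. haar_measure (G\<lparr>carrier := topspace (K n)\<rparr>) (K n) \<mu>)"

lemma haar_measure_haar: "haar_measure (G\<lparr>carrier := topspace (K n)\<rparr>) (K n) (haar n)"
  unfolding haar_def by (rule someI_ex[OF haar_measure_exists[OF topological_group_K compact_K metrizable_K]])

lemma prob_haar: "prob_space (haar n)"
  and space_haar: "space (haar n) = topspace (K n)"
  and sets_haar: "sets (haar n) = sigma_sets (topspace (K n)) {U. openin (K n) U}"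
  and haar_left: "a \<in> topspace (K n) \<Longrightarrow> distr (haar n) (haar n) (\<lambda>x. a \<otimes> x) = haar n"
  and haar_right: "a \<in> topspace (K n) \<Longrightarrow> distr (haar n) (haar n) (\<lambda>x. x \<otimes> a) = haar n"
  using haar_measure_haar[of n] by (simp_all add: haar_measure_def)

lemma haar_inv: "distr (haar n) (haar n) (\<lambda>x. inv x) = haar n"
proof -
  have "distr (haar n) (haar n) (\<lambda>x. inv x) = distr (haar n) (haar n) (\<lambda>x. inv\<^bsub>G\<lparr>carrier := topspace (K n)\<rparr>\<^esub> x)"
    by (rule distr_cong) (simp_all add: space_haar m_inv_consistent[OF subgroup_K])
  then show ?thesis using haar_measure_haar[of n] by (simp add: haar_measure_def)
qed

lemma continuous_measurable_haar:
  assumes f: "continuous_map (K n) (K n) f"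
  shows "f \<in> haar n \<rightarrow>\<^sub>M haar n"
proof (rule measurable_sigma_sets[OF sets_haar])
  show "{U. openin (K n) U} \<subseteq> Pow (topspace (K n))" by (auto dest: openin_subset)
  show "f \<in> space (haar n) \<rightarrow> topspace (K n)" using f by (auto simp: space_haar continuous_map_def)
  fix U assume "U \<in> {U. openin (K n) U}"
  then have "openin (K n) {x \<in> topspace (K n). f x \<in> U}"
    using openin_continuous_map_preimage[OF f] by simp
  moreover have "f -` U \<inter> space (haar n) = {x \<in> topspace (K n). f x \<in> U}"
    by (auto simp: space_haar)
  ultimately show "f -` U \<inter> space (haar n) \<in> sets (haar n)"
    by (simp add: sets_haar sigma_sets.Basic)
qed

lemma continuous_mult_K:
  assumes f: "continuous_map Z (K n) f" and g: "continuous_map Z (K n) g"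
  shows "continuous_map Z (K n) (\<lambda>z. f z \<otimes> g z)"
  using continuous_map_group_mult[OF topological_group_K f g] by simp

lemma measurable_left_haar: "a \<in> topspace (K n) \<Longrightarrow> (\<lambda>x. a \<otimes> x) \<in> haar n \<rightarrow>\<^sub>M haar n"
  and measurable_right_haar: "a \<in> topspace (K n) \<Longrightarrow> (\<lambda>x. x \<otimes> a) \<in> haar n \<rightarrow>\<^sub>M haar n"
  by (intro continuous_measurable_haar continuous_mult_K; simp)+

lemma measurable_inv_haar: "(\<lambda>x. inv x) \<in> haar n \<rightarrow>\<^sub>M haar n"
proof (rule continuous_measurable_haar)
  have "continuous_map (K n) (K n) (\<lambda>x. inv\<^bsub>G\<lparr>carrier := topspace (K n)\<rparr>\<^esub> x)"
    using topological_group_K by (simp add: topological_group_def)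
  then show "continuous_map (K n) (K n) (\<lambda>x. inv x)"
    by (rule continuous_map_eq) (simp add: m_inv_consistent[OF subgroup_K])
qed

lemma nn_integral_haar_left:
  assumes "a \<in> topspace (K n)" and f: "f \<in> borel_measurable (haar n)"
  shows "(\<integral>\<^sup>+x. f (a \<otimes> x) \<partial>haar n) = (\<integral>\<^sup>+x. f x \<partial>haar n)"
  using nn_integral_distr[OF measurable_left_haar[OF assms(1)], of f] f
  by (simp add: haar_left[OF assms(1)])

lemma nn_integral_haar_right:
  assumes "a \<in> topspace (K n)" and f: "f \<in> borel_measurable (haar n)"
  shows "(\<integral>\<^sup>+x. f (x \<otimes> a) \<partial>haar n) = (\<integral>\<^sup>+x. f x \<partial>haar n)"
  using nn_integral_distr[OF measurable_right_haar[OF assms(1)], of f] f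
  by (simp add: haar_right[OF assms(1)])

lemma nn_integral_haar_inv:
  assumes f: "f \<in> borel_measurable (haar n)"
  shows "(\<integral>\<^sup>+x. f (inv x) \<partial>haar n) = (\<integral>\<^sup>+x. f x \<partial>haar n)"
  using nn_integral_distr[OF measurable_inv_haar, of f] f by (simp add: haar_inv)

lemma closedin_K: "m \<le> n \<Longrightarrow> closedin (K n) (topspace (K m))"
  by (rule compact_metrizable_chain_closedin[OF compact_K[of m]])
    (simp_all add: subtopology_le ascending_le metrizable_K)

lemma sets_haar_Int:
  assumes "A \<in> sigma_sets (topspace (K m)) {U. openin (K m) U}"
  shows "A \<inter> topspace (K n) \<in> sets (haar n)"
proof -
  have open_sets: "openin (K n) U \<Longrightarrow> U \<in> sets (haar n)" for U
    by (simp add: sets_haar sigma_sets.Basic)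
  have base: "U \<inter> topspace (K n) \<in> sets (haar n)" if U: "openin (K m) U" for U
  proof (cases "m \<le> n")
    case True
    have "topspace (K n) - topspace (K m) \<in> sets (haar n)"
      using closedin_K[OF True] by (intro open_sets) (simp add: closedin_def)
    then have "topspace (K n) - (topspace (K n) - topspace (K m)) \<in> sets (haar n)"
      using sets.compl_sets[of _ "haar n"] by (simp add: space_haar)
    then have Km: "topspace (K m) \<in> sets (haar n)"
      using ascending_le[OF True] by (simp add: double_diff)
    have "openin (subtopology (K n) (topspace (K m))) U" using U by (simp add: subtopology_le[OF True])
    then obtain V where V: "openin (K n) V" "U = V \<inter> topspace (K m)" by (auto simp: openin_subtopology)
    have "U \<in> sets (haar n)" unfolding V(2) by (intro sets.Int open_sets V(1) Km)
    moreover have "U \<inter> topspace (K n) = U"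
      using openin_subset[OF U] ascending_le[OF True] by blast
    ultimately show ?thesis by simp
  next
    case False
    then have "openin (subtopology (K m) (topspace (K n))) (U \<inter> topspace (K n))"
      using U by (auto simp: openin_subtopology)
    then show ?thesis using False by (intro open_sets) (simp add: subtopology_le)
  qed
  show ?thesis
    using assms
  proof (induction rule: sigma_sets.induct)
    case (Compl a)
    have "(topspace (K m) - a) \<inter> topspace (K n) = (topspace (K m) \<inter> topspace (K n)) - (a \<inter> topspace (K n))" by blast
    then show ?case using base[OF openin_topspace] Compl.IH by auto
  next
    case (Union a)
    have "(\<Union>i. a i) \<inter> topspace (K n) = (\<Union>i. a i \<inter> topspace (K n))" by blast
    moreover have "(\<Union>i. a i \<inter> topspace (K n)) \<in> sets (haar n)"
      by (rule sets.countable_UN) (use Union.IH in blast)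
    ultimately show ?case by simp
  qed (use base in auto)
qed

lemma ilb_generator: "(\<Union>n. sigma_sets (topspace (K n)) {U. openin (K n) U}) \<subseteq> Pow (\<Union>n. topspace (K n))"
proof -
  have "sigma_sets (topspace (K n)) {U. openin (K n) U} \<subseteq> Pow (topspace (K n))" for n
    using sigma_sets_into_sp[of "{U. openin (K n) U}" "topspace (K n)"] openin_subset[of "K n"] by blast
  then show ?thesis by fast
qed

lemma space_ilb: "space (inductive_limit_borel K) = carrier G"
  unfolding inductive_limit_borel_def carrier_eq by (rule space_measure_of[OF ilb_generator])

lemma measurable_haar_ilb: "(\<lambda>g. g) \<in> haar n \<rightarrow>\<^sub>M inductive_limit_borel K"
  unfolding inductive_limit_borel_def
proof (rule measurable_measure_of[OF ilb_generator])
  show "(\<lambda>g. g) \<in> space (haar n) \<rightarrow> (\<Union>n. topspace (K n))" by (auto simp: space_haar)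
  fix A assume "A \<in> (\<Union>n. sigma_sets (topspace (K n)) {U. openin (K n) U})"
  then show "(\<lambda>g. g) -` A \<inter> space (haar n) \<in> sets (haar n)"
    using sets_haar_Int by (auto simp: space_haar)
qed

end

section \<open>Kernels of a cocycle\<close>

locale cocycle_action = inductively_compact_group G K
  for G (structure) and K :: "nat \<Rightarrow> 'g topology" +
  fixes X :: "'x measure" and T :: "'g \<Rightarrow> 'x \<Rightarrow> 'x" and \<rho> :: "'g \<Rightarrow> 'x \<Rightarrow> real"
  assumes action: "measurable_action G K X T"
    and cocycle: "positive_cocycle G K X T \<rho>"
    and continuous_cocycle: "fibrewise_continuous K X \<rho>"
begin

lemma group_action_T: "group_action G (space X) T"
  using action by (simp add: measurable_action_def)

lemma T_in: "g \<in> carrier G \<Longrightarrow> x \<in> space X \<Longrightarrow> T g x \<in> space X"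
  using group_action.element_image[OF group_action_T] by blast

lemma T_mult: "g \<in> carrier G \<Longrightarrow> h \<in> carrier G \<Longrightarrow> x \<in> space X \<Longrightarrow> T (g \<otimes> h) x = T g (T h x)"
  using group_action.composition_rule[OF group_action_T] by blast

lemma T_inv_T: "g \<in> carrier G \<Longrightarrow> x \<in> space X \<Longrightarrow> T (inv g) (T g x) = x"
  using group_action.orbit_sym_aux[OF group_action_T] by blast

lemma T_T_inv: "g \<in> carrier G \<Longrightarrow> x \<in> space X \<Longrightarrow> T g (T (inv g) x) = x"
  using T_inv_T[of "inv g" x] by simp

lemma \<rho>_pos: "g \<in> carrier G \<Longrightarrow> x \<in> space X \<Longrightarrow> 0 < \<rho> g x"
  using cocycle by (simp add: positive_cocycle_def)

lemma \<rho>_mult: "g \<in> carrier G \<Longrightarrow> h \<in> carrier G \<Longrightarrow> x \<in> space X \<Longrightarrow> \<rho> (g \<otimes> h) x = \<rho> g (T h x) * \<rho> h x"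
  using cocycle by (simp add: positive_cocycle_def)

lemma measurable_T_haar: "(\<lambda>(x, g). T g x) \<in> X \<Otimes>\<^sub>M haar n \<rightarrow>\<^sub>M X"
proof -
  have "(\<lambda>p. (snd p, fst p)) \<in> X \<Otimes>\<^sub>M haar n \<rightarrow>\<^sub>M inductive_limit_borel K \<Otimes>\<^sub>M X"
    by (intro measurable_Pair measurable_compose[OF measurable_snd measurable_haar_ilb] measurable_fst)
  from measurable_compose[OF this, of "\<lambda>(g, x). T g x" X] show ?thesis
    using action by (simp add: measurable_action_def split_beta')
qed

lemma measurable_\<rho>_haar: "(\<lambda>(x, g). \<rho> g x) \<in> borel_measurable (X \<Otimes>\<^sub>M haar n)"
proof -
  have "(\<lambda>p. (snd p, fst p)) \<in> X \<Otimes>\<^sub>M haar n \<rightarrow>\<^sub>M inductive_limit_borel K \<Otimes>\<^sub>M X"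
    by (intro measurable_Pair measurable_compose[OF measurable_snd measurable_haar_ilb] measurable_fst)
  from measurable_compose[OF this, of "\<lambda>(g, x). \<rho> g x" borel] show ?thesis
    using cocycle by (simp add: positive_cocycle_def split_beta')
qed

lemma measurable_T:
  assumes "g \<in> carrier G" shows "T g \<in> X \<rightarrow>\<^sub>M X"
proof -
  have "(\<lambda>x. case (g, x) of (g, x) \<Rightarrow> T g x) \<in> X \<rightarrow>\<^sub>M X"
    by (rule measurable_compose[OF measurable_Pair1'[of g "inductive_limit_borel K" X]])
      (use assms action in \<open>simp_all add: measurable_action_def space_ilb\<close>)
  then show ?thesis by simp
qed

lemma measurable_\<rho>:
  assumes "g \<in> carrier G" shows "\<rho> g \<in> borel_measurable X"
proof -
  have "(\<lambda>x. case (g, x) of (g, x) \<Rightarrow> \<rho> g x) \<in> borel_measurable X"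
    by (rule measurable_compose[OF measurable_Pair1'[of g "inductive_limit_borel K" X]])
      (use assms cocycle in \<open>simp_all add: positive_cocycle_def space_ilb\<close>)
  then show ?thesis by simp
qed

definition orbit_integral :: "nat \<Rightarrow> 'x \<Rightarrow> ('x \<Rightarrow> ennreal) \<Rightarrow> ennreal" where
  "orbit_integral n x f = (\<integral>\<^sup>+g. ennreal (\<rho> g x) * f (T g x) \<partial>haar n)"

abbreviation mass :: "nat \<Rightarrow> 'x \<Rightarrow> ennreal" where
  "mass n x \<equiv> orbit_integral n x (\<lambda>_. 1)"

definition orbit_kernel :: "nat \<Rightarrow> 'x \<Rightarrow> 'x measure" where
  "orbit_kernel n x = distr (density (haar n) (\<lambda>g. ennreal (\<rho> g x) / mass n x)) X (\<lambda>g. T g x)"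

lemma measurable_integrand:
  assumes [measurable]: "f \<in> borel_measurable X"
  shows "(\<lambda>(x, g). ennreal (\<rho> g x) * f (T g x)) \<in> borel_measurable (X \<Otimes>\<^sub>M haar n)"
proof -
  note [measurable] = measurable_T_haar[of n, unfolded split_beta'] measurable_\<rho>_haar[of n, unfolded split_beta']
  show ?thesis unfolding split_beta' by measurable
qed

lemma measurable_integrand1:
  assumes "f \<in> borel_measurable X" "x \<in> space X"
  shows "(\<lambda>g. ennreal (\<rho> g x) * f (T g x)) \<in> borel_measurable (haar n)"
  using measurable_compose[OF measurable_Pair1'[OF assms(2)] measurable_integrand[OF assms(1)]] by simp

lemma measurable_T1: "x \<in> space X \<Longrightarrow> (\<lambda>g. T g x) \<in> haar n \<rightarrow>\<^sub>M X"
  using measurable_compose[OF measurable_Pair1' measurable_T_haar] by simp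

lemma measurable_\<rho>1: "x \<in> space X \<Longrightarrow> (\<lambda>g. ennreal (\<rho> g x)) \<in> borel_measurable (haar n)"
  using measurable_integrand1[of "\<lambda>_. 1" x] by simp

lemma measurable_orbit_integral:
  assumes "f \<in> borel_measurable X"
  shows "(\<lambda>x. orbit_integral n x f) \<in> borel_measurable X"
  unfolding orbit_integral_def
proof -
  interpret prob_space "haar n" by (rule prob_haar)
  show "(\<lambda>x. \<integral>\<^sup>+g. ennreal (\<rho> g x) * f (T g x) \<partial>haar n) \<in> borel_measurable X"
    by (rule borel_measurable_nn_integral[OF measurable_integrand[OF assms]])
qed

lemma mass_pos:
  assumes x: "x \<in> space X" shows "mass n x \<noteq> 0"
proof
  interpret prob_space "haar n" by (rule prob_haar)
  assume "mass n x = 0"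
  then have "AE g in haar n. ennreal (\<rho> g x) = 0"
    using nn_integral_0_iff_AE[OF measurable_\<rho>1[OF x]] by (simp add: orbit_integral_def)
  then have "AE g in haar n. False"
    using AE_space
  proof eventually_elim
    case (elim g)
    then show ?case using \<rho>_pos[OF K_carrier x, of g n] by (simp add: space_haar ennreal_eq_0_iff)
  qed
  then show False by simp
qed

lemma mass_finite:
  assumes x: "x \<in> space X" shows "mass n x < top_class.top"
proof -
  interpret prob_space "haar n" by (rule prob_haar)
  have "continuous_map (K n) euclideanreal (\<lambda>g. \<rho> g x)"
    using continuous_cocycle x by (simp add: fibrewise_continuous_def continuous_map_inductive_limit_topology)
  then have "compactin euclideanreal ((\<lambda>g. \<rho> g x) ` topspace (K n))"
    by (rule image_compactin[rotated]) (use compact_K in \<open>simp add: compact_space_def\<close>)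
  then have "bounded ((\<lambda>g. \<rho> g x) ` topspace (K n))" by (simp add: compact_imp_bounded)
  then obtain B where B: "\<And>g. g \<in> topspace (K n) \<Longrightarrow> \<rho> g x \<le> B"
    unfolding bounded_iff by (auto simp: abs_le_iff)
  have "mass n x \<le> (\<integral>\<^sup>+g. ennreal B \<partial>haar n)"
    unfolding orbit_integral_def by (rule nn_integral_mono) (simp add: B space_haar ennreal_leI)
  also have "\<dots> = ennreal B" by (simp add: emeasure_space_1)
  also have "\<dots> < top_class.top" by simp
  finally show ?thesis .
qed

lemma orbit_integral_translate:
  assumes k: "k \<in> topspace (K n)" and x: "x \<in> space X" and f: "f \<in> borel_measurable X"
  shows "ennreal (\<rho> k x) * orbit_integral n (T k x) f = orbit_integral n x f"
proof -
  have kG: "k \<in> carrier G" by (rule K_carrier[OF k])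
  have "orbit_integral n x f = (\<integral>\<^sup>+g. ennreal (\<rho> (g \<otimes> k) x) * f (T (g \<otimes> k) x) \<partial>haar n)"
    unfolding orbit_integral_def by (rule nn_integral_haar_right[OF k measurable_integrand1[OF f x], symmetric])
  also have "\<dots> = (\<integral>\<^sup>+g. ennreal (\<rho> k x) * (ennreal (\<rho> g (T k x)) * f (T g (T k x))) \<partial>haar n)"
  proof (rule nn_integral_cong)
    fix g assume "g \<in> space (haar n)"
    then have gG: "g \<in> carrier G" by (simp add: space_haar K_carrier)
    show "ennreal (\<rho> (g \<otimes> k) x) * f (T (g \<otimes> k) x) = ennreal (\<rho> k x) * (ennreal (\<rho> g (T k x)) * f (T g (T k x)))"
      using \<rho>_pos[OF kG x] \<rho>_pos[OF gG T_in[OF kG x]]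
      by (simp add: \<rho>_mult[OF gG kG x] T_mult[OF gG kG x] ennreal_mult mult.assoc mult.left_commute)
  qed
  also have "\<dots> = ennreal (\<rho> k x) * orbit_integral n (T k x) f"
    unfolding orbit_integral_def
    by (rule nn_integral_cmult[OF measurable_integrand1[OF f T_in[OF kG x]]])
  finally show ?thesis by simp
qed

lemma orbit_integral_left:
  assumes k: "k \<in> topspace (K n)" and x: "x \<in> space X" and f: "f \<in> borel_measurable X"
  shows "orbit_integral n x (\<lambda>y. f (T (inv k) y)) = orbit_integral n x (\<lambda>y. ennreal (\<rho> k y) * f y)"
proof -
  have kG: "k \<in> carrier G" by (rule K_carrier[OF k])
  have ikG: "inv k \<in> carrier G" using kG by simp
  have fT: "(\<lambda>y. f (T (inv k) y)) \<in> borel_measurable X"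
    by (rule measurable_compose[OF measurable_T[OF ikG] f])
  have "orbit_integral n x (\<lambda>y. f (T (inv k) y))
      = (\<integral>\<^sup>+g. ennreal (\<rho> (k \<otimes> g) x) * f (T (inv k) (T (k \<otimes> g) x)) \<partial>haar n)"
    unfolding orbit_integral_def by (rule nn_integral_haar_left[OF k measurable_integrand1[OF fT x], symmetric])
  also have "\<dots> = orbit_integral n x (\<lambda>y. ennreal (\<rho> k y) * f y)"
    unfolding orbit_integral_def
  proof (rule nn_integral_cong)
    fix g assume "g \<in> space (haar n)"
    then have gG: "g \<in> carrier G" by (simp add: space_haar K_carrier)
    show "ennreal (\<rho> (k \<otimes> g) x) * f (T (inv k) (T (k \<otimes> g) x)) = ennreal (\<rho> g x) * (ennreal (\<rho> k (T g x)) * f (T g x))"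
      using \<rho>_pos[OF gG x] \<rho>_pos[OF kG T_in[OF gG x]]
      by (simp add: \<rho>_mult[OF kG gG x] T_mult[OF kG gG x] T_inv_T[OF kG T_in[OF gG x]] ennreal_mult
          mult.assoc mult.left_commute)
  qed
  finally show ?thesis .
qed

lemma nn_integral_orbit_kernel:
  assumes f: "f \<in> borel_measurable X" and x: "x \<in> space X"
  shows "(\<integral>\<^sup>+y. f y \<partial>orbit_kernel n x) = orbit_integral n x f / mass n x"
proof -
  let ?d = "density (haar n) (\<lambda>g. ennreal (\<rho> g x) / mass n x)"
  note [measurable] = measurable_\<rho>1[OF x] measurable_compose[OF measurable_T1[OF x] f]
  have "(\<lambda>g. T g x) \<in> ?d \<rightarrow>\<^sub>M X" using measurable_T1[OF x] by simp
  then have "(\<integral>\<^sup>+y. f y \<partial>orbit_kernel n x) = (\<integral>\<^sup>+g. f (T g x) \<partial>?d)"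
    unfolding orbit_kernel_def by (rule nn_integral_distr) (simp add: f)
  also have "\<dots> = (\<integral>\<^sup>+g. ennreal (\<rho> g x) / mass n x * f (T g x) \<partial>haar n)"
    by (rule nn_integral_density) measurable
  also have "\<dots> = (\<integral>\<^sup>+g. ennreal (\<rho> g x) * f (T g x) / mass n x \<partial>haar n)"
    by (simp add: divide_ennreal_def mult.assoc mult.left_commute mult.commute)
  also have "\<dots> = orbit_integral n x f / mass n x"
    unfolding orbit_integral_def[of n x f]
    by (rule nn_integral_divide[OF measurable_integrand1[OF f x]])
  finally show ?thesis .
qed

lemma sets_orbit_kernel: "sets (orbit_kernel n x) = sets X"
  by (simp add: orbit_kernel_def)

lemma emeasure_orbit_kernel:
  assumes "A \<in> sets X" "x \<in> space X"
  shows "emeasure (orbit_kernel n x) A = orbit_integral n x (indicator A) / mass n x"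
  using nn_integral_orbit_kernel[of "indicator A" x n] assms by (simp add: sets_orbit_kernel)

lemma prob_orbit_kernel:
  assumes x: "x \<in> space X" shows "prob_space (orbit_kernel n x)"
proof (rule prob_spaceI)
  have sp: "space (orbit_kernel n x) = space X" by (rule sets_eq_imp_space_eq[OF sets_orbit_kernel])
  have "orbit_integral n x (indicator (space X)) = mass n x"
    unfolding orbit_integral_def
    by (rule nn_integral_cong) (simp add: space_haar K_carrier T_in x)
  then show "emeasure (orbit_kernel n x) (space (orbit_kernel n x)) = 1"
    using mass_pos[OF x] mass_finite[OF x] by (simp add: sp emeasure_orbit_kernel[OF sets.top x])
qed

lemma measurable_orbit_kernel: "orbit_kernel n \<in> X \<rightarrow>\<^sub>M prob_algebra X"
proof (rule measurable_prob_algebraI[OF prob_orbit_kernel measurable_subprob_algebra])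
  fix A assume A: "A \<in> sets X"
  have [measurable]: "(\<lambda>x. orbit_integral n x (indicator A)) \<in> borel_measurable X" "mass n \<in> borel_measurable X"
    using measurable_orbit_integral A by simp_all
  have "(\<lambda>x. orbit_integral n x (indicator A) / mass n x) \<in> borel_measurable X" by measurable
  then show "(\<lambda>x. emeasure (orbit_kernel n x) A) \<in> borel_measurable X"
    using measurable_cong[of X "\<lambda>x. emeasure (orbit_kernel n x) A" "\<lambda>x. orbit_integral n x (indicator A) / mass n x" borel]
    by (simp add: emeasure_orbit_kernel[OF A])
qed (simp_all add: sets_orbit_kernel prob_space_imp_subprob_space prob_orbit_kernel)

lemma ennreal_mult_divide_cancel:
  assumes "0 < c" shows "(ennreal c * a) / (ennreal c * b) = a / b"
proof (cases "b = 0 \<or> b = top_class.top")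
  case True
  then show ?thesis using assms
    by (cases "a = 0") (auto simp: ennreal_mult_top ennreal_mult_eq_top_iff divide_ennreal_def ennreal_top_mult)
next
  case False
  then have "inverse (ennreal c * b) = inverse (ennreal c) * inverse b"
    by (intro ennreal_inverse_mult) (auto simp: less_top)
  moreover have "ennreal c * inverse (ennreal c) = 1"
    using assms by (simp flip: divide_ennreal_def)
  ultimately show ?thesis
    by (simp add: divide_ennreal_def) (metis mult.assoc mult.commute mult.right_neutral)
qed

lemma orbit_kernel_invariant:
  assumes k: "k \<in> topspace (K n)" and x: "x \<in> space X"
  shows "orbit_kernel n (T k x) = orbit_kernel n x"
proof (rule measure_eqI)
  have kG: "k \<in> carrier G" by (rule K_carrier[OF k])
  fix A assume "A \<in> sets (orbit_kernel n (T k x))"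
  then have A: "A \<in> sets X" by (simp add: sets_orbit_kernel)
  have "orbit_integral n x (indicator A) / mass n x =
    (ennreal (\<rho> k x) * orbit_integral n (T k x) (indicator A)) / (ennreal (\<rho> k x) * mass n (T k x))"
    using A by (simp only: orbit_integral_translate[OF k x borel_measurable_indicator]
        orbit_integral_translate[OF k x borel_measurable_const])
  also have "\<dots> = orbit_integral n (T k x) (indicator A) / mass n (T k x)"
    by (rule ennreal_mult_divide_cancel[OF \<rho>_pos[OF kG x]])
  finally show "emeasure (orbit_kernel n (T k x)) A = emeasure (orbit_kernel n x) A"
    by (simp add: emeasure_orbit_kernel A x T_in[OF kG x])
qed (simp add: sets_orbit_kernel)

definition invariants :: "nat \<Rightarrow> 'x measure" where
  "invariants n = sigma (space X) {A \<in> sets X. \<forall>k\<in>topspace (K n). \<forall>x\<in>space X. T k x \<in> A \<longleftrightarrow> x \<in> A}"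

lemma sets_invariants:
    "sets (invariants n) = {A \<in> sets X. \<forall>k\<in>topspace (K n). \<forall>x\<in>space X. T k x \<in> A \<longleftrightarrow> x \<in> A}" (is "_ = ?S")
  and space_invariants: "space (invariants n) = space X"
proof -
  have sub: "?S \<subseteq> Pow (space X)" by (auto dest: sets.sets_into_space)
  have "sigma_algebra (space X) ?S"
    unfolding sigma_algebra_iff2
  proof (intro conjI sub ballI allI impI)
    fix s assume "s \<in> ?S"
    then show "space X - s \<in> ?S" using T_in[OF K_carrier] by auto
  next
    fix A :: "nat \<Rightarrow> 'x set" assume A: "range A \<subseteq> ?S"
    then have "(\<Union>i. A i) \<in> sets X" by (intro sets.countable_UN) blast
    then show "\<Union> (range A) \<in> ?S" using A by blast
  qed simp
  then show "sets (invariants n) = ?S"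
    unfolding invariants_def sets_measure_of[OF sub] by (rule sigma_algebra.sigma_sets_eq)
  show "space (invariants n) = space X"
    unfolding invariants_def by (rule space_measure_of[OF sub])
qed

sublocale tower: markov_tower X invariants orbit_kernel
proof
  fix n
  show "space (invariants n) = space X" by (rule space_invariants)
  show "sets (invariants n) \<subseteq> sets X" by (auto simp: sets_invariants)
  show "sets (invariants (Suc n)) \<subseteq> sets (invariants n)"
    using ascending_K[of n] by (auto simp: sets_invariants)
  show "orbit_kernel n \<in> invariants n \<rightarrow>\<^sub>M prob_algebra X"
  proof (rule measurableI)
    fix x assume "x \<in> space (invariants n)"
    then show "orbit_kernel n x \<in> space (prob_algebra X)"
      using measurable_space[OF measurable_orbit_kernel] by (simp add: space_invariants)
  next
    fix S assume "S \<in> sets (prob_algebra X)"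
    from measurable_sets[OF measurable_orbit_kernel this]
    show "orbit_kernel n -` S \<inter> space (invariants n) \<in> sets (invariants n)"
      by (simp add: sets_invariants space_invariants orbit_kernel_invariant T_in K_carrier)
  qed
  fix A x assume A: "A \<in> sets (invariants n)" and x: "x \<in> space X"
  have AX: "A \<in> sets X" using A by (simp add: sets_invariants)
  have "orbit_integral n x (indicator A) = (\<integral>\<^sup>+g. ennreal (\<rho> g x) * 1 * indicator A x \<partial>haar n)"
    unfolding orbit_integral_def
  proof (rule nn_integral_cong)
    fix g assume "g \<in> space (haar n)"
    then have "T g x \<in> A \<longleftrightarrow> x \<in> A" using A x by (simp add: sets_invariants space_haar)
    then show "ennreal (\<rho> g x) * indicator A (T g x) = ennreal (\<rho> g x) * 1 * indicator A x"
      by (simp add: indicator_def)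
  qed
  also have "\<dots> = mass n x * indicator A x"
    unfolding orbit_integral_def by (rule nn_integral_multc) (simp add: measurable_\<rho>1[OF x])
  finally show "emeasure (orbit_kernel n x) A = indicator A x"
    using mass_pos[OF x] mass_finite[OF x]
    by (cases "x \<in> A") (simp_all add: emeasure_orbit_kernel[OF AX x])
qed

definition transforms_by_cocycle :: "'x measure \<Rightarrow> 'g \<Rightarrow> bool" where
  "transforms_by_cocycle \<nu> g \<longleftrightarrow> (\<forall>f\<in>borel_measurable X.
     (\<integral>\<^sup>+y. f (T (inv g) y) \<partial>\<nu>) = (\<integral>\<^sup>+x. ennreal (\<rho> g x) * f x \<partial>\<nu>))"

text \<open>
  After Fubini and the substitution \<open>y = T g x\<close>, the integral over \<open>g\<close> becomes that of
  \<open>\<rho> (inv g) y\<close>, which is \<open>mass n y\<close> because the Haar measure is invariant under inversion.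
\<close>

lemma cocycle_imp_stationary:
  assumes \<nu>: "\<nu> \<in> space (prob_algebra X)"
    and tr: "\<And>g. g \<in> carrier G \<Longrightarrow> transforms_by_cocycle \<nu> g"
  shows "\<nu> \<in> tower.stationary"
proof -
  have s: "sets \<nu> = sets X" and "prob_space \<nu>" using \<nu> by (auto simp: space_prob_algebra)
  have sp: "space \<nu> = space X" by (rule sets_eq_imp_space_eq[OF s])
  interpret \<nu>: prob_space \<nu> by fact
  have "(\<integral>\<^sup>+x. emeasure (orbit_kernel n x) A \<partial>\<nu>) = emeasure \<nu> A" if A: "A \<in> sets X" for n A
  proof -
    interpret H: prob_space "haar n" by (rule prob_haar)
    interpret P: pair_sigma_finite \<nu> "haar n" ..
    have sP: "sets (\<nu> \<Otimes>\<^sub>M haar n) = sets (X \<Otimes>\<^sub>M haar n)" by (rule sets_pair_measure_cong[OF s refl])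
    note T [measurable] = measurable_T_haar[of n, unfolded split_beta']
    note R [measurable] = measurable_\<rho>_haar[of n, unfolded split_beta']
    have [measurable]: "mass n \<in> borel_measurable X" by (rule measurable_orbit_integral) simp
    note [measurable] = A measurable_inv_haar[of n]
    let ?f = "\<lambda>x g. ennreal (\<rho> g x) * (indicator A (T g x) / mass n x)"
    let ?h = "\<lambda>x g. ennreal (\<rho> (inv g) x) * (indicator A x / mass n x)"
    have "case_prod ?f \<in> borel_measurable (X \<Otimes>\<^sub>M haar n)"
      unfolding split_beta' by measurable
    then have f: "case_prod ?f \<in> borel_measurable (\<nu> \<Otimes>\<^sub>M haar n)"
      using measurable_cong_sets[OF sP refl] by blast
    have "(\<lambda>p. (fst p, inv (snd p))) \<in> X \<Otimes>\<^sub>M haar n \<rightarrow>\<^sub>M X \<Otimes>\<^sub>M haar n"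
      by measurable
    from measurable_compose[OF this R]
    have [measurable]: "(\<lambda>p. \<rho> (inv (snd p)) (fst p)) \<in> borel_measurable (X \<Otimes>\<^sub>M haar n)" by simp
    have "case_prod ?h \<in> borel_measurable (X \<Otimes>\<^sub>M haar n)"
      unfolding split_beta' by measurable
    then have h: "case_prod ?h \<in> borel_measurable (\<nu> \<Otimes>\<^sub>M haar n)"
      using measurable_cong_sets[OF sP refl] by blast
    have "(\<integral>\<^sup>+x. emeasure (orbit_kernel n x) A \<partial>\<nu>) = (\<integral>\<^sup>+x. (\<integral>\<^sup>+g. ?f x g \<partial>haar n) \<partial>\<nu>)"
    proof (rule nn_integral_cong)
      fix x assume "x \<in> space \<nu>"
      then have x: "x \<in> space X" by (simp add: sp)
      have "emeasure (orbit_kernel n x) A = (\<integral>\<^sup>+g. ennreal (\<rho> g x) * indicator A (T g x) / mass n x \<partial>haar n)"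
        unfolding emeasure_orbit_kernel[OF A x] orbit_integral_def[of n x "indicator A"]
        by (rule nn_integral_divide[symmetric, OF measurable_integrand1[OF _ x]]) (simp add: A)
      then show "emeasure (orbit_kernel n x) A = (\<integral>\<^sup>+g. ?f x g \<partial>haar n)"
        by (simp only: ennreal_times_divide)
    qed
    also have "\<dots> = (\<integral>\<^sup>+g. (\<integral>\<^sup>+x. ?f x g \<partial>\<nu>) \<partial>haar n)"
      by (rule P.Fubini'[OF f, symmetric])
    also have "\<dots> = (\<integral>\<^sup>+g. (\<integral>\<^sup>+x. ?h x g \<partial>\<nu>) \<partial>haar n)"
    proof (rule nn_integral_cong)
      fix g assume "g \<in> space (haar n)"
      then have gK: "g \<in> topspace (K n)" by (simp add: space_haar)
      then have gG: "g \<in> carrier G" by (rule K_carrier)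
      have "(\<lambda>x. indicator A (T g x) / mass n x) \<in> borel_measurable X"
        using measurable_T[OF gG] by measurable
      from bspec[OF tr[OF gG, unfolded transforms_by_cocycle_def] this]
      have "(\<integral>\<^sup>+x. ?f x g \<partial>\<nu>) = (\<integral>\<^sup>+y. indicator A (T g (T (inv g) y)) / mass n (T (inv g) y) \<partial>\<nu>)"
        by (rule sym)
      also have "\<dots> = (\<integral>\<^sup>+x. ?h x g \<partial>\<nu>)"
      proof (rule nn_integral_cong)
        fix y assume "y \<in> space \<nu>"
        then have y: "y \<in> space X" by (simp add: sp)
        let ?c = "\<rho> (inv g) y"
        have c: "0 < ?c" using \<rho>_pos[of "inv g" y] gG y by simp
        have "ennreal ?c * mass n (T (inv g) y) = mass n y"
          by (rule orbit_integral_translate[OF K_inv[OF gK] y]) simp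
        then have "indicator A y / mass n (T (inv g) y) = (ennreal ?c * indicator A y) / mass n y"
          using ennreal_mult_divide_cancel[OF c, of "indicator A y" "mass n (T (inv g) y)"] by simp
        then show "indicator A (T g (T (inv g) y)) / mass n (T (inv g) y) = ?h y g"
          by (simp add: T_T_inv[OF gG y] ennreal_times_divide)
      qed
      finally show "(\<integral>\<^sup>+x. ?f x g \<partial>\<nu>) = (\<integral>\<^sup>+x. ?h x g \<partial>\<nu>)" .
    qed
    also have "\<dots> = (\<integral>\<^sup>+x. (\<integral>\<^sup>+g. ?h x g \<partial>haar n) \<partial>\<nu>)"
      by (rule P.Fubini'[OF h])
    also have "\<dots> = (\<integral>\<^sup>+x. indicator A x \<partial>\<nu>)"
    proof (rule nn_integral_cong)
      fix x assume "x \<in> space \<nu>"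
      then have x: "x \<in> space X" by (simp add: sp)
      have "(\<integral>\<^sup>+g. ?h x g \<partial>haar n) = (\<integral>\<^sup>+g. ennreal (\<rho> (inv g) x) \<partial>haar n) * (indicator A x / mass n x)"
        by (rule nn_integral_multc[OF measurable_compose[OF measurable_inv_haar measurable_\<rho>1[OF x]]])
      also have "(\<integral>\<^sup>+g. ennreal (\<rho> (inv g) x) \<partial>haar n) = mass n x"
        unfolding nn_integral_haar_inv[OF measurable_\<rho>1[OF x]] orbit_integral_def by simp
      also have "mass n x * (indicator A x / mass n x) = indicator A x"
        using mass_pos[OF x] mass_finite[OF x] by (cases "x \<in> A") (simp_all add: ennreal_times_divide)
      finally show "(\<integral>\<^sup>+g. ?h x g \<partial>haar n) = indicator A x" .
    qed
    also have "\<dots> = emeasure \<nu> A" using A by (simp add: s)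
    finally show ?thesis .
  qed
  then show ?thesis using \<nu> by (simp add: tower.stationary_def)
qed

lemma nn_integral_stationary:
  assumes \<nu>: "\<nu> \<in> tower.stationary" and f: "f \<in> borel_measurable X"
  shows "(\<integral>\<^sup>+y. f y \<partial>\<nu>) = (\<integral>\<^sup>+x. orbit_integral n x f / mass n x \<partial>\<nu>)"
proof -
  note s = tower.stationaryD(2)[OF \<nu>] and sp = tower.stationaryD(3)[OF \<nu>]
  have P: "\<nu> \<in> space (prob_algebra X)" using \<nu> by (simp add: tower.stationary_def)
  have "\<nu> \<bind> orbit_kernel n = \<nu>"
  proof (rule measure_eqI)
    show sb: "sets (\<nu> \<bind> orbit_kernel n) = sets \<nu>"
      using sets_bind'[OF P measurable_orbit_kernel] by (simp add: s)
    fix A assume "A \<in> sets (\<nu> \<bind> orbit_kernel n)"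
    then have A: "A \<in> sets X" by (simp only: sb s)
    show "emeasure (\<nu> \<bind> orbit_kernel n) A = emeasure \<nu> A"
      by (simp add: emeasure_bind_prob_algebra[OF P measurable_orbit_kernel A] tower.stationaryD(4)[OF \<nu> A])
  qed
  moreover have "orbit_kernel n \<in> \<nu> \<rightarrow>\<^sub>M subprob_algebra X"
    using measurable_prob_algebraD[OF measurable_orbit_kernel] measurable_cong_sets[OF s refl] by blast
  then have "(\<integral>\<^sup>+y. f y \<partial>(\<nu> \<bind> orbit_kernel n)) = (\<integral>\<^sup>+x. (\<integral>\<^sup>+y. f y \<partial>orbit_kernel n x) \<partial>\<nu>)"
    by (rule nn_integral_bind[OF f])
  moreover have "(\<integral>\<^sup>+x. (\<integral>\<^sup>+y. f y \<partial>orbit_kernel n x) \<partial>\<nu>) = (\<integral>\<^sup>+x. orbit_integral n x f / mass n x \<partial>\<nu>)"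
    by (rule nn_integral_cong) (simp add: sp nn_integral_orbit_kernel[OF f])
  ultimately show ?thesis by simp
qed

lemma stationary_imp_cocycle:
  assumes \<nu>: "\<nu> \<in> tower.stationary" and g: "g \<in> carrier G"
  shows "transforms_by_cocycle \<nu> g"
  unfolding transforms_by_cocycle_def
proof
  fix f :: "'x \<Rightarrow> ennreal" assume f: "f \<in> borel_measurable X"
  obtain n where n: "g \<in> topspace (K n)" using g unfolding carrier_eq by blast
  have "inv g \<in> carrier G" using g by simp
  then have fT: "(\<lambda>y. f (T (inv g) y)) \<in> borel_measurable X"
    by (rule measurable_compose[OF measurable_T f])
  have \<rho>f: "(\<lambda>x. ennreal (\<rho> g x) * f x) \<in> borel_measurable X"
    using measurable_\<rho>[OF g] f by measurable
  have "(\<integral>\<^sup>+y. f (T (inv g) y) \<partial>\<nu>) = (\<integral>\<^sup>+x. orbit_integral n x (\<lambda>y. f (T (inv g) y)) / mass n x \<partial>\<nu>)"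
    by (rule nn_integral_stationary[OF \<nu> fT])
  also have "\<dots> = (\<integral>\<^sup>+x. orbit_integral n x (\<lambda>y. ennreal (\<rho> g y) * f y) / mass n x \<partial>\<nu>)"
    by (rule nn_integral_cong) (simp add: tower.stationaryD(3)[OF \<nu>] orbit_integral_left[OF n _ f])
  also have "\<dots> = (\<integral>\<^sup>+x. ennreal (\<rho> g x) * f x \<partial>\<nu>)"
    by (rule nn_integral_stationary[OF \<nu> \<rho>f, symmetric])
  finally show "(\<integral>\<^sup>+y. f (T (inv g) y) \<partial>\<nu>) = (\<integral>\<^sup>+x. ennreal (\<rho> g x) * f x \<partial>\<nu>)" .
qed

lemma RN_deriv_iff_transforms:
  assumes \<nu>: "\<nu> \<in> space (prob_algebra X)" and g: "g \<in> carrier G"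
  shows "(absolutely_continuous \<nu> (compose_measure \<nu> (T g)) \<and>
      (AE x in \<nu>. RN_deriv \<nu> (compose_measure \<nu> (T g)) x = ennreal (\<rho> g x))) \<longleftrightarrow> transforms_by_cocycle \<nu> g"
proof -
  have s: "sets \<nu> = sets X" and "prob_space \<nu>" using \<nu> by (auto simp: space_prob_algebra)
  have sp: "space \<nu> = space X" by (rule sets_eq_imp_space_eq[OF s])
  interpret prob_space \<nu> by fact
  have ig: "inv g \<in> carrier G" using g by simp
  have Tg: "T g \<in> \<nu> \<rightarrow>\<^sub>M \<nu>" and Ti: "T (inv g) \<in> \<nu> \<rightarrow>\<^sub>M \<nu>"
    using measurable_T[OF g] measurable_T[OF ig] measurable_cong_sets[OF s s] by blast+
  have \<rho>m: "(\<lambda>x. ennreal (\<rho> g x)) \<in> borel_measurable \<nu>"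
    using measurable_\<rho>[OF g] measurable_cong_sets[OF s refl] by (intro measurable_compose[OF _ measurable_ennreal]) blast
  have N: "compose_measure \<nu> (T g) = distr \<nu> \<nu> (T (inv g))"
    by (rule compose_measure_eq_distr[OF Tg Ti]) (simp_all add: sp T_inv_T T_T_inv g)
  let ?N = "distr \<nu> \<nu> (T (inv g))"
  have borel: "borel_measurable \<nu> = borel_measurable X" by (rule measurable_cong_sets[OF s refl])
  have eq: "?N = density \<nu> (\<lambda>x. ennreal (\<rho> g x)) \<longleftrightarrow> transforms_by_cocycle \<nu> g"
  proof
    assume E: "?N = density \<nu> (\<lambda>x. ennreal (\<rho> g x))"
    show "transforms_by_cocycle \<nu> g"
      unfolding transforms_by_cocycle_def
    proof
      fix f :: "'x \<Rightarrow> ennreal" assume "f \<in> borel_measurable X"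
      then have f: "f \<in> borel_measurable \<nu>" by (simp only: borel)
      have "(\<integral>\<^sup>+y. f (T (inv g) y) \<partial>\<nu>) = (\<integral>\<^sup>+y. f y \<partial>?N)"
        by (rule nn_integral_distr[OF Ti, symmetric]) (simp add: f)
      also have "\<dots> = (\<integral>\<^sup>+x. ennreal (\<rho> g x) * f x \<partial>\<nu>)"
        unfolding E by (rule nn_integral_density[OF \<rho>m f])
      finally show "(\<integral>\<^sup>+y. f (T (inv g) y) \<partial>\<nu>) = (\<integral>\<^sup>+x. ennreal (\<rho> g x) * f x \<partial>\<nu>)" .
    qed
  next
    assume tr: "transforms_by_cocycle \<nu> g"
    show "?N = density \<nu> (\<lambda>x. ennreal (\<rho> g x))"
    proof (rule measure_eqI)
      fix A assume "A \<in> sets ?N"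
      then have A: "A \<in> sets \<nu>" by simp
      have "emeasure ?N A = (\<integral>\<^sup>+y. indicator A y \<partial>?N)" using A by simp
      also have "\<dots> = (\<integral>\<^sup>+y. indicator A (T (inv g) y) \<partial>\<nu>)"
        by (rule nn_integral_distr[OF Ti]) (use A in simp)
      also have "\<dots> = (\<integral>\<^sup>+x. ennreal (\<rho> g x) * indicator A x \<partial>\<nu>)"
        using tr A unfolding transforms_by_cocycle_def by (simp add: s)
      also have "\<dots> = emeasure (density \<nu> (\<lambda>x. ennreal (\<rho> g x))) A"
        by (rule emeasure_density[OF \<rho>m A, symmetric])
      finally show "emeasure ?N A = emeasure (density \<nu> (\<lambda>x. ennreal (\<rho> g x))) A" .
    qed simp
  qed
  show ?thesis
    unfolding N eq[symmetric]
  proof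
    assume A: "absolutely_continuous \<nu> ?N \<and> (AE x in \<nu>. RN_deriv \<nu> ?N x = ennreal (\<rho> g x))"
    then have "?N = density \<nu> (RN_deriv \<nu> ?N)" by (intro density_RN_deriv[symmetric]) simp_all
    also have "\<dots> = density \<nu> (\<lambda>x. ennreal (\<rho> g x))"
      by (rule density_cong) (use A \<rho>m in simp_all)
    finally show "?N = density \<nu> (\<lambda>x. ennreal (\<rho> g x))" .
  next
    assume E: "?N = density \<nu> (\<lambda>x. ennreal (\<rho> g x))"
    have "absolutely_continuous \<nu> ?N" unfolding E by (rule absolutely_continuousI_density[OF \<rho>m])
    moreover have "AE x in \<nu>. RN_deriv \<nu> ?N x = ennreal (\<rho> g x)"
      using RN_deriv_unique[OF \<rho>m E[symmetric]] by eventually_elim simp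
    ultimately show "absolutely_continuous \<nu> ?N \<and> (AE x in \<nu>. RN_deriv \<nu> ?N x = ennreal (\<rho> g x))" ..
  qed
qed

lemma stationary_iff:
  assumes \<nu>: "\<nu> \<in> space (prob_algebra X)"
  shows "\<nu> \<in> tower.stationary \<longleftrightarrow> (\<forall>g\<in>carrier G. absolutely_continuous \<nu> (compose_measure \<nu> (T g)) \<and>
      (AE x in \<nu>. RN_deriv \<nu> (compose_measure \<nu> (T g)) x = ennreal (\<rho> g x)))"
  using RN_deriv_iff_transforms[OF \<nu>] stationary_imp_cocycle cocycle_imp_stationary[OF \<nu>] by blast

lemma sets_Finf_iff: "E \<in> sets tower.Finf \<longleftrightarrow> E \<in> sets X \<and> (\<forall>g\<in>carrier G. T g ` E = E)"
proof
  assume E: "E \<in> sets tower.Finf"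
  then have EX: "E \<in> sets X" and inv: "\<And>g x. g \<in> carrier G \<Longrightarrow> x \<in> space X \<Longrightarrow> T g x \<in> E \<longleftrightarrow> x \<in> E"
    unfolding tower.sets_Finf sets_invariants carrier_eq by blast+
  have sub: "E \<subseteq> space X" by (rule sets.sets_into_space[OF EX])
  have "T g ` E = E" if g: "g \<in> carrier G" for g
  proof
    show "T g ` E \<subseteq> E" using inv[OF g] sub by blast
    show "E \<subseteq> T g ` E"
    proof
      fix x assume x: "x \<in> E"
      then have xX: "x \<in> space X" using sub by blast
      have "T (inv g) x \<in> E" using inv[of "inv g" x] g x xX by simp
      then show "x \<in> T g ` E" using T_T_inv[OF g xX] by (intro image_eqI[of _ _ "T (inv g) x"]) simp_all
    qed
  qed
  then show "E \<in> sets X \<and> (\<forall>g\<in>carrier G. T g ` E = E)" using EX by blast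
next
  assume E: "E \<in> sets X \<and> (\<forall>g\<in>carrier G. T g ` E = E)"
  have "T g x \<in> E \<longleftrightarrow> x \<in> E" if g: "g \<in> carrier G" and x: "x \<in> space X" for g x
  proof
    assume "T g x \<in> E"
    then have "T (inv g) (T g x) \<in> T (inv g) ` E" by (rule imageI)
    moreover have "T (inv g) ` E = E" using E g by simp
    ultimately show "x \<in> E" by (simp add: T_inv_T[OF g x])
  qed (use E g in blast)
  then show "E \<in> sets tower.Finf"
    using E K_carrier by (auto simp: tower.sets_Finf sets_invariants)
qed

end

lemma restrict_space_cong_Int:
  assumes "space M \<inter> A = space M \<inter> B"
  shows "restrict_space M A = restrict_space M B"
proof -
  have "A \<inter> S = B \<inter> S" if "S \<in> sets M" for S
    using assms sets.sets_into_space[OF that] by blast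
  then have "(\<inter>) A ` sets M = (\<inter>) B ` sets M" by (intro image_cong) simp_all
  moreover have "A \<inter> space M = B \<inter> space M" using assms by blast
  ultimately show ?thesis by (simp add: restrict_space_def)
qed

lemma coordinatized_space_exists:
  assumes "standard_borel_space X"
  shows "\<exists>\<psi> \<theta>. coordinatized_space X \<psi> \<theta>"
proof -
  obtain f where f: "f \<in> X \<rightarrow>\<^sub>M restrict_space borel {0..1::real}"
    and bij: "bij_betw f (space X) (space (restrict_space borel {0..1::real}))"
    and inv: "the_inv_into (space X) f \<in> restrict_space borel {0..1::real} \<rightarrow>\<^sub>M X"
    using assms unfolding standard_borel_space_def borel_isomorphism_def by blast
  have inj: "inj_on f (space X)" and im: "f ` space X = {0..1}"
    using bij by (auto simp: bij_betw_def space_restrict_space)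
  let ?\<theta> = "\<lambda>r. the_inv_into (space X) f (max 0 (min 1 r))"
  have "coordinatized_space X f ?\<theta>"
  proof
    show "f \<in> borel_measurable X" using f by (simp add: measurable_restrict_space2_iff)
    have "(\<lambda>r::real. max 0 (min 1 r)) \<in> borel \<rightarrow>\<^sub>M restrict_space borel {0..1}"
      by (intro measurable_restrict_space2) auto
    from measurable_compose[OF this inv] show "?\<theta> \<in> borel \<rightarrow>\<^sub>M X" .
    show range: "0 \<le> f x" "f x \<le> 1" if "x \<in> space X" for x
      using that im by auto
    show "?\<theta> (f x) = x" if x: "x \<in> space X" for x
      using range[OF x] by (simp add: the_inv_into_f_f[OF inj x])
    show "f (?\<theta> r) = max 0 (min 1 r)" for r
      by (rule f_the_inv_into_f[OF inj]) (simp add: im)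
  qed
  then show ?thesis by blast
qed

theorem theorem1:
  fixes G :: "('g, 'm) monoid_scheme"
    and K :: "nat \<Rightarrow> 'g topology"
    and X :: "'x measure"
    and T :: "'g \<Rightarrow> 'x \<Rightarrow> 'x"
    and \<rho> :: "'g \<Rightarrow> 'x \<Rightarrow> real"
  assumes "inductively_compact_group G K"
    and "standard_borel_space X"
    and "measurable_action G K X T"
    and "positive_cocycle G K X T \<rho>"
    and "fibrewise_continuous K X \<rho>"
  shows "\<exists>Xt \<pi>.
    let MM = cocycle_measures G X T \<rho>;
        ME = ergodic_cocycle_measures G X T \<rho>;
        bar = pushforward_on Xt \<pi> ME
    in
      Xt \<in> sets X \<and>
      \<pi> \<in> restrict_space X Xt \<rightarrow>\<^sub>M ME \<and> \<pi> ` Xt = space ME \<and>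
      (\<forall>\<eta>\<in>space ME. \<pi> -` {\<eta>} \<inter> Xt \<in> sets X \<and> emeasure \<eta> (\<pi> -` {\<eta>} \<inter> Xt) = 1) \<and>
      (\<forall>\<nu>\<in>space MM. is_mixture X \<nu> (bar \<nu>) \<and> emeasure \<nu> Xt = 1) \<and>
      borel_isomorphism bar MM (prob_algebra ME) \<and>
      (\<forall>\<nu>\<in>space MM. \<forall>P\<in>space (prob_algebra ME). is_mixture X \<nu> P \<longrightarrow> P = bar \<nu>) \<and>
      (\<forall>\<nu>\<^sub>1\<in>space MM. \<forall>\<nu>\<^sub>2\<in>space MM.
         (absolutely_continuous \<nu>\<^sub>2 \<nu>\<^sub>1 \<longleftrightarrow> absolutely_continuous (bar \<nu>\<^sub>2) (bar \<nu>\<^sub>1)) \<and>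
         (mutually_singular \<nu>\<^sub>1 \<nu>\<^sub>2 \<longleftrightarrow> mutually_singular (bar \<nu>\<^sub>1) (bar \<nu>\<^sub>2)))"
proof -
  interpret cocycle_action G K X T \<rho>
    using assms by (intro cocycle_action.intro cocycle_action_axioms.intro)
  obtain \<psi> \<theta> where "coordinatized_space X \<psi> \<theta>"
    using coordinatized_space_exists[OF assms(2)] by blast
  then interpret coordinatized_tower X invariants orbit_kernel \<psi> \<theta>
    by (intro coordinatized_tower.intro tower.markov_tower_axioms)
  have MM: "cocycle_measures G X T \<rho> = stat_space"
    unfolding cocycle_measures_def stat_space_def
    by (rule restrict_space_cong_Int) (use stationary_iff in auto)
  have "ergodic_measure G X T = tail_trivial"
    by (rule ext) (auto simp: ergodic_measure_def tail_trivial_def sets_Finf_iff)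
  then have ME: "ergodic_cocycle_measures G X T \<rho> = erg_space"
    by (simp add: ergodic_cocycle_measures_def erg_space_def MM)
  show ?thesis
    unfolding Let_def MM ME space_stat_space
    by (rule exI[of _ good_part], rule exI[of _ limit_kernel], fold bar_def,
        intro conjI ballI impI sets_good_part_X measurable_limit_kernel_erg_space is_mixture_bar
          emeasure_good_part borel_isomorphism_bar is_mixture_unique absolutely_continuous_bar mutually_singular_bar)
      (simp_all add: space_erg_space limit_kernel_image tower.stationary_def sets_limit_kernel_fibre
        emeasure_limit_kernel_fibre[unfolded tower.stationary_def])
qed

end
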